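(* Let $n\ge1$, let $\mathfrak g$ be a finite-dimensional simple complex Lie algebra with Cartan subalgebra $\mathfrak h$, and let $\mathcal L$ be the associated full toroidal Lie algebra. Let $M\in\mathcal M(\mathcal L,\widetilde{\mathfrak h}_n)$. Then $M\cong\widehat M_{\mathcal L}(\Lambda,a,M_{\mathfrak g})$ as $\mathcal L$-modules for some $\Lambda\in(\mathbb C^* )^n$, $a\in\mathbb C$ and $M_{\mathfrak g}\in\mathcal M(\mathfrak g,\mathfrak h)$.
   Context: All vector spaces, algebras and tensor products are over $\mathbb C$. $U(\mathfrak a)$ denotes the universal enveloping algebra of a Lie algebra $\mathfrak a$. Category: for a Lie algebra $\mathfrak a$ and a finite-dimensional abelian subalgebra $\mathfrak b\subseteq\mathfrak a$, $\mathcal M(\mathfrak a,\mathfrak b)$ is the full subcategory of $U(\mathfrak a)$-modules whose restriction to $U(\mathfrak b)$ is free of rank $1$. Each object is identified with the vector space $U(\mathfrak b)$ on which $\mathfrak b$ acts by multiplication. Notation for $\mathfrak g$: $\mathfrak g$ is a finite-dimensional simple Lie algebra of rank $l$ with Chevalley generators $x_i,y_i,h_i$ ($1\le i\le l$), and $\{H_1,\dots,H_l\}$ is the basis of $\mathfrak h$ with $[H_i,x_j]=\delta_{ij}x_i$, $[H_i,y_j]=-\delta_{ij}y_j$. $(\cdot,\cdot)$ is the Killing form. Full toroidal Lie algebra: let $A=\mathbb C[t_1^{\pm1},\dots,t_n^{\pm1}]$, $t^m=t_1^{m_1}\cdots t_n^{m_n}$ for $m\in\mathbb Z^n$; $\Omega_A$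 is the free $A$-module with basis $K_1,\dots,K_n$; $dA\subseteq\Omega_A$ is the span of the elements $\sum_i m_it^mK_i$, $m\in\mathbb Z^n$; $\mathcal K_A=\Omega_A/dA$; $\mathrm{Der}(A)$ is the space of derivations of $A$, with basis $t^rd_i$ ($r\in\mathbb Z^n$, $1\le i\le n$), where $d_i=t_i\,\partial/\partial t_i$. For $u\in\mathbb C^n$ put $D(u,r)=\sum_iu_it^rd_i$, and $(u,v)=\sum_i u_iv_i$. Let $\phi$ be a fixed arbitrary linear combination of the $\mathcal K_A$-valued 2-cocycles $\phi_1(t^rd_i,t^sd_j)=-s_ir_j\sum_pr_pt^{r+s}K_p$ and $\phi_2(t^rd_i,t^sd_j)=r_is_j\sum_pr_pt^{r+s}K_p$ on $\mathrm{Der}(A)$. With $x(r)=x\otimes t^r$, $\mathcal L=(\mathfrak g\otimes A)\oplus\mathcal K_A\oplus\mathrm{Der}(A)$ has brackets $[x(r),y(s)]=[x,y](r+s)+(x,y)\sum_ir_it^{r+s}K_i$; $[\mathfrak g\otimes A,\mathcal K_A]=[\mathcal K_A,\mathcal K_A]=0$; $[t^rd_i,t^sK_j]=s_it^{r+s}K_j+\delta_{ij}\sum_pr_pt^{r+s}K_p$; $[D(u,r),D(v,s)]=D(w,r+s)+\phi(D(u,r),D(v,s))$ with $w=(u,s)v-(v,r)u$; $[D(u,r),x(s)]=(u,s)x(r+s)$. Put $D=\bigoplus_i\mathbb Cd_i$ and $\widetilde{\mathfrak h}_n=\mathfrak h\oplus D\subset\mathcal L$, so $U(\widetilde{\mathfrak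 h}_n)=\mathbb C[H_1,\dots,H_l,d_1,\dots,d_n]$. Automorphisms of $U(\widetilde{\mathfrak h}_n)$: $\sigma_i$ sends $H_i\mapsto H_i-1$ and fixes all other generators; $\tau_j$ sends $d_j\mapsto d_j-1$ and fixes all other generators. For $r\in\mathbb Z^n$, $\tau^r=\tau_1^{r_1}\cdots\tau_n^{r_n}$ and, for $\Lambda=(\lambda_1,\dots,\lambda_n)$, $\Lambda^r=\lambda_1^{r_1}\cdots\lambda_n^{r_n}$. The module $\widehat M_{\mathcal L}(\Lambda,a,M_{\mathfrak g})$: for $M_{\mathfrak g}\in\mathcal M(\mathfrak g,\mathfrak h)$, $\Lambda\in(\mathbb C^* )^n$, $a\in\mathbb C$, it is the space $U(\widetilde{\mathfrak h}_n)$ with, for $g\in U(\widetilde{\mathfrak h}_n)$, $r\in\mathbb Z^n$, $h\in\mathfrak h$: $t^rK_j.g=0$; $h(r).g=\Lambda^rh\,\tau^r(g)$; $x_i(r).g=\Lambda^r\sigma_i\tau^r(g)(x_i.1)$; $y_i(r).g=\Lambda^r\sigma_i^{-1}\tau^r(g)(y_i.1)$; $t^rd_j.g=\Lambda^r\tau^r(g)\,(d_j-r_j(a+1))$, where $x_i.1,y_i.1\in U(\mathfrak h)$ are given by the $\mathfrak g$-module structure of $M_{\mathfrak g}=U(\mathfrak h)$. This defines an $\mathcal L$-module. *)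

theory Defs
  imports "HOL-Analysis.Analysis" "HOL-Library.Poly_Mapping"
begin

section \<open>Lie algebras, modules, Cartan subalgebras\<close>

text \<open>
  A complex vector space is a type with a scalar multiplication \<open>s\<close> satisfying
  \<^const>\<open>vector_space\<close>.
\<close>

definition lie_algebra :: "(complex \<Rightarrow> 'g::ab_group_add \<Rightarrow> 'g) \<Rightarrow> ('g \<Rightarrow> 'g \<Rightarrow> 'g) \<Rightarrow> bool" where
  "lie_algebra s br \<longleftrightarrow>
     (\<forall>x. Vector_Spaces.linear s s (br x)) \<and>
     (\<forall>y. Vector_Spaces.linear s s (\<lambda>x. br x y)) \<and>
     (\<forall>x. br x x = 0) \<and>
     (\<forall>x y z. br x (br y z) + br y (br z x) + br z (br x y) = 0)"

definition finite_dim :: "(complex \<Rightarrow> 'g::ab_group_add \<Rightarrow> 'g) \<Rightarrow> bool" where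
  "finite_dim s \<longleftrightarrow> (\<exists>B. finite B \<and> module.span s B = UNIV)"

definition lie_ideal :: "(complex \<Rightarrow> 'g::ab_group_add \<Rightarrow> 'g) \<Rightarrow> ('g \<Rightarrow> 'g \<Rightarrow> 'g) \<Rightarrow> 'g set \<Rightarrow> bool" where
  "lie_ideal s br I \<longleftrightarrow> module.subspace s I \<and> (\<forall>x. \<forall>z\<in>I. br x z \<in> I)"

definition simple_lie_algebra :: "(complex \<Rightarrow> 'g::ab_group_add \<Rightarrow> 'g) \<Rightarrow> ('g \<Rightarrow> 'g \<Rightarrow> 'g) \<Rightarrow> bool" where
  "simple_lie_algebra s br \<longleftrightarrow>
     lie_algebra s br \<and> (\<exists>x y. br x y \<noteq> 0) \<and>
     (\<forall>I. lie_ideal s br I \<longrightarrow> I = {0} \<or> I = UNIV)"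

definition lie_subalgebra :: "(complex \<Rightarrow> 'g::ab_group_add \<Rightarrow> 'g) \<Rightarrow> ('g \<Rightarrow> 'g \<Rightarrow> 'g) \<Rightarrow> 'g set \<Rightarrow> bool" where
  "lie_subalgebra s br b \<longleftrightarrow> module.subspace s b \<and> (\<forall>x\<in>b. \<forall>y\<in>b. br x y \<in> b)"

primrec lower_central :: "(complex \<Rightarrow> 'g::ab_group_add \<Rightarrow> 'g) \<Rightarrow> ('g \<Rightarrow> 'g \<Rightarrow> 'g) \<Rightarrow> 'g set \<Rightarrow> nat \<Rightarrow> 'g set" where
  "lower_central s br h 0 = h"
| "lower_central s br h (Suc k) = module.span s {br x z |x z. x \<in> h \<and> z \<in> lower_central s br h k}"

definition cartan_subalgebra :: "(complex \<Rightarrow> 'g::ab_group_add \<Rightarrow> 'g) \<Rightarrow> ('g \<Rightarrow> 'g \<Rightarrow> 'g) \<Rightarrow> 'g set \<Rightarrow> bool" where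
  "cartan_subalgebra s br h \<longleftrightarrow>
     lie_subalgebra s br h \<and>
     (\<exists>k. lower_central s br h k = {0}) \<and>
     {x. \<forall>z\<in>h. br x z \<in> h} = h"

definition lin_trace :: "(complex \<Rightarrow> 'g::ab_group_add \<Rightarrow> 'g) \<Rightarrow> ('g \<Rightarrow> 'g) \<Rightarrow> complex" where
  "lin_trace s f =
     (let B = vector_space.extend_basis s {} in \<Sum>b\<in>B. module.representation s B (f b) b)"

definition killing :: "(complex \<Rightarrow> 'g::ab_group_add \<Rightarrow> 'g) \<Rightarrow> ('g \<Rightarrow> 'g \<Rightarrow> 'g) \<Rightarrow> 'g \<Rightarrow> 'g \<Rightarrow> complex" where
  "killing s br x y = lin_trace s (\<lambda>z. br x (br y z))"

text \<open>
  Elements of the dual space of \<open>h\<close> are represented by functions on the whole type, of which only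
  the restriction to \<open>h\<close> matters.
\<close>

definition linear_form_on :: "(complex \<Rightarrow> 'g::ab_group_add \<Rightarrow> 'g) \<Rightarrow> 'g set \<Rightarrow> ('g \<Rightarrow> complex) \<Rightarrow> bool" where
  "linear_form_on s h \<alpha> \<longleftrightarrow>
     (\<forall>z\<in>h. \<forall>w\<in>h. \<alpha> (z + w) = \<alpha> z + \<alpha> w) \<and> (\<forall>c. \<forall>z\<in>h. \<alpha> (s c z) = c * \<alpha> z)"

definition root_space :: "(complex \<Rightarrow> 'g::ab_group_add \<Rightarrow> 'g) \<Rightarrow> ('g \<Rightarrow> 'g \<Rightarrow> 'g) \<Rightarrow> 'g set \<Rightarrow> ('g \<Rightarrow> complex) \<Rightarrow> 'g set" where
  "root_space s br h \<alpha> = {x. \<forall>z\<in>h. br z x = s (\<alpha> z) x}"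

definition is_root :: "(complex \<Rightarrow> 'g::ab_group_add \<Rightarrow> 'g) \<Rightarrow> ('g \<Rightarrow> 'g \<Rightarrow> 'g) \<Rightarrow> 'g set \<Rightarrow> ('g \<Rightarrow> complex) \<Rightarrow> bool" where
  "is_root s br h \<alpha> \<longleftrightarrow>
     linear_form_on s h \<alpha> \<and> (\<exists>z\<in>h. \<alpha> z \<noteq> 0) \<and> root_space s br h \<alpha> \<noteq> {0}"

definition simple_roots :: "(complex \<Rightarrow> 'g::ab_group_add \<Rightarrow> 'g) \<Rightarrow> ('g \<Rightarrow> 'g \<Rightarrow> 'g) \<Rightarrow> 'g set \<Rightarrow> ('l::finite \<Rightarrow> 'g \<Rightarrow> complex) \<Rightarrow> bool" where
  "simple_roots s br h \<alpha> \<longleftrightarrow>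
     (\<forall>i. is_root s br h (\<alpha> i)) \<and>
     (\<forall>c. (\<forall>z\<in>h. (\<Sum>i\<in>UNIV. c i * \<alpha> i z) = 0) \<longrightarrow> (\<forall>i. c i = 0)) \<and>
     (\<forall>\<beta>. is_root s br h \<beta> \<longrightarrow>
        (\<exists>k :: 'l \<Rightarrow> int. ((\<forall>i. 0 \<le> k i) \<or> (\<forall>i. k i \<le> 0)) \<and>
           (\<forall>z\<in>h. \<beta> z = (\<Sum>i\<in>UNIV. of_int (k i) * \<alpha> i z))))"

definition chevalley_generators ::
  "(complex \<Rightarrow> 'g::ab_group_add \<Rightarrow> 'g) \<Rightarrow> ('g \<Rightarrow> 'g \<Rightarrow> 'g) \<Rightarrow> 'g set \<Rightarrow>
   ('l::finite \<Rightarrow> 'g) \<Rightarrow> ('l \<Rightarrow> 'g) \<Rightarrow> ('l \<Rightarrow> 'g) \<Rightarrow> bool" where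
  "chevalley_generators s br h x y hc \<longleftrightarrow>
     (\<exists>\<alpha>. simple_roots s br h \<alpha> \<and>
        (\<forall>i. x i \<in> root_space s br h (\<alpha> i) \<and> y i \<in> root_space s br h (\<lambda>z. - \<alpha> i z) \<and>
             hc i = br (x i) (y i) \<and> \<alpha> i (hc i) = 2))"

definition basis_family :: "(complex \<Rightarrow> 'v::ab_group_add \<Rightarrow> 'v) \<Rightarrow> ('i \<Rightarrow> 'v) \<Rightarrow> 'v set \<Rightarrow> bool" where
  "basis_family s e b \<longleftrightarrow> inj e \<and> \<not> module.dependent s (range e) \<and> module.span s (range e) = b"

definition dual_cartan_basis ::
  "(complex \<Rightarrow> 'g::ab_group_add \<Rightarrow> 'g) \<Rightarrow> ('g \<Rightarrow> 'g \<Rightarrow> 'g) \<Rightarrow> 'g set \<Rightarrow>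
   ('l::finite \<Rightarrow> 'g) \<Rightarrow> ('l \<Rightarrow> 'g) \<Rightarrow> ('l \<Rightarrow> 'g) \<Rightarrow> bool" where
  "dual_cartan_basis s br h x y H \<longleftrightarrow>
     basis_family s H h \<and>
     (\<forall>i j. br (H i) (x j) = (if i = j then x j else 0) \<and>
            br (H i) (y j) = (if i = j then - y j else 0))"

text \<open>A \<open>U(\<aa>)\<close>-module is the same thing as a representation of \<open>\<aa>\<close>.\<close>

definition lie_module ::
  "(complex \<Rightarrow> 'a::ab_group_add \<Rightarrow> 'a) \<Rightarrow> ('a \<Rightarrow> 'a \<Rightarrow> 'a) \<Rightarrow>
   (complex \<Rightarrow> 'm::ab_group_add \<Rightarrow> 'm) \<Rightarrow> ('a \<Rightarrow> 'm \<Rightarrow> 'm) \<Rightarrow> bool" where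
  "lie_module s br sM act \<longleftrightarrow>
     (\<forall>x. Vector_Spaces.linear sM sM (act x)) \<and>
     (\<forall>v. Vector_Spaces.linear s sM (\<lambda>x. act x v)) \<and>
     (\<forall>x y v. act (br x y) v = act x (act y v) - act y (act x v))"

definition lie_module_iso ::
  "(complex \<Rightarrow> 'm::ab_group_add \<Rightarrow> 'm) \<Rightarrow> ('a \<Rightarrow> 'm \<Rightarrow> 'm) \<Rightarrow>
   (complex \<Rightarrow> 'k::ab_group_add \<Rightarrow> 'k) \<Rightarrow> ('a \<Rightarrow> 'k \<Rightarrow> 'k) \<Rightarrow> ('m \<Rightarrow> 'k) \<Rightarrow> bool" where
  "lie_module_iso sM actM sN actN F \<longleftrightarrow>
     Vector_Spaces.linear sM sN F \<and> bij F \<and> (\<forall>x v. F (actM x v) = actN x (F v))"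

section \<open>Polynomial rings\<close>

lemma pm_induct [case_names single add]:
  fixes p :: "'a \<Rightarrow>\<^sub>0 'b::comm_monoid_add"
  assumes "\<And>k c. P (Poly_Mapping.single k c)" "\<And>p q. P p \<Longrightarrow> P q \<Longrightarrow> P (p + q)"
  shows "P p"
proof (induction p rule: Poly_Mapping.update_induct)
  case const
  show ?case using assms(1)[of undefined 0] by simp
next
  case (update f a b)
  have "Poly_Mapping.update a b f = f + Poly_Mapping.single a b"
    using update(1)
    by (intro poly_mapping_eqI)
       (auto simp: lookup_update lookup_add lookup_single not_in_keys_iff_lookup_eq_zero)
  then show ?case using assms update by simp
qed

text \<open>\<open>\<complex>[X\<^sub>v | v :: 'v]\<close>\<close>
type_synonym 'v cpoly = "('v \<Rightarrow>\<^sub>0 nat) \<Rightarrow>\<^sub>0 complex"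

definition pconst :: "complex \<Rightarrow> 'v cpoly" where
  "pconst c = Poly_Mapping.single 0 c"

definition pvar :: "'v \<Rightarrow> 'v cpoly" where
  "pvar v = Poly_Mapping.single (Poly_Mapping.single v 1) 1"

definition cscale :: "complex \<Rightarrow> ('k \<Rightarrow>\<^sub>0 complex) \<Rightarrow> ('k \<Rightarrow>\<^sub>0 complex)" where
  "cscale c = Poly_Mapping.map ((*) c)"

text \<open>The algebra homomorphism with \<open>X\<^sub>v \<mapsto> f v\<close>.\<close>
definition psubst :: "('v::finite \<Rightarrow> 'w cpoly) \<Rightarrow> 'v cpoly \<Rightarrow> 'w cpoly" where
  "psubst f p = (\<Sum>m\<in>Poly_Mapping.keys p.
     pconst (Poly_Mapping.lookup p m) * (\<Prod>v\<in>UNIV. f v ^ Poly_Mapping.lookup m v))"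

lemma psubst_single:
  "psubst f (Poly_Mapping.single m c) = pconst c * (\<Prod>v\<in>UNIV. f v ^ Poly_Mapping.lookup m v)"
  by (simp add: psubst_def pconst_def)

lemma psubst_add: "psubst f (p + q) = psubst f p + psubst f q"
  unfolding psubst_def
  by (rule setsum_keys_plus_distrib) (simp_all add: pconst_def single_add distrib_right)

lemma pconst_1: "pconst 1 = 1" and pconst_0: "pconst 0 = 0"
  and pconst_add: "pconst (c + d) = pconst c + pconst d"
  and pconst_mult: "pconst (c * d) = pconst c * pconst d"
  by (simp_all add: pconst_def single_add mult_single)

lemma psubst_mult: "psubst f (p * q) = psubst f p * psubst f q"
proof (induction p rule: pm_induct)
  case (single k c)
  show ?case
  proof (induction q rule: pm_induct)
    case (single l d)
    show ?case
      by (simp add: mult_single psubst_single pconst_mult lookup_add power_add prod.distrib mult_ac)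
  qed (simp add: psubst_add distrib_left)
qed (simp add: psubst_add distrib_right)

lemma psubst_pconst: "psubst f (pconst c) = pconst c"
  by (simp add: psubst_single pconst_def)

lemma psubst_pvar: "psubst f (pvar v) = f v"
proof -
  have "(\<Prod>w\<in>UNIV. f w ^ Poly_Mapping.lookup (Poly_Mapping.single v 1) w) = (\<Prod>w\<in>UNIV. if w = v then f v else 1)"
    by (rule prod.cong) (auto simp: lookup_single when_def)
  then show ?thesis by (simp add: pvar_def psubst_single pconst_def)
qed

lemma psubst_1: "psubst f 1 = 1"
  using psubst_pconst [of f 1] by (simp add: pconst_1)

lemma psubst_power: "psubst f (p ^ k) = psubst f p ^ k"
  by (induction k) (simp_all add: psubst_1 psubst_mult)

lemma psubst_prod: "psubst f (\<Prod>x\<in>X. g x) = (\<Prod>x\<in>X. psubst f (g x))"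
  by (induction X rule: infinite_finite_induct) (simp_all add: psubst_1 psubst_mult)

lemma psubst_psubst: "psubst f (psubst g p) = psubst (\<lambda>v. psubst f (g v)) p"
  by (induction p rule: pm_induct)
     (simp_all add: psubst_add psubst_single psubst_mult psubst_pconst psubst_prod psubst_power)

lemma psubst_ident: "psubst pvar p = p"
proof (induction p rule: pm_induct)
  case (single m c)
  have pow: "pvar v ^ k = Poly_Mapping.single (Poly_Mapping.single v k) 1" for v :: 'a and k
    by (induction k) (simp_all add: pvar_def mult_single single_add [symmetric])
  have prod: "(\<Prod>v\<in>X. Poly_Mapping.single (g v) (1::complex)) = Poly_Mapping.single (\<Sum>v\<in>X. g v) 1"
    if "finite X" for X :: "'a set" and g :: "'a \<Rightarrow> 'a \<Rightarrow>\<^sub>0 nat"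
    using that by (induction X) (simp_all add: mult_single)
  have sum: "(\<Sum>v\<in>UNIV. Poly_Mapping.single v (Poly_Mapping.lookup m v)) = m"
    by (intro poly_mapping_eqI) (simp add: lookup_sum lookup_single when_def)
  have "(\<Prod>v\<in>UNIV. pvar v ^ Poly_Mapping.lookup m v) = Poly_Mapping.single m 1"
    by (simp only: pow prod [OF finite] sum)
  then show ?case
    by (simp add: psubst_single pconst_def mult_single)
qed (simp add: psubst_add)

section \<open>The category \<open>\<M>(\<aa>, \<bb>)\<close>\<close>

text \<open>
  For an abelian Lie algebra \<open>\<bb>\<close> with basis \<open>e\<close>, \<open>U(\<bb>)\<close> is the polynomial ring in the \<open>e i\<close>.
  A module is free of rank 1 over \<open>U(\<bb>)\<close> iff it is isomorphic to \<open>U(\<bb>)\<close> with \<open>\<bb>\<close> acting by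
  multiplication.
\<close>

definition free_rank_one ::
  "('i \<Rightarrow> 'a) \<Rightarrow> (complex \<Rightarrow> 'm::ab_group_add \<Rightarrow> 'm) \<Rightarrow> ('a \<Rightarrow> 'm \<Rightarrow> 'm) \<Rightarrow> bool" where
  "free_rank_one e sM act \<longleftrightarrow>
     (\<exists>\<Phi> :: 'i cpoly \<Rightarrow> 'm. Vector_Spaces.linear cscale sM \<Phi> \<and> bij \<Phi> \<and>
        (\<forall>i p. \<Phi> (pvar i * p) = act (e i) (\<Phi> p)))"

definition category_M ::
  "(complex \<Rightarrow> 'a::ab_group_add \<Rightarrow> 'a) \<Rightarrow> ('a \<Rightarrow> 'a \<Rightarrow> 'a) \<Rightarrow> 'a set \<Rightarrow> ('i::finite \<Rightarrow> 'a) \<Rightarrow>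
   (complex \<Rightarrow> 'm::ab_group_add \<Rightarrow> 'm) \<Rightarrow> ('a \<Rightarrow> 'm \<Rightarrow> 'm) \<Rightarrow> bool" where
  "category_M s br b e sM act \<longleftrightarrow>
     lie_subalgebra s br b \<and> (\<forall>x\<in>b. \<forall>y\<in>b. br x y = 0) \<and> basis_family s e b \<and>
     lie_module s br sM act \<and> free_rank_one e sM act"

section \<open>Laurent polynomials, derivations and differentials\<close>

type_synonym 'n laurent = "(int, 'n) vec \<Rightarrow>\<^sub>0 complex"

definition tpow :: "int ^ 'n::finite \<Rightarrow> 'n laurent" where
  "tpow m = Poly_Mapping.single m 1"

text \<open>\<open>d\<^sub>i = t\<^sub>i \<partial>/\<partial>t\<^sub>i\<close>, so \<open>d\<^sub>i t\<^sup>m = m\<^sub>i t\<^sup>m\<close>\<close>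
definition ldiff :: "'n::finite \<Rightarrow> 'n laurent \<Rightarrow> 'n laurent" where
  "ldiff i = Poly_Mapping.mapp (\<lambda>m c. of_int (m $ i) * c)"

lemma lookup_ldiff [simp]:
  "Poly_Mapping.lookup (ldiff i f) m = of_int (m $ i) * Poly_Mapping.lookup f m"
  by (simp add: ldiff_def lookup_mapp when_def in_keys_iff)

lemma ldiff_zero [simp]: "ldiff i 0 = 0"
  and ldiff_add: "ldiff i (f + g) = ldiff i f + ldiff i g"
  and ldiff_minus: "ldiff i (f - g) = ldiff i f - ldiff i g"
  and ldiff_uminus: "ldiff i (- f) = - ldiff i f"
  and ldiff_commute: "ldiff i (ldiff j f) = ldiff j (ldiff i f)"
  and ldiff_single: "ldiff i (Poly_Mapping.single m c) = Poly_Mapping.single m (of_int (m $ i) * c)"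
  by (auto intro!: poly_mapping_eqI simp: lookup_add lookup_minus lookup_single when_def algebra_simps)

lemma ldiff_sum: "ldiff i (sum f X) = (\<Sum>x\<in>X. ldiff i (f x))"
  by (induction X rule: infinite_finite_induct) (auto simp: ldiff_add)

lemma ldiff_mult: "ldiff i (f * g) = ldiff i f * g + f * ldiff i g"
proof (induction f rule: pm_induct)
  case (single k c)
  show ?case
  proof (induction g rule: pm_induct)
    case (single l d)
    show ?case
      by (simp add: mult_single ldiff_single single_add [symmetric] algebra_simps)
  qed (simp add: ldiff_add algebra_simps)
qed (simp add: ldiff_add algebra_simps)

lemma lookup_cscale [simp]:
  "Poly_Mapping.lookup (cscale c f) m = c * Poly_Mapping.lookup f m"
  by (simp add: cscale_def Poly_Mapping.map.rep_eq when_def)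

lemma ldiff_cscale: "ldiff i (cscale c f) = cscale c (ldiff i f)"
  by (auto intro!: poly_mapping_eqI)

lemma cscale_mult: "cscale c f * g = cscale c (f * g)"
  by (simp add: cscale_def mult_map_scale_conv_mult mult.assoc)

lemma mult_cscale: "f * cscale c g = cscale c (f * g)" for g :: "'k::comm_monoid_add \<Rightarrow>\<^sub>0 complex"
  using cscale_mult [of c g f] by (simp only: mult.commute)

lemma vector_space_cscale: "vector_space cscale"
  by unfold_locales (auto intro!: poly_mapping_eqI simp: lookup_add algebra_simps)

text \<open>
  \<open>Der(A)\<close> is the free \<open>A\<close>-module on \<open>d\<^sub>1, \<dots>, d\<^sub>n\<close>: the vector \<open>u\<close> stands for the derivation
  \<open>\<Sum>\<^sub>i u\<^sub>i d\<^sub>i\<close> (see \<open>der_apply_bij\<close> below).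
\<close>
type_synonym 'n der = "('n laurent, 'n) vec"

text \<open>The vector \<open>\<omega>\<close> stands for \<open>\<Sum>\<^sub>i \<omega>\<^sub>i K\<^sub>i\<close>.\<close>
type_synonym 'n omega = "('n laurent, 'n) vec"

definition der_apply :: "'n::finite der \<Rightarrow> 'n laurent \<Rightarrow> 'n laurent" where
  "der_apply u f = (\<Sum>i\<in>UNIV. u $ i * ldiff i f)"

definition derivations :: "('n::finite laurent \<Rightarrow> 'n laurent) set" where
  "derivations = {\<delta>. Vector_Spaces.linear cscale cscale \<delta> \<and> (\<forall>f g. \<delta> (f * g) = \<delta> f * g + f * \<delta> g)}"

definition ext_d :: "'n::finite laurent \<Rightarrow> 'n omega" where
  "ext_d f = (\<chi> i. ldiff i f)"

definition vscale :: "complex \<Rightarrow> ('n laurent, 'n::finite) vec \<Rightarrow> ('n laurent, 'n) vec" where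
  "vscale c u = (\<chi> i. cscale c (u $ i))"

lemma ext_d_zero: "ext_d 0 = 0" 
  and ext_d_add: "ext_d (f + g) = ext_d f + ext_d g"
  and ext_d_uminus: "ext_d (- f) = - ext_d f"
  and ext_d_minus: "ext_d (f - g) = ext_d f - ext_d g"
  and ext_d_cscale: "ext_d (cscale c f) = vscale c (ext_d f)"
  by (simp_all add: ext_d_def vec_eq_iff ldiff_add ldiff_uminus ldiff_minus ldiff_cscale vscale_def)

text \<open>\<open>\<K>\<^sub>A = \<Omega>\<^sub>A/dA\<close>\<close>
quotient_type (overloaded) 'n kah = "('n::finite laurent, 'n) vec" / "\<lambda>\<omega> \<eta>. \<omega> - \<eta> \<in> range ext_d"
  morphisms rep_kah abs_kah
proof (rule equivpI)
  show "reflp (\<lambda>\<omega> \<eta>. \<omega> - \<eta> \<in> range (ext_d :: 'n laurent \<Rightarrow> 'n omega))"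
    by (rule reflpI) (metis diff_self ext_d_zero rangeI)
  show "symp (\<lambda>\<omega> \<eta>. \<omega> - \<eta> \<in> range (ext_d :: 'n laurent \<Rightarrow> 'n omega))"
    by (rule sympI) (metis (no_types, lifting) ext_d_uminus imageE minus_diff_eq rangeI)
  show "transp (\<lambda>\<omega> \<eta>. \<omega> - \<eta> \<in> range (ext_d :: 'n laurent \<Rightarrow> 'n omega))"
  proof (rule transpI)
    fix x y z :: "'n omega"
    assume "x - y \<in> range ext_d" "y - z \<in> range ext_d"
    then obtain f g where "x - y = ext_d f" "y - z = ext_d g" by auto
    then have "x - z = ext_d (f + g)" by (simp add: ext_d_add algebra_simps)
    then show "x - z \<in> range ext_d" by blast
  qed
qed

instantiation kah :: (finite) ab_group_add
begin
lift_definition zero_kah :: "'a kah" is 0 .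
lift_definition plus_kah :: "'a kah \<Rightarrow> 'a kah \<Rightarrow> 'a kah" is "(+)"
  by (metis (no_types, opaque_lifting) add_diff_add ext_d_add imageE rangeI)
lift_definition uminus_kah :: "'a kah \<Rightarrow> 'a kah" is uminus
  by (metis (no_types, opaque_lifting) ext_d_uminus imageE minus_diff_minus rangeI)
definition minus_kah :: "'a kah \<Rightarrow> 'a kah \<Rightarrow> 'a kah" where "minus_kah a b = a + - b"
instance
proof
  have refl: "(x::'a omega) - x \<in> range ext_d" for x
    by (metis diff_self ext_d_zero rangeI)
  fix a b c :: "'a kah"
  show "a + b + c = a + (b + c)"
    by transfer (simp only: add.assoc refl)
  show "a + b = b + a"
    by transfer (metis add.commute refl)
  show "0 + a = a"
    by transfer (simp only: add_0_left refl)
  show "- a + a = 0"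
    by transfer (simp only: add.left_inverse refl)
  show "a - b = a + - b" by (simp add: minus_kah_def)
qed
end

lift_definition kah_scale :: "complex \<Rightarrow> 'n::finite kah \<Rightarrow> 'n kah" is vscale
proof -
  fix c and x y :: "'n omega"
  assume "x - y \<in> range ext_d"
  then obtain f where f: "x - y = ext_d f" by auto
  have "vscale c x - vscale c y = vscale c (x - y)"
    by (simp add: vscale_def vec_eq_iff) (auto intro!: poly_mapping_eqI simp: lookup_minus right_diff_distrib)
  then show "vscale c x - vscale c y \<in> range ext_d"
    by (metis ext_d_cscale f rangeI)
qed

text \<open>
  The action of \<open>Der(A)\<close> on \<open>\<Omega>\<^sub>A\<close>: the \<open>A\<close>-expanded form of
  \<open>t\<^sup>r d\<^sub>i \<cdot> t\<^sup>s K\<^sub>j = s\<^sub>i t\<^sup>r\<^sup>+\<^sup>s K\<^sub>j + \<delta>\<^sub>i\<^sub>j \<Sum>\<^sub>p r\<^sub>p t\<^sup>r\<^sup>+\<^sup>s K\<^sub>p\<close>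
  (see \<open>kah_act_basis\<close>).
\<close>
definition lie_deriv :: "'n::finite der \<Rightarrow> 'n omega \<Rightarrow> 'n omega" where
  "lie_deriv u \<omega> = (\<chi> p. \<Sum>i\<in>UNIV. u $ i * ldiff i (\<omega> $ p) + \<omega> $ i * ldiff p (u $ i))"

lemma lie_deriv_ext_d: "lie_deriv u (ext_d f) = ext_d (der_apply u f)"
  by (simp add: lie_deriv_def ext_d_def der_apply_def vec_eq_iff ldiff_sum ldiff_mult)
     (auto intro!: sum.cong simp: ldiff_commute algebra_simps)

lemma lie_deriv_diff: "lie_deriv u (\<omega> - \<eta>) = lie_deriv u \<omega> - lie_deriv u \<eta>"
  by (simp add: lie_deriv_def vec_eq_iff ldiff_minus sum_subtractf [symmetric] algebra_simps)

lift_definition kah_act :: "'n::finite der \<Rightarrow> 'n kah \<Rightarrow> 'n kah" is lie_deriv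
  by (metis (no_types, lifting) imageE lie_deriv_diff lie_deriv_ext_d rangeI)

text \<open>The vector field bracket and the two cocycles in \<open>A\<close>-expanded form; see
  \<open>der_bracket_basis\<close>, \<open>phi1_basis\<close> and \<open>phi2_basis\<close> for the values on basis elements.\<close>

definition der_bracket :: "'n::finite der \<Rightarrow> 'n der \<Rightarrow> 'n der" where
  "der_bracket u v = (\<chi> p. \<Sum>i\<in>UNIV. u $ i * ldiff i (v $ p) - v $ i * ldiff i (u $ p))"

definition phi1 :: "'n::finite der \<Rightarrow> 'n der \<Rightarrow> 'n kah" where
  "phi1 u v = abs_kah (\<chi> p. - (\<Sum>i\<in>UNIV. \<Sum>j\<in>UNIV. ldiff p (ldiff j (u $ i)) * ldiff i (v $ j)))"

definition phi2 :: "'n::finite der \<Rightarrow> 'n der \<Rightarrow> 'n kah" where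
  "phi2 u v = abs_kah (\<chi> p. \<Sum>i\<in>UNIV. \<Sum>j\<in>UNIV. ldiff p (ldiff i (u $ i)) * ldiff j (v $ j))"

subsection \<open>Agreement with the customary descriptions\<close>

lemma tpow_add: "tpow (r + q) = tpow r * tpow q"
  by (simp add: tpow_def mult_single)

lemma tpow_0: "tpow 0 = 1"
  by (simp add: tpow_def)

lemma ldiff_tpow: "ldiff i (tpow m) = of_int (m $ i) * tpow m"
  by (simp add: tpow_def ldiff_single mult_single flip: single_of_int)

lemma of_int_mult_eq_cscale: "of_int k * f = cscale (of_int k) f"
  by (simp add: cscale_def mult_map_scale_conv_mult)

lemma single_eq_cscale: "Poly_Mapping.single m c = cscale c (tpow m)"
  by (auto intro!: poly_mapping_eqI simp: tpow_def lookup_single when_def)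

lemma der_apply_bracket:
  "der_apply (der_bracket u v) f = der_apply u (der_apply v f) - der_apply v (der_apply u f)"
proof -
  have 1: "der_apply u (der_apply v f) =
      (\<Sum>p\<in>UNIV. \<Sum>i\<in>UNIV. u $ i * ldiff i (v $ p) * ldiff p f) +
      (\<Sum>i\<in>UNIV. \<Sum>p\<in>UNIV. u $ i * v $ p * ldiff i (ldiff p f))" for u v :: "'a der"
  proof -
    have "der_apply u (der_apply v f) =
        (\<Sum>i\<in>UNIV. \<Sum>p\<in>UNIV. u $ i * ldiff i (v $ p) * ldiff p f) +
        (\<Sum>i\<in>UNIV. \<Sum>p\<in>UNIV. u $ i * v $ p * ldiff i (ldiff p f))"
      by (simp add: der_apply_def ldiff_sum ldiff_mult sum_distrib_left sum.distrib [symmetric]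
          distrib_left mult.assoc)
    then show ?thesis by (subst sum.swap)
  qed
  have 2: "(\<Sum>i\<in>UNIV. \<Sum>p\<in>UNIV. v $ i * u $ p * ldiff i (ldiff p f)) =
      (\<Sum>i\<in>UNIV. \<Sum>p\<in>UNIV. u $ i * v $ p * ldiff i (ldiff p f))"
    by (subst sum.swap) (auto intro!: sum.cong simp: ldiff_commute mult.commute)
  show ?thesis
    unfolding 1 2
    by (simp add: der_apply_def der_bracket_def sum_distrib_right sum_subtractf left_diff_distrib)
qed

lemma der_apply_add: "der_apply u (f + g) = der_apply u f + der_apply u g"
  by (simp add: der_apply_def ldiff_add distrib_left sum.distrib)

lemma der_apply_cscale: "der_apply u (cscale c f) = cscale c (der_apply u f)"
proof -
  interpret vector_space "cscale :: complex \<Rightarrow> 'a laurent \<Rightarrow> 'a laurent"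
    by (rule vector_space_cscale)
  show ?thesis by (simp add: der_apply_def ldiff_cscale mult_cscale scale_sum_right)
qed

lemma der_apply_bij: "bij_betw der_apply (UNIV :: 'n::finite der set) derivations"
proof (rule bij_betw_imageI)
  have inv: "tpow m * tpow (- m) = 1" for m :: "int ^ 'n"
    by (simp flip: tpow_add add: tpow_0)
  have val: "der_apply u (tpow (axis j 1)) = u $ j * tpow (axis j 1)" for u :: "'n der" and j
  proof -
    have "der_apply u (tpow (axis j 1)) = (\<Sum>i\<in>UNIV. if i = j then u $ j * tpow (axis j 1) else 0)"
      unfolding der_apply_def by (rule sum.cong) (auto simp: ldiff_tpow axis_def)
    then show ?thesis by simp
  qed
  show "inj (der_apply :: 'n der \<Rightarrow> _)"
  proof (rule injI)
    fix u v :: "'n der"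
    assume eq: "der_apply u = der_apply v"
    have "u $ j = v $ j" for j
    proof -
      have "u $ j * tpow (axis j 1) * tpow (- axis j 1) = v $ j * tpow (axis j 1) * tpow (- axis j 1)"
        using eq val by metis
      then show ?thesis by (simp add: mult.assoc inv)
    qed
    then show "u = v" by (simp add: vec_eq_iff)
  qed
  show "range (der_apply :: 'n der \<Rightarrow> _) = derivations"
  proof (intro equalityI subsetI)
    fix \<delta> :: "'n laurent \<Rightarrow> 'n laurent"
    assume "\<delta> \<in> range der_apply"
    then obtain u where \<delta>: "\<delta> = der_apply u" by auto
    interpret vector_space "cscale :: complex \<Rightarrow> 'n laurent \<Rightarrow> 'n laurent"
      by (rule vector_space_cscale)
    have "Vector_Spaces.linear cscale cscale \<delta>"
      unfolding \<delta>
      by unfold_locales (rule der_apply_add der_apply_cscale)+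
    moreover have "\<delta> (f * g) = \<delta> f * g + f * \<delta> g" for f g
      unfolding \<delta> der_apply_def sum_distrib_left sum_distrib_right sum.distrib [symmetric]
      by (rule sum.cong) (simp_all add: ldiff_mult distrib_left mult_ac)
    ultimately show "\<delta> \<in> derivations"
      by (simp add: derivations_def)
  next
    fix \<delta> :: "'n laurent \<Rightarrow> 'n laurent"
    assume "\<delta> \<in> derivations"
    then have lin: "Vector_Spaces.linear cscale cscale \<delta>"
      and leib: "\<And>f g. \<delta> (f * g) = \<delta> f * g + f * \<delta> g"
      by (auto simp: derivations_def)
    interpret hom: Vector_Spaces.linear cscale cscale \<delta> by (fact lin)
    define \<chi>' where "\<chi>' m = tpow (- m) * \<delta> (tpow m)" for m :: "int ^ 'n"
    have \<delta>_\<chi>: "\<delta> (tpow m) = tpow m * \<chi>' m" for m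
      by (simp add: \<chi>'_def mult.assoc [symmetric] inv)
    have add: "\<chi>' (r + q) = \<chi>' r + \<chi>' q" for r q
    proof -
      have "\<chi>' (r + q) = tpow (- r) * tpow (- q) * (tpow r * \<chi>' r * tpow q + tpow r * (tpow q * \<chi>' q))"
      proof -
        have "tpow (- (r + q)) = tpow (- r) * tpow (- q)"
          by (simp flip: tpow_add)
        moreover have "\<delta> (tpow (r + q)) = tpow r * \<chi>' r * tpow q + tpow r * (tpow q * \<chi>' q)"
          using leib[of "tpow r" "tpow q"] by (simp only: tpow_add \<delta>_\<chi>)
        ultimately show ?thesis by (simp only: \<chi>'_def [of "r + q"])
      qed
      also have "\<dots> = (tpow r * tpow (- r)) * (tpow q * tpow (- q)) * (\<chi>' r + \<chi>' q)"
        by (simp add: algebra_simps)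
      finally show ?thesis by (simp add: inv)
    qed
    have z: "\<chi>' 0 = 0" using add[of 0 0] by simp
    have sum: "\<chi>' (sum f X) = (\<Sum>i\<in>X. \<chi>' (f i))" for f and X :: "'n set"
      by (induction X rule: infinite_finite_induct) (auto simp: z add)
    have ax: "\<chi>' (axis i k) = of_int k * \<chi>' (axis i 1)" for i k
    proof -
      have ax_add: "axis i (k + l) = axis i k + (axis i l :: int ^ 'n)" for k l
        by (simp add: axis_def vec_eq_iff)
      show ?thesis
      proof (induction k rule: int_induct [where k = 0])
        case base
        have "axis i 0 = (0 :: int ^ 'n)" by (simp add: axis_def vec_eq_iff)
        then show ?case by (simp only: z) simp
      next
        case (step1 k)
        then show ?case by (simp add: ax_add add algebra_simps)
      next
        case (step2 k)
        have "\<chi>' (axis i k) = \<chi>' (axis i (k - 1)) + \<chi>' (axis i 1)"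
          using ax_add[of "k - 1" 1] add by simp
        with step2 show ?case by (simp add: algebra_simps)
      qed
    qed
    have decomp: "(\<Sum>i\<in>UNIV. axis i (m $ i)) = m" for m :: "int ^ 'n"
      by (simp add: vec_eq_iff axis_def if_distrib cong: if_cong)
    have \<chi>_eq: "\<chi>' m = (\<Sum>i\<in>UNIV. of_int (m $ i) * \<chi>' (axis i 1))" for m
    proof -
      have "\<chi>' m = (\<Sum>i\<in>UNIV. \<chi>' (axis i (m $ i)))"
        using sum[of "\<lambda>i. axis i (m $ i)" UNIV] by (simp only: decomp)
      also have "\<dots> = (\<Sum>i\<in>UNIV. of_int (m $ i) * \<chi>' (axis i 1))"
        by (rule sum.cong) (rule refl, rule ax)
      finally show ?thesis .
    qed
    define u :: "'n der" where "u = (\<chi> i. \<chi>' (axis i 1))"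
    have "\<delta> f = der_apply u f" for f
    proof (induction f rule: pm_induct)
      case (single m c)
      have "\<delta> (tpow m) = der_apply u (tpow m)"
        by (simp add: \<delta>_\<chi> \<chi>_eq [of m] der_apply_def u_def ldiff_tpow sum_distrib_left algebra_simps)
      then show ?case by (simp add: single_eq_cscale der_apply_cscale hom.scale)
    qed (simp add: der_apply_add hom.add)
    then show "\<delta> \<in> range der_apply" by (auto simp: fun_eq_iff)
  qed
qed

lemma dA_eq_span:
  "range ext_d = module.span vscale {(\<chi> i. of_int (m $ i) * tpow m) |m :: int ^ 'n::finite. True}"
proof -
  interpret vector_space "vscale :: complex \<Rightarrow> 'n omega \<Rightarrow> 'n omega"
    by unfold_locales
       (auto simp: vscale_def vec_eq_iff vector_space.vector_space_assms [OF vector_space_cscale])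
  let ?S = "{(\<chi> i. of_int (m $ i) * tpow m) |m :: int ^ 'n. True}"
  have gen: "(\<chi> i. of_int (m $ i) * tpow m) = ext_d (tpow m)" for m :: "int ^ 'n"
    by (simp add: ext_d_def ldiff_tpow)
  have "ext_d f \<in> span ?S" for f :: "'n laurent"
  proof (induction f rule: pm_induct)
    case (single m c)
    have "ext_d (tpow m) \<in> span ?S" by (rule span_base) (auto simp: gen)
    then show ?case by (simp add: single_eq_cscale ext_d_cscale span_scale)
  qed (simp add: ext_d_add span_add)
  moreover have "subspace (range ext_d)"
    by (rule subspaceI) (auto simp flip: ext_d_zero ext_d_add ext_d_cscale)
  ultimately show ?thesis
    by (intro equalityI span_minimal) (auto simp: gen)
qed

lemma ldiff_of_int_mult: "ldiff i (of_int k * f) = of_int k * ldiff i f"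
  by (simp add: of_int_mult_eq_cscale ldiff_cscale)

lemma axis_ldiff: "ldiff p (axis i f $ j) = (if j = i then ldiff p f else 0)"
  by (simp add: axis_def)

lemma axis_if: "axis i f $ j = (if j = i then f else 0)"
  by (simp add: axis_def)

lemma der_bracket_basis:
  "der_bracket (axis i (tpow r)) (axis j (tpow q)) =
     axis j (of_int (q $ i) * tpow (r + q)) - axis i (of_int (r $ j) * tpow (r + q))"
  by (auto simp: der_bracket_def vec_eq_iff axis_if axis_ldiff ldiff_tpow tpow_add sum_subtractf
      if_distrib [of "\<lambda>x. _ * x"] if_distrib [of "\<lambda>x. x * _"] cong: if_cong)

lemma kah_act_basis:
  "kah_act (axis i (tpow r)) (abs_kah (axis j (tpow q))) =
     abs_kah (axis j (of_int (q $ i) * tpow (r + q)) +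
              (if i = j then (\<chi> p. of_int (r $ p) * tpow (r + q)) else 0))"
  unfolding kah_act.abs_eq
  by (rule arg_cong [of _ _ abs_kah])
     (auto simp: lie_deriv_def vec_eq_iff axis_if axis_ldiff ldiff_tpow tpow_add sum.distrib
      if_distrib [of "\<lambda>x. _ * x"] if_distrib [of "\<lambda>x. x * _"] cong: if_cong)

lemma phi1_basis:
  "phi1 (axis i (tpow r)) (axis j (tpow q)) =
     abs_kah (\<chi> p. - of_int (q $ i) * of_int (r $ j) * of_int (r $ p) * tpow (r + q))"
  unfolding phi1_def
  by (rule arg_cong [of _ _ abs_kah])
     (simp add: vec_eq_iff axis_if axis_ldiff ldiff_tpow tpow_add ldiff_of_int_mult
      if_distrib [of "\<lambda>x. _ * x"] if_distrib [of "\<lambda>x. x * _"] if_distrib [of "ldiff _"] cong: if_cong)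

lemma phi2_basis:
  "phi2 (axis i (tpow r)) (axis j (tpow q)) =
     abs_kah (\<chi> p. of_int (r $ i) * of_int (q $ j) * of_int (r $ p) * tpow (r + q))"
  unfolding phi2_def
  by (rule arg_cong [of _ _ abs_kah])
     (simp add: vec_eq_iff axis_if axis_ldiff ldiff_tpow tpow_add ldiff_of_int_mult
      if_distrib [of "\<lambda>x. _ * x"] if_distrib [of "\<lambda>x. x * _"] if_distrib [of "ldiff _"] cong: if_cong)

section \<open>The full toroidal Lie algebra\<close>

text \<open>
  \<open>\<gg> \<otimes> A\<close> is the space of Laurent polynomials with coefficients in \<open>\<gg>\<close>, with
  \<open>x \<otimes> t\<^sup>r = single r x\<close>.  The three components of an element are those in
  \<open>\<gg> \<otimes> A\<close>, \<open>\<K>\<^sub>A\<close> and \<open>Der(A)\<close>.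
\<close>
type_synonym ('g, 'n) toroidal = "((int, 'n) vec \<Rightarrow>\<^sub>0 'g) \<times> 'n kah \<times> 'n der"

definition loop_bracket ::
  "('g \<Rightarrow> 'g \<Rightarrow> 'g::ab_group_add) \<Rightarrow> (int ^ 'n \<Rightarrow>\<^sub>0 'g) \<Rightarrow> (int ^ 'n::finite \<Rightarrow>\<^sub>0 'g) \<Rightarrow> (int ^ 'n \<Rightarrow>\<^sub>0 'g)" where
  "loop_bracket br X Y = (\<Sum>r\<in>Poly_Mapping.keys X. \<Sum>s\<in>Poly_Mapping.keys Y.
     Poly_Mapping.single (r + s) (br (Poly_Mapping.lookup X r) (Poly_Mapping.lookup Y s)))"

definition loop_central ::
  "(complex \<Rightarrow> 'g::ab_group_add \<Rightarrow> 'g) \<Rightarrow> ('g \<Rightarrow> 'g \<Rightarrow> 'g) \<Rightarrow> (int ^ 'n \<Rightarrow>\<^sub>0 'g) \<Rightarrow> (int ^ 'n::finite \<Rightarrow>\<^sub>0 'g) \<Rightarrow> 'n kah" where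
  "loop_central s br X Y = abs_kah (\<chi> i. \<Sum>r\<in>Poly_Mapping.keys X. \<Sum>q\<in>Poly_Mapping.keys Y.
     cscale (killing s br (Poly_Mapping.lookup X r) (Poly_Mapping.lookup Y q) * of_int (r $ i)) (tpow (r + q)))"

definition der_loop ::
  "(complex \<Rightarrow> 'g::ab_group_add \<Rightarrow> 'g) \<Rightarrow> 'n::finite der \<Rightarrow> (int ^ 'n \<Rightarrow>\<^sub>0 'g) \<Rightarrow> (int ^ 'n \<Rightarrow>\<^sub>0 'g)" where
  "der_loop s u X = (\<Sum>i\<in>UNIV. \<Sum>r\<in>Poly_Mapping.keys (u $ i). \<Sum>q\<in>Poly_Mapping.keys X.
     Poly_Mapping.single (r + q)
       (s (Poly_Mapping.lookup (u $ i) r * of_int (q $ i)) (Poly_Mapping.lookup X q)))"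

text \<open>The parameters \<open>c1, c2\<close> are the coefficients of \<open>\<phi> = c1 \<phi>\<^sub>1 + c2 \<phi>\<^sub>2\<close>.\<close>
definition tor_bracket ::
  "(complex \<Rightarrow> 'g::ab_group_add \<Rightarrow> 'g) \<Rightarrow> ('g \<Rightarrow> 'g \<Rightarrow> 'g) \<Rightarrow> complex \<Rightarrow> complex \<Rightarrow>
   ('g, 'n::finite) toroidal \<Rightarrow> ('g, 'n) toroidal \<Rightarrow> ('g, 'n) toroidal" where
  "tor_bracket s br c1 c2 a b = (case (a, b) of ((X, k, u), (Y, l, v)) \<Rightarrow>
     (loop_bracket br X Y + der_loop s u Y - der_loop s v X,
      loop_central s br X Y + kah_act u l - kah_act v k
        + kah_scale c1 (phi1 u v) + kah_scale c2 (phi2 u v),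
      der_bracket u v))"

definition tor_scale ::
  "(complex \<Rightarrow> 'g::ab_group_add \<Rightarrow> 'g) \<Rightarrow> complex \<Rightarrow> ('g, 'n::finite) toroidal \<Rightarrow> ('g, 'n) toroidal" where
  "tor_scale s c a = (case a of (X, k, u) \<Rightarrow> (Poly_Mapping.map (s c) X, kah_scale c k, vscale c u))"

text \<open>\<open>x(r)\<close>, \<open>t\<^sup>r K\<^sub>j\<close> and \<open>t\<^sup>r d\<^sub>j\<close>\<close>

definition tor_loop :: "'g::ab_group_add \<Rightarrow> int ^ 'n::finite \<Rightarrow> ('g, 'n) toroidal" where
  "tor_loop x r = (Poly_Mapping.single r x, 0, 0)"

definition tor_K :: "int ^ 'n::finite \<Rightarrow> 'n \<Rightarrow> ('g::ab_group_add, 'n) toroidal" where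
  "tor_K r j = (0, abs_kah (axis j (tpow r)), 0)"

definition tor_d :: "int ^ 'n::finite \<Rightarrow> 'n \<Rightarrow> ('g::ab_group_add, 'n) toroidal" where
  "tor_d r j = (0, 0, axis j (tpow r))"

definition htilde :: "(complex \<Rightarrow> 'g::ab_group_add \<Rightarrow> 'g) \<Rightarrow> 'g set \<Rightarrow> ('g, 'n::finite) toroidal set" where
  "htilde s h = {tor_loop z 0 + (\<Sum>j\<in>UNIV. tor_scale s (c j) (tor_d 0 j)) |z c. z \<in> h}"

definition htilde_basis :: "('l \<Rightarrow> 'g::ab_group_add) \<Rightarrow> 'l + 'n \<Rightarrow> ('g, 'n::finite) toroidal" where
  "htilde_basis H v = (case v of Inl i \<Rightarrow> tor_loop (H i) 0 | Inr j \<Rightarrow> tor_d 0 j)"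

lemma abs_kah_add: "abs_kah (\<omega> + \<eta>) = abs_kah \<omega> + abs_kah \<eta>"
  by (simp add: plus_kah.abs_eq)

lemma abs_kah_0 [simp]: "abs_kah 0 = 0"
  by (rule zero_kah.abs_eq [symmetric])

lemma kah_act_0: "kah_act u 0 = 0" "kah_act 0 k = 0"
proof -
  have "lie_deriv u 0 = 0"
    by (simp add: lie_deriv_def vec_eq_iff)
  then show "kah_act u 0 = 0"
    by (metis abs_kah_0 kah_act.abs_eq)
  have k: "k = abs_kah (rep_kah k)"
    by (rule Quotient3_abs_rep [OF Quotient3_kah, symmetric])
  have "lie_deriv 0 (rep_kah k) = 0"
    by (simp add: lie_deriv_def vec_eq_iff)
  then show "kah_act 0 k = 0"
    by (subst k) (simp only: kah_act.abs_eq abs_kah_0)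
qed

lemma zero_facts:
  shows phi_0: "phi1 0 v = 0" "phi1 u 0 = 0" "phi2 0 v = 0" "phi2 u 0 = 0"
  and der_bracket_0: "der_bracket 0 v = 0" "der_bracket u 0 = 0"
  and loop_central_0: "loop_central s br 0 Y = 0" "loop_central s br X 0 = 0"
  and der_loop_0: "der_loop s 0 X = 0" "der_loop s u 0 = 0"
  and kah_scale_0: "kah_scale c 0 = 0"
proof -
  have z: "(\<chi> p. 0) = (0 :: 'z::zero ^ 'k)"
    by (simp add: vec_eq_iff)
  show "phi1 0 v = 0" "phi1 u 0 = 0" "phi2 0 v = 0" "phi2 u 0 = 0"
    "der_bracket 0 v = 0" "der_bracket u 0 = 0"
    "loop_central s br 0 Y = 0" "loop_central s br X 0 = 0"
    "der_loop s 0 X = 0" "der_loop s u 0 = 0"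
    by (simp_all add: phi1_def phi2_def der_bracket_def loop_central_def der_loop_def z)
  have "vscale c 0 = 0"
    by (auto simp: vscale_def vec_eq_iff intro!: poly_mapping_eqI)
  then show "kah_scale c 0 = 0"
    by (metis abs_kah_0 kah_scale.abs_eq)
qed

lemma tor_bracket_loop_loop:
  fixes s :: "complex \<Rightarrow> 'g::ab_group_add \<Rightarrow> 'g" and r q :: "int ^ 'n::finite" and x y :: 'g
  assumes "lie_algebra s br"
  shows "tor_bracket s br c1 c2 (tor_loop x r) (tor_loop y q) =
    (Poly_Mapping.single (r + q) (br x y),
     abs_kah (\<chi> i. cscale (killing s br x y * of_int (r $ i)) (tpow (r + q))), 0)"
proof -
  interpret L: Vector_Spaces.linear s s "br u" for u
    using assms by (simp add: lie_algebra_def)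
  interpret R: Vector_Spaces.linear s s "\<lambda>u. br u v" for v
    using assms by (simp add: lie_algebra_def)
  have c0: "cscale 0 f = 0" for f :: "'n laurent"
    by (rule poly_mapping_eqI) simp
  have k0: "killing s br u 0 = 0" "killing s br 0 u = 0" for u
  proof -
    have "br 0 z = 0" for z using R.zero .
    then show "killing s br u 0 = 0" "killing s br 0 u = 0"
      using L.vs1.representation_zero
      by (simp_all add: killing_def lin_trace_def L.zero Let_def)
  qed
  have lb: "loop_bracket br (Poly_Mapping.single r x) (Poly_Mapping.single q y) =
      Poly_Mapping.single (r + q) (br x y)"
    by (auto simp: loop_bracket_def L.zero R.zero)
  have lc: "loop_central s br (Poly_Mapping.single r x) (Poly_Mapping.single q y) =
      abs_kah (\<chi> i. cscale (killing s br x y * of_int (r $ i)) (tpow (r + q)))"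
    unfolding loop_central_def
    by (rule arg_cong [of _ _ abs_kah]) (auto simp: vec_eq_iff k0 c0)
  show ?thesis
    by (simp add: tor_bracket_def tor_loop_def der_loop_0 kah_act_0 phi_0 kah_scale_0 der_bracket_0)
       (intro conjI lb lc)
qed

lemma tor_bracket_loop_K: "tor_bracket s br c1 c2 (tor_loop x r) (tor_K q j) = 0"
  and tor_bracket_K_K: "tor_bracket s br c1 c2 (tor_K r i) (tor_K q j) = 0"
  by (simp_all add: tor_bracket_def tor_loop_def tor_K_def loop_bracket_def loop_central_0
      der_loop_0 kah_act_0 phi_0 kah_scale_0 der_bracket_0 zero_prod_def)

lemma tor_bracket_d_K:
  "tor_bracket s br c1 c2 (tor_d r i) (tor_K q j) =
     (0, kah_act (axis i (tpow r)) (abs_kah (axis j (tpow q))), 0)"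
  by (simp add: tor_bracket_def tor_d_def tor_K_def loop_bracket_def loop_central_0
      der_loop_0 kah_act_0 phi_0 kah_scale_0 der_bracket_0)

lemma tor_bracket_d_d:
  "tor_bracket s br c1 c2 (tor_d r i) (tor_d q j) =
     (0, kah_scale c1 (phi1 (axis i (tpow r)) (axis j (tpow q)))
         + kah_scale c2 (phi2 (axis i (tpow r)) (axis j (tpow q))),
      der_bracket (axis i (tpow r)) (axis j (tpow q)))"
  by (simp add: tor_bracket_def tor_d_def loop_bracket_def loop_central_0 der_loop_0 kah_act_0)

lemma tor_bracket_d_loop:
  assumes "vector_space s"
  shows "tor_bracket s br c1 c2 (tor_d r i) (tor_loop x q) =
    (Poly_Mapping.single (r + q) (s (of_int (q $ i)) x), 0, 0)"
proof -
  interpret vector_space s by fact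
  have "der_loop s (axis i (tpow r)) (Poly_Mapping.single q x) =
      (\<Sum>p\<in>UNIV. if p = i then Poly_Mapping.single (r + q) (s (of_int (q $ i)) x) else 0)"
    unfolding der_loop_def by (rule sum.cong) (auto simp: axis_if tpow_def)
  then have "der_loop s (axis i (tpow r)) (Poly_Mapping.single q x) =
      Poly_Mapping.single (r + q) (s (of_int (q $ i)) x)"
    by simp
  then show ?thesis
    by (simp add: tor_bracket_def tor_loop_def tor_d_def loop_bracket_def loop_central_0
        der_loop_0 kah_act_0 phi_0 kah_scale_0 der_bracket_0)
qed

lemma vector_space_tor_scale:
  fixes s :: "complex \<Rightarrow> 'g::ab_group_add \<Rightarrow> 'g"
  assumes "vector_space s"
  shows "vector_space (tor_scale s :: complex \<Rightarrow> ('g, 'n::finite) toroidal \<Rightarrow> _)"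
proof -
  interpret vector_space s by fact
  have l: "Poly_Mapping.lookup (Poly_Mapping.map (s c) X) m = s c (Poly_Mapping.lookup X m)"
    for c and X :: "int ^ 'n \<Rightarrow>\<^sub>0 'g" and m
    by (simp add: Poly_Mapping.map.rep_eq when_def)
  have refl: "(x::'n omega) - x \<in> range ext_d" for x
    by (metis diff_self ext_d_zero rangeI)
  have v: "vector_space (vscale :: complex \<Rightarrow> 'n omega \<Rightarrow> 'n omega)"
    by unfold_locales
       (auto simp: vscale_def vec_eq_iff vector_space.vector_space_assms [OF vector_space_cscale])
  note va = vector_space.vector_space_assms [OF v]
  have k: "kah_scale a (k + l) = kah_scale a k + kah_scale a l"
       "kah_scale (a + b) k = kah_scale a k + kah_scale b k"
       "kah_scale a (kah_scale b k) = kah_scale (a * b) k"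
       "kah_scale 1 k = k" for a b and k l :: "'n kah"
    by (transfer, simp only: va refl)+
  show ?thesis
    by unfold_locales
       (auto intro!: poly_mapping_eqI simp: tor_scale_def l k va lookup_add vector_space_assms split: prod.split)
qed

section \<open>The modules \<open>M(\<Lambda>, a, M\<^sub>\<gg>)\<close>\<close>

text \<open>
  \<open>U(\<hh>)\<close> is \<open>'l cpoly\<close> with \<open>H\<^sub>i = pvar i\<close>, and the universal enveloping algebra of \<open>htilde\<close> is
  \<open>('l + 'n) cpoly\<close> with \<open>H\<^sub>i = pvar (Inl i)\<close> and \<open>d\<^sub>j = pvar (Inr j)\<close>.
\<close>

definition shift :: "('v::finite \<Rightarrow> complex) \<Rightarrow> 'v cpoly \<Rightarrow> 'v cpoly" where
  "shift c = psubst (\<lambda>v. pvar v - pconst (c v))"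

definition sigma :: "'l::finite \<Rightarrow> ('l + 'n::finite) cpoly \<Rightarrow> ('l + 'n) cpoly" where
  "sigma i = shift (\<lambda>v. if v = Inl i then 1 else 0)"

text \<open>\<open>\<tau>\<^sup>r\<close> is the algebra automorphism with \<open>d\<^sub>j \<mapsto> d\<^sub>j - r\<^sub>j\<close> and \<open>H\<^sub>i \<mapsto> H\<^sub>i\<close>.\<close>
definition tau :: "int ^ 'n::finite \<Rightarrow> ('l::finite + 'n) cpoly \<Rightarrow> ('l + 'n) cpoly" where
  "tau r = shift (\<lambda>v. case v of Inl i \<Rightarrow> 0 | Inr j \<Rightarrow> of_int (r $ j))"

lemma shift_pvar: "shift c (pvar v) = pvar v - pconst (c v)"
  by (simp add: shift_def psubst_pvar)

lemma shift_shift: "shift c (shift d p) = shift (\<lambda>v. c v + d v) p"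
proof -
  have minus: "psubst f (p - q) = psubst f p - psubst f q" for f :: "'a \<Rightarrow> 'a cpoly" and p q
    by (metis add_diff_cancel_right' diff_add_cancel psubst_add)
  show ?thesis
    by (simp add: shift_def psubst_psubst minus psubst_pvar psubst_pconst pconst_add algebra_simps)
qed

lemma shift_0: "shift (\<lambda>v. 0) p = p"
  by (simp add: shift_def pconst_0 psubst_ident)

lemma sigma_pvar:
  "sigma i (pvar (Inl i')) = (if i' = i then pvar (Inl i') - 1 else pvar (Inl i'))"
  "sigma i (pvar (Inr j)) = pvar (Inr j)"
  by (simp_all add: sigma_def shift_pvar pconst_1 pconst_0)

lemma inv_sigma: "inv (sigma i) = shift (\<lambda>v. if v = Inl i then - 1 else 0)"
  by (rule inv_equality) (simp_all add: sigma_def shift_shift shift_0 if_distrib cong: if_cong)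

lemma bij_sigma: "bij (sigma i)"
  by (rule o_bij [where g = "shift (\<lambda>v. if v = Inl i then - 1 else 0)"])
     (simp_all add: fun_eq_iff sigma_def shift_shift shift_0 if_distrib cong: if_cong)

lemma tau_pvar:
  "tau r (pvar (Inl i)) = pvar (Inl i)"
  "tau r (pvar (Inr j)) = pvar (Inr j) - pconst (of_int (r $ j))"
  by (simp_all add: tau_def shift_pvar pconst_0)

lemma tau_tau: "tau r (tau q p) = tau (r + q) p"
  by (simp add: tau_def shift_shift) (rule arg_cong [of _ _ "\<lambda>c. shift c p"], auto split: sum.splits)

definition Uh_incl :: "'l::finite cpoly \<Rightarrow> ('l + 'n::finite) cpoly" where
  "Uh_incl = psubst (\<lambda>i. pvar (Inl i))"

text \<open>An element of \<open>\<hh>\<close> as a linear polynomial in the basis \<open>H\<close>.\<close>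
definition cartan_poly ::
  "(complex \<Rightarrow> 'g::ab_group_add \<Rightarrow> 'g) \<Rightarrow> ('l::finite \<Rightarrow> 'g) \<Rightarrow> 'g \<Rightarrow> ('l + 'n::finite) cpoly" where
  "cartan_poly s H z =
     (\<Sum>i\<in>UNIV. pconst (module.representation s (range H) z (H i)) * pvar (Inl i))"

definition Lpow :: "complex ^ 'n \<Rightarrow> int ^ 'n::finite \<Rightarrow> complex" where
  "Lpow \<Lambda> r = (\<Prod>j\<in>UNIV. (\<Lambda> $ j) powi (r $ j))"

text \<open>Objects of \<open>\<M>(\<gg>, \<hh>)\<close> with underlying space \<open>U(\<hh>)\<close>, on which \<open>\<hh>\<close> acts by multiplication.\<close>
definition category_M_normalized ::
  "(complex \<Rightarrow> 'g::ab_group_add \<Rightarrow> 'g) \<Rightarrow> ('g \<Rightarrow> 'g \<Rightarrow> 'g) \<Rightarrow> 'g set \<Rightarrow> ('l::finite \<Rightarrow> 'g) \<Rightarrow>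
   ('g \<Rightarrow> 'l cpoly \<Rightarrow> 'l cpoly) \<Rightarrow> bool" where
  "category_M_normalized s br h H actg \<longleftrightarrow>
     category_M s br h H cscale actg \<and> (\<forall>i p. actg (H i) p = pvar i * p)"

text \<open>
  \<open>\<rho>\<close> is the \<open>\<L>\<close>-module structure on \<open>U\<close> of \<open>htilde\<close> that defines the module with parameters
  \<open>\<Lambda>\<close>, \<open>a\<close> and \<open>M\<^sub>\<gg> = (U(\<hh>), actg)\<close>.  It is uniquely determined by the listed formulas, because the
  elements occurring in them generate the Lie algebra \<open>\<L>\<close>.
\<close>
definition is_Mhat ::
  "(complex \<Rightarrow> 'g::ab_group_add \<Rightarrow> 'g) \<Rightarrow> ('g \<Rightarrow> 'g \<Rightarrow> 'g) \<Rightarrow> complex \<Rightarrow> complex \<Rightarrow> 'g set \<Rightarrow>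
   ('l::finite \<Rightarrow> 'g) \<Rightarrow> ('l \<Rightarrow> 'g) \<Rightarrow> ('l \<Rightarrow> 'g) \<Rightarrow>
   complex ^ 'n::finite \<Rightarrow> complex \<Rightarrow> ('g \<Rightarrow> 'l cpoly \<Rightarrow> 'l cpoly) \<Rightarrow>
   (('g, 'n) toroidal \<Rightarrow> ('l + 'n) cpoly \<Rightarrow> ('l + 'n) cpoly) \<Rightarrow> bool" where
  "is_Mhat s br c1 c2 h x y H \<Lambda> a actg \<rho> \<longleftrightarrow>
     lie_module (tor_scale s) (tor_bracket s br c1 c2) cscale \<rho> \<and>
     (\<forall>r j g. \<rho> (tor_K r j) g = 0) \<and>
     (\<forall>z\<in>h. \<forall>r g. \<rho> (tor_loop z r) g = cscale (Lpow \<Lambda> r) (cartan_poly s H z * tau r g)) \<and>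
     (\<forall>i r g. \<rho> (tor_loop (x i) r) g =
        cscale (Lpow \<Lambda> r) (sigma i (tau r g) * Uh_incl (actg (x i) 1))) \<and>
     (\<forall>i r g. \<rho> (tor_loop (y i) r) g =
        cscale (Lpow \<Lambda> r) (inv (sigma i) (tau r g) * Uh_incl (actg (y i) 1))) \<and>
     (\<forall>r j g. \<rho> (tor_d r j) g =
        cscale (Lpow \<Lambda> r) (tau r g * (pvar (Inr j) - pconst (of_int (r $ j) * (a + 1)))))"

end

theory Submission
  imports Defs "Jordan_Normal_Form.Schur_Decomposition"
begin

text \<open>
  Identify the module with the polynomial ring \<open>\<complex>[H, d]\<close>, on which \<open>H\<^sub>i\<close> and \<open>d\<^sub>j\<close> act by
  multiplication.  An element \<open>X\<close> of \<open>\<L>\<close> of weight \<open>\<alpha>\<close> for \<open>\<hh>\<close> and degree \<open>r\<close> passes the operators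
  of multiplication by \<open>H\<^sub>i\<close> and \<open>d\<^sub>j\<close> up to constants, so it acts as
  \<open>g(H, d) \<mapsto> g(H - \<alpha>, d - r) \<cdot> p\<close> with \<open>p = X.1\<close> (\<open>rho_weight_vector\<close>).  The module
  structure is therefore a family of polynomials, and the brackets of \<open>\<L>\<close> are functional equations
  between their translates.

  The decisive equation comes from \<open>[t\<^sup>r d\<^sub>j, H\<^sub>a(s)] = s\<^sub>j H\<^sub>a(r + s)\<close> with \<open>r\<close> and \<open>s\<close> multiples of one
  vector.  On a line in that direction it relates polynomials in one variable, and a comparison of
  degrees shows that the polynomials \<open>f\<^sub>r = H\<^sub>a(r).1\<close> are constant along the line and satisfy
  \<open>f\<^sub>r f\<^sub>-\<^sub>r = H\<^sub>a\<^sup>2\<close> and \<open>f\<^sub>r\<^sup>2 = H\<^sub>a f\<^sub>2\<^sub>r\<close> (\<open>line_structure_constants\<close>).  Hence \<open>f\<^sub>r\<close> is a nonzero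
  multiple of \<open>H\<^sub>a\<close>.  Returning to the equation with arbitrary \<open>r\<close> and \<open>s\<close>, the polynomial of \<open>t\<^sup>r d\<^sub>j\<close>
  turns out to be affine in \<open>d\<close>, and the multiples form a character \<open>r \<mapsto> \<Lambda>\<^sup>r\<close> of \<open>\<int>\<^sup>n\<close> that is the
  same for all \<open>a\<close> (\<open>character_add\<close>).

  Now all \<open>h(r)\<close> with \<open>h \<in> \<hh>\<close> commute.  Their brackets are the \<open>t\<^sup>m K\<^sub>j\<close>, scaled by values of the
  Killing form, and the Killing form does not vanish at a coroot \<open>h\<^sub>i\<close>, because \<open>ad h\<^sub>i\<close> belongs to an
  \<open>sl\<^sub>2\<close>-triple and so has integral eigenvalues, which makes the trace of its square positive
  (\<open>killing_sl2_nonzero\<close>).  Thus \<open>\<K>\<^sub>A\<close> acts by zero (\<open>rho_centre\<close>).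

  What remains are two linear problems.  The brackets within \<open>Der(A)\<close> force
  \<open>t\<^sup>r d\<^sub>j.1 = \<Lambda>\<^sup>r (d\<^sub>j + r\<^sub>j c)\<close> with a polynomial \<open>c\<close> in the \<open>H\<^sub>i\<close> (\<open>d_error_linear\<close>).  The brackets of
  \<open>x\<^sub>i(r)\<close> and \<open>y\<^sub>i(r)\<close> with the \<open>H\<^sub>i(s)\<close> and \<open>t\<^sup>s d\<^sub>j\<close> force \<open>x\<^sub>i(r).1 = \<Lambda>\<^sup>r (x\<^sub>i.1)\<close> with \<open>x\<^sub>i.1 \<in> U(\<hh>)\<close>
  and the invariance of \<open>c\<close> under \<open>H\<^sub>i \<mapsto> H\<^sub>i - 1\<close> (\<open>weight_one_loop_vector\<close>).  Therefore \<open>c\<close> is a constant, to be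
  called \<open>-(a + 1)\<close>, and setting \<open>d = 0\<close> yields the \<open>\<gg>\<close>-module \<open>M\<^sub>\<gg>\<close>.
\<close>

section \<open>The Killing form at a coroot\<close>

definition mat_trace :: "'a::comm_ring_1 mat \<Rightarrow> 'a" where
  "mat_trace A = (\<Sum>i<dim_row A. A $$ (i, i))"

lemma mat_trace_mult_commute:
  assumes "A \<in> carrier_mat n n" "B \<in> carrier_mat n n"
  shows "mat_trace (A * B) = mat_trace (B * A)"
proof -
  have tr: "mat_trace (A * B) = (\<Sum>i<n. \<Sum>j<n. A $$ (i, j) * B $$ (j, i))"
    if "A \<in> carrier_mat n n" "B \<in> carrier_mat n n" for A B :: "'a mat"
    using that by (auto simp: mat_trace_def scalar_prod_def atLeast0LessThan intro!: sum.cong)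
  show ?thesis
    unfolding tr [OF assms] tr [OF assms(2,1)]
    by (subst sum.swap) (simp add: mult.commute)
qed

text \<open>The numbers \<open>d i\<close> are the diagonal entries of a Schur triangularization.\<close>
lemma mat_trace_square_eq_eigenvalues:
  fixes A :: "complex mat"
  assumes A: "A \<in> carrier_mat n n"
  obtains d where "mat_trace (A * A) = (\<Sum>i<n. (d i)\<^sup>2)" "{k. eigenvalue A k} = d ` {..<n}"
proof -
  obtain as where "char_poly A = (\<Prod>a\<leftarrow>as. [:- a, 1:])"
    using char_poly_factorized [OF A] by blast
  then obtain U where U: "U \<in> carrier_mat n n" "upper_triangular U" and sim: "similar_mat A U"
    using schur_decomposition_exists [OF A] by blast
  obtain P Q where wit: "similar_mat_wit A U P Q"
    using sim by (auto simp: similar_mat_def)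
  have PQ: "P \<in> carrier_mat n n" "Q \<in> carrier_mat n n" "Q * P = 1\<^sub>m n" "A = P * U * Q"
    using wit A by (auto simp: similar_mat_wit_def Let_def)
  have "A * A = P * U * Q * (P * U * Q)" by (simp flip: PQ(4))
  also have "\<dots> = P * U * ((Q * P) * (U * Q))"
    using PQ(1,2) U(1) by (simp add: assoc_mult_mat [of _ n n _ n _ n])
  also have "\<dots> = P * (U * U * Q)"
    unfolding PQ(3) using PQ(1,2) U(1) by (simp add: assoc_mult_mat [of _ n n _ n _ n])
  finally have "mat_trace (A * A) = mat_trace (U * U * Q * P)"
    using mat_trace_mult_commute [of P n "U * U * Q"] PQ(1,2) U(1) by simp
  also have "U * U * Q * P = U * U * (Q * P)"
    using PQ(1,2) U(1) by (simp add: assoc_mult_mat [of _ n n _ n _ n])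
  also have "\<dots> = U * U" unfolding PQ(3) using U(1) by simp
  also have "mat_trace (U * U) = (\<Sum>i<n. (U $$ (i, i))\<^sup>2)"
  proof -
    have "(U * U) $$ (i, i) = (U $$ (i, i))\<^sup>2" if "i < n" for i
    proof -
      have "(U * U) $$ (i, i) = (\<Sum>j<n. U $$ (i, j) * U $$ (j, i))"
        using U(1) that by (auto simp: scalar_prod_def atLeast0LessThan intro!: sum.cong)
      also have "\<dots> = (\<Sum>j<n. if j = i then (U $$ (i, i))\<^sup>2 else 0)"
      proof (rule sum.cong)
        fix j assume "j \<in> {..<n}"
        then have "j < i \<Longrightarrow> U $$ (i, j) = 0" "i < j \<Longrightarrow> U $$ (j, i) = 0"
          using U that by (auto simp: upper_triangular_def)
        then show "U $$ (i, j) * U $$ (j, i) = (if j = i then (U $$ (i, i))\<^sup>2 else 0)"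
          by (cases j i rule: linorder_cases) (auto simp: power2_eq_square)
      qed simp
      finally show ?thesis using that by simp
    qed
    then show ?thesis using U(1) by (simp add: mat_trace_def)
  qed
  finally have "mat_trace (A * A) = (\<Sum>i<n. (U $$ (i, i))\<^sup>2)" .
  moreover have "{k. eigenvalue A k} = (\<lambda>i. U $$ (i, i)) ` {..<n}"
  proof -
    have "eigenvalue A k \<longleftrightarrow> k \<in> set (diag_mat U)" for k
      unfolding eigenvalue_root_char_poly [OF A] char_poly_similar [OF sim]
        char_poly_upper_triangular [OF U]
      by (auto simp: poly_prod_list prod_list_zero_iff)
    then show ?thesis using U(1) by (auto simp: diag_mat_def)
  qed
  ultimately show ?thesis by (rule that [of "\<lambda>i. U $$ (i, i)"])
qed

text \<open>
  Apply the raising operator to the eigenvector until it vanishes, which happens since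
  eigenvectors to distinct eigenvalues are independent. The string of lowered vectors that starts
  at the last nonzero one ends for the same reason, and its end shows that the highest eigenvalue
  is the number of its steps.
\<close>
lemma sl2_eigenvalues_integral:
  fixes s :: "complex \<Rightarrow> 'v::ab_group_add \<Rightarrow> 'v"
  assumes vs: "vector_space s" and fd: "finite_dim s"
    and X: "Vector_Spaces.linear s s X" and Y: "Vector_Spaces.linear s s Y"
    and T: "Vector_Spaces.linear s s T"
    and TX: "\<And>v. T (X v) = X (T v) + s 2 (X v)"
    and TY: "\<And>v. T (Y v) = Y (T v) - s 2 (Y v)"
    and XY: "\<And>v. X (Y v) = Y (X v) + T v"
    and ev: "v \<noteq> 0" "T v = s k v"
  shows "k \<in> \<int>"
proof -
  interpret V: vector_space s by (rule vs)
  interpret X: Vector_Spaces.linear s s X by (rule X)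
  interpret Y: Vector_Spaces.linear s s Y by (rule Y)
  interpret T: Vector_Spaces.linear s s T by (rule T)
  obtain W where W: "finite W" "V.span W = UNIV" using fd by (auto simp: finite_dim_def)
  \<comment> \<open>eigenvectors to infinitely many distinct eigenvalues would be independent\<close>
  have stops: "\<exists>m. f m = 0"
    if f: "\<And>m. T (f m) = s (c + of_nat m * e) (f m)" and e: "e \<noteq> 0"
    for f :: "nat \<Rightarrow> 'v" and c e :: complex
  proof (rule ccontr)
    assume "\<nexists>m. f m = 0"
    then have nz: "f m \<noteq> 0" for m by blast
    have inj: "inj f"
    proof (rule injI)
      fix m m' assume "f m = f m'"
      then have "s (c + of_nat m * e) (f m) = s (c + of_nat m' * e) (f m)" by (metis f)
      then have "c + of_nat m * e = c + of_nat m' * e" using nz V.scale_cancel_right by blast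
      then show "m = m'" using e by simp
    qed
    have "\<forall>a. (\<Sum>m<N. s (a m) (f m)) = 0 \<longrightarrow> (\<forall>m<N. a m = 0)" for N
    proof (induction N)
      case (Suc N)
      show ?case
      proof (intro allI impI)
        fix a m assume sum: "(\<Sum>m<Suc N. s (a m) (f m)) = 0" and "m < Suc N"
        define c' where "c' m = c + of_nat m * e" for m
        have fT: "T (f m) = s (c' m) (f m)" for m by (simp add: f c'_def)
        have "(\<Sum>m<N. s (a m * (c' m - c' N)) (f m))
            = T (\<Sum>m<Suc N. s (a m) (f m)) - s (c' N) (\<Sum>m<Suc N. s (a m) (f m))"
          by (simp add: T.sum T.scale T.add fT V.scale_sum_right sum_subtractf
              V.scale_left_diff_distrib V.scale_right_distrib right_diff_distrib mult.commute)
        also have "\<dots> = 0" unfolding sum by (simp add: T.zero)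
        finally have "\<forall>m<N. a m * (c' m - c' N) = 0"
          using Suc.IH by (elim allE [of _ "\<lambda>m. a m * (c' m - c' N)"]) simp
        then have z: "\<forall>m<N. a m = 0" using e by (auto simp: c'_def)
        then have "s (a N) (f N) = 0" using sum by simp
        then have "a N = 0" using nz V.scale_eq_0_iff by blast
        then show "a m = 0" using z \<open>m < Suc N\<close> by (cases "m = N") auto
      qed
    qed simp
    then have lin: "(\<Sum>m<N. s (a m) (f m)) = 0 \<Longrightarrow> m < N \<Longrightarrow> a m = 0" for N a m by blast
    have "V.independent (f ` {..<N})" for N
    proof (rule V.independent_if_scalars_zero)
      fix g v assume 0: "(\<Sum>x\<in>f ` {..<N}. s (g x) x) = 0" and "v \<in> f ` {..<N}"
      then obtain m where m: "m < N" "v = f m" by auto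
      have "(\<Sum>m<N. s (g (f m)) (f m)) = 0"
        using 0 inj by (simp add: sum.reindex inj_on_subset)
      then show "g v = 0" using lin [of "\<lambda>m. g (f m)" N m] m by simp
    qed simp
    then have "card (f ` {..<N}) \<le> card W" for N
      using V.independent_span_bound [OF W(1)] W(2) by simp
    then have "N \<le> card W" for N
      using inj by (metis card_image card_lessThan inj_on_subset subset_UNIV)
    then show False by (metis Suc_n_not_le_n)
  qed
  define u where "u m = (X ^^ m) v" for m
  have u: "T (u m) = s (k + of_nat m * 2) (u m)" for m
    by (induction m) (simp_all add: u_def ev(2) TX X.scale X.add algebra_simps V.scale_left_distrib)
  obtain m where m: "u m = 0" using stops [OF u] by auto
  define p where "p = (LEAST m. u m = 0)"
  have p: "u p = 0" unfolding p_def using m by (rule LeastI)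
  have "p \<noteq> 0" using p ev(1) by (metis funpow_0 u_def)
  then obtain q where q: "p = Suc q" by (cases p) auto
  have uq: "u q \<noteq> 0" using not_less_Least [of q "\<lambda>m. u m = 0"] q by (simp add: p_def)
  define n where "n = k + of_nat q * 2"
  define w where "w m = (Y ^^ m) (u q)" for m
  have Xw0: "X (w 0) = 0" using p q by (simp add: w_def u_def)
  have w: "T (w m) = s (n + of_nat m * (- 2)) (w m)" for m
  proof (induction m)
    case 0
    show ?case by (simp add: w_def u n_def)
  next
    case (Suc m)
    have "T (w (Suc m)) = Y (T (w m)) - s 2 (w (Suc m))" by (simp add: w_def TY)
    also have "\<dots> = s (n + of_nat m * (- 2)) (w (Suc m)) - s 2 (w (Suc m))"
      unfolding Suc by (simp add: Y.scale w_def)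
    also have "\<dots> = s (n + of_nat (Suc m) * (- 2)) (w (Suc m))"
      by (simp add: algebra_simps flip: V.scale_left_diff_distrib)
    finally show ?case .
  qed
  have Xw: "X (w (Suc m)) = s (of_nat (Suc m) * (n - of_nat m)) (w m)" for m
  proof (induction m)
    case 0
    then show ?case using Xw0 w [of 0] by (simp add: w_def XY Y.zero)
  next
    case (Suc m)
    have "X (w (Suc (Suc m))) = Y (X (w (Suc m))) + T (w (Suc m))"
      by (simp add: w_def XY)
    also have "\<dots> = s (of_nat (Suc m) * (n - of_nat m)) (w (Suc m))
        + s (n + of_nat (Suc m) * (- 2)) (w (Suc m))"
      unfolding Suc w by (simp add: Y.scale w_def)
    also have "\<dots> = s (of_nat (Suc (Suc m)) * (n - of_nat (Suc m))) (w (Suc m))"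
      by (simp add: algebra_simps flip: V.scale_left_distrib)
    finally show ?case .
  qed
  obtain m where m: "w m = 0" using stops [OF w] by auto
  define p' where "p' = (LEAST m. w m = 0)"
  have p': "w p' = 0" unfolding p'_def using m by (rule LeastI)
  have "p' \<noteq> 0" using p' uq by (metis funpow_0 w_def)
  then obtain q' where q': "p' = Suc q'" by (cases p') auto
  have "w q' \<noteq> 0" using not_less_Least [of q' "\<lambda>m. w m = 0"] q' by (simp add: p'_def)
  moreover have "s (of_nat (Suc q') * (n - of_nat q')) (w q') = 0"
    using Xw [of q'] p' q' by (simp add: X.zero)
  ultimately have "n = of_nat q'"
    by (metis V.scale_eq_0_iff mult_eq_0_iff of_nat_eq_0_iff nat.distinct(1) right_minus_eq)
  then have "k = of_int (int q' - 2 * int q)" by (simp add: n_def algebra_simps)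
  then show ?thesis by simp
qed

text \<open>
  In a triangular form, the trace of the square is the sum of the squares of the eigenvalues, so
  real eigenvalues cannot cancel.
\<close>
lemma lin_trace_square_nonzero:
  fixes s :: "complex \<Rightarrow> 'v::ab_group_add \<Rightarrow> 'v"
  assumes vs: "vector_space s" and fd: "finite_dim s" and T: "Vector_Spaces.linear s s T"
    and real: "\<And>k v. v \<noteq> 0 \<Longrightarrow> T v = s k v \<Longrightarrow> k \<in> \<real>"
    and ev: "v0 \<noteq> 0" "T v0 = s k0 v0" "k0 \<noteq> 0"
  shows "lin_trace s (\<lambda>v. T (T v)) \<noteq> 0"
proof -
  interpret V: vector_space s by (rule vs)
  interpret T: Vector_Spaces.linear s s T by (rule T)
  define B where "B = V.extend_basis {}"
  have indep: "\<not> V.dependent B" and span: "V.span B = UNIV"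
    unfolding B_def by (simp_all add: V.independent_extend_basis V.span_extend_basis V.independent_empty)
  obtain W where "finite W" "V.span W = UNIV" using fd by (auto simp: finite_dim_def)
  then have fin: "finite B" using V.independent_span_bound [of W B] indep by simp
  define n where "n = card B"
  obtain b where b: "bij_betw b {..<n} B"
    using ex_bij_betw_nat_finite [OF fin] by (auto simp: n_def atLeast0LessThan)
  let ?r = "V.representation B"
  have expand: "v = (\<Sum>j<n. s (?r v (b j)) (b j))" for v
  proof -
    have "(\<Sum>c\<in>B. s (?r v c) c) = v"
      using V.sum_representation_eq [OF indep, of v B] span fin by simp
    then show ?thesis by (simp add: sum.reindex_bij_betw [OF b, symmetric])
  qed
  define A where "A = mat n n (\<lambda>(i, j). ?r (T (b j)) (b i))"
  have A: "A \<in> carrier_mat n n" by (simp add: A_def)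
  have rep_T: "?r (T v) (b i) = (\<Sum>j<n. A $$ (i, j) * ?r v (b j))" if "i < n" for v i
  proof -
    have "T v = (\<Sum>j<n. s (?r v (b j)) (T (b j)))"
      by (subst expand) (simp add: T.sum T.scale)
    then have "?r (T v) (b i) = (\<Sum>j<n. ?r v (b j) * ?r (T (b j)) (b i))"
      by (simp add: V.representation_sum indep span V.representation_scale)
    then show ?thesis using that by (simp add: A_def mult.commute)
  qed
  have "lin_trace s (\<lambda>v. T (T v)) = (\<Sum>i<n. ?r (T (T (b i))) (b i))"
    by (simp add: lin_trace_def B_def [symmetric] Let_def sum.reindex_bij_betw [OF b, symmetric])
  also have "\<dots> = (\<Sum>i<n. \<Sum>j<n. A $$ (i, j) * A $$ (j, i))"
    by (rule sum.cong) (auto simp: rep_T [of _ "T _"] A_def)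
  also have "\<dots> = mat_trace (A * A)"
    using A by (auto simp: mat_trace_def scalar_prod_def atLeast0LessThan intro!: sum.cong)
  finally have trace: "lin_trace s (\<lambda>v. T (T v)) = mat_trace (A * A)" .
  have ev_iff: "eigenvalue A k \<longleftrightarrow> (\<exists>v. v \<noteq> 0 \<and> T v = s k v)" for k
  proof
    assume "eigenvalue A k"
    then obtain w where w: "w \<in> carrier_vec n" "w \<noteq> 0\<^sub>v n" "A *\<^sub>v w = k \<cdot>\<^sub>v w"
      using A by (auto simp: eigenvalue_def eigenvector_def)
    define v where "v = (\<Sum>j<n. s (vec_index w j) (b j))"
    have bB: "b j \<in> B" if "j < n" for j using b that by (auto simp: bij_betw_def)
    have b_eq: "b j = b i \<longleftrightarrow> j = i" if "j < n" "i < n" for i j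
      using b that by (auto simp: bij_betw_def inj_on_def)
    have rep_v: "?r v (b i) = vec_index w i" if "i < n" for i
    proof -
      have "?r v (b i) = (\<Sum>j<n. vec_index w j * ?r (b j) (b i))"
        by (simp add: v_def V.representation_sum indep span V.representation_scale)
      also have "\<dots> = (\<Sum>j<n. if j = i then vec_index w i else 0)"
        by (rule sum.cong) (auto simp: V.representation_basis indep bB b_eq that)
      finally show ?thesis using that by simp
    qed
    have "v \<noteq> 0"
    proof
      assume "v = 0"
      then have "vec_index w i = 0" if "i < n" for i
        using rep_v [OF that] by (simp add: V.representation_zero)
      then have "w = 0\<^sub>v n" using w(1) by (intro eq_vecI) auto
      then show False using w(2) by simp
    qed
    moreover have "T v = s k v"
    proof -
      have "?r (T v) (b i) = k * ?r v (b i)" if "i < n" for i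
      proof -
        have "?r (T v) (b i) = vec_index (A *\<^sub>v w) i"
          using that A w(1) by (simp add: rep_T rep_v scalar_prod_def atLeast0LessThan)
        then show ?thesis using that w by (simp add: rep_v)
      qed
      then have "(\<Sum>j<n. s (?r (T v) (b j)) (b j)) = s k (\<Sum>j<n. s (?r v (b j)) (b j))"
        by (simp add: V.scale_sum_right)
      then show ?thesis by (simp flip: expand)
    qed
    ultimately show "\<exists>v. v \<noteq> 0 \<and> T v = s k v" by blast
  next
    assume "\<exists>v. v \<noteq> 0 \<and> T v = s k v"
    then obtain v where v: "v \<noteq> 0" "T v = s k v" by blast
    define w where "w = vec n (\<lambda>i. ?r v (b i))"
    have "A *\<^sub>v w = k \<cdot>\<^sub>v w"
    proof (rule eq_vecI)
      fix i assume "i < dim_vec (k \<cdot>\<^sub>v w)"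
      then have i: "i < n" by (simp add: w_def)
      have "vec_index (A *\<^sub>v w) i = ?r (T v) (b i)"
        using i A by (simp add: rep_T w_def scalar_prod_def atLeast0LessThan)
      also have "\<dots> = k * ?r v (b i)"
        by (simp add: v(2) V.representation_scale indep span)
      finally show "vec_index (A *\<^sub>v w) i = vec_index (k \<cdot>\<^sub>v w) i"
        using i by (simp add: w_def)
    qed (use A in \<open>simp add: w_def\<close>)
    moreover have "w \<noteq> 0\<^sub>v n"
    proof
      assume "w = 0\<^sub>v n"
      then have "?r v (b i) = 0" if "i < n" for i
        using that by (metis w_def index_vec index_zero_vec(1))
      then have "v = 0" by (subst expand) simp
      then show False using v(1) by simp
    qed
    ultimately show "eigenvalue A k"
      using A unfolding eigenvalue_def eigenvector_def by (intro exI [of _ w]) (auto simp: w_def)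
  qed
  obtain d where d: "mat_trace (A * A) = (\<Sum>i<n. (d i)\<^sup>2)" "{k. eigenvalue A k} = d ` {..<n}"
    using mat_trace_square_eq_eigenvalues [OF A] by blast
  have dreal: "d i = of_real (Re (d i))" if "i < n" for i
  proof -
    have "eigenvalue A (d i)" using d(2) that by blast
    then have "d i \<in> \<real>" using ev_iff real by blast
    then show ?thesis by (simp add: complex_is_Real_iff complex_eq_iff)
  qed
  have "(\<Sum>i<n. (d i)\<^sup>2) = (\<Sum>i<n. of_real ((Re (d i))\<^sup>2))"
    by (rule sum.cong) (metis dreal lessThan_iff of_real_power)+
  also have "\<dots> = of_real (\<Sum>i<n. (Re (d i))\<^sup>2)" by simp
  finally have tr: "lin_trace s (\<lambda>v. T (T v)) = of_real (\<Sum>i<n. (Re (d i))\<^sup>2)"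
    using trace d(1) by simp
  obtain i where i: "i < n" "d i = k0"
  proof -
    have "k0 \<in> d ` {..<n}" using ev_iff ev d(2) by blast
    then show ?thesis using that by auto
  qed
  have "Re (d i) \<noteq> 0" using dreal [OF i(1)] i(2) ev(3) by (metis of_real_0)
  then have "(\<Sum>i<n. (Re (d i))\<^sup>2) > 0"
    by (intro sum_pos2 [of _ i]) (use i(1) in auto)
  then show ?thesis unfolding tr by (simp only: of_real_eq_0_iff)
qed

lemma lie_algebraD:
  assumes "lie_algebra s br"
  shows lie_algebra_vector_space: "vector_space s"
    and lie_algebra_skew: "br u v = - br v u"
    and lie_algebra_derivation: "br u (br v w) = br (br u v) w + br v (br u w)"
proof -
  interpret L: Vector_Spaces.linear s s "br u" for u
    using assms by (simp add: lie_algebra_def)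
  interpret R: Vector_Spaces.linear s s "\<lambda>u. br u v" for v
    using assms by (simp add: lie_algebra_def)
  show "vector_space s" by unfold_locales
  have alt: "br u u = 0" for u using assms by (simp add: lie_algebra_def)
  have skew: "br u v = - br v u" for u v
  proof -
    have "br (u + v) (u + v) = br u u + br v u + (br u v + br v v)"
      by (simp only: L.add R.add)
    then show ?thesis using alt by (simp add: eq_neg_iff_add_eq_0 add.commute)
  qed
  then show "br u v = - br v u" .
  have "br u (br v w) + br v (br w u) + br w (br u v) = 0"
    using assms by (simp add: lie_algebra_def)
  moreover have "br v (br w u) = - br v (br u w)"
    by (subst skew [of w u]) (rule L.neg)
  moreover have "br w (br u v) = - br (br u v) w" by (rule skew)
  ultimately show "br u (br v w) = br (br u v) w + br v (br u w)"
    by (simp add: algebra_simps)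
qed

text \<open>
  In the adjoint representation of the triple, \<open>hc\<close> has integral eigenvalues and the nonzero
  eigenvalue \<open>2\<close> at \<open>x\<close>.
\<close>
lemma killing_sl2_nonzero:
  assumes lie: "lie_algebra s br" and fd: "finite_dim s"
    and hx: "br hc x = s 2 x" and hy: "br hc y = - s 2 y" and xy: "br x y = hc"
    and x: "x \<noteq> 0"
  shows "killing s br hc hc \<noteq> 0"
proof -
  have L: "Vector_Spaces.linear s s (br u)" for u
    using lie by (simp add: lie_algebra_def)
  interpret R: Vector_Spaces.linear s s "\<lambda>u. br u v" for v
    using lie by (simp add: lie_algebra_def)
  note deriv = lie_algebra_derivation [OF lie]
  have "k \<in> \<int>" if "v \<noteq> 0" "br hc v = s k v" for k v
  proof (rule sl2_eigenvalues_integral [OF lie_algebra_vector_space [OF lie] fd L L L _ _ _ that])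
    show "br hc (br x v) = br x (br hc v) + s 2 (br x v)" for v
      by (simp add: deriv [of hc x] hx R.scale)
    show "br hc (br y v) = br y (br hc v) - s 2 (br y v)" for v
      by (simp add: deriv [of hc y] hy R.scale R.neg)
    show "br x (br y v) = br y (br x v) + br hc v" for v
      by (simp add: deriv [of x y] xy)
  qed
  then have "k \<in> \<real>" if "v \<noteq> 0" "br hc v = s k v" for k v
    using that by (metis Ints_cases Reals_of_int)
  then show ?thesis
    unfolding killing_def
    by (rule lin_trace_square_nonzero [OF lie_algebra_vector_space [OF lie] fd L _ x hx]) auto
qed

\<comment> \<open>From here on vectors are again the functions on a finite index type.\<close>
no_notation vec_index (infixl "$" 100)
hide_type (open) Matrix.vec

section \<open>Polynomials as functions\<close>

lemma pconst_power: "pconst c ^ k = pconst (c ^ k)"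
  by (induction k) (simp_all add: pconst_1 pconst_mult)

lemma pconst_prod: "(\<Prod>x\<in>X. pconst (f x)) = pconst (\<Prod>x\<in>X. f x)"
  by (induction X rule: infinite_finite_induct) (simp_all add: pconst_1 pconst_mult)

lemma pconst_uminus: "pconst (- c) = - pconst c"
  by (simp add: pconst_def single_uminus)

lemma cscale_pconst: "cscale c p = pconst c * p"
  by (simp add: cscale_def pconst_def mult_map_scale_conv_mult)

lemma monomial_eq:
  "Poly_Mapping.single m c = pconst c * (\<Prod>v\<in>UNIV. pvar v ^ Poly_Mapping.lookup m v)"
  for m :: "'v::finite \<Rightarrow>\<^sub>0 nat"
  using psubst_ident [of "Poly_Mapping.single m c"] by (simp add: psubst_single)

text \<open>
  This induction suits operators whose commutators with the multiplications by variables are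
  known.
\<close>
lemma cpoly_induct [case_names const mult add]:
  fixes p :: "'v::finite cpoly"
  assumes const: "\<And>c. P (pconst c)"
    and mult: "\<And>v p. P p \<Longrightarrow> P (pvar v * p)"
    and add: "\<And>p q. P p \<Longrightarrow> P q \<Longrightarrow> P (p + q)"
  shows "P p"
proof (induction p rule: pm_induct)
  case (single m c)
  have pow: "P (pvar v ^ k * p)" if "P p" for v k p
    using that by (induction k) (simp_all add: mult mult.assoc)
  have "P ((\<Prod>v\<in>X. pvar v ^ Poly_Mapping.lookup m v) * pconst c)" for X
    by (induction X rule: infinite_finite_induct) (simp_all add: const pow mult.assoc)
  then show ?case by (simp add: monomial_eq mult.commute)
qed (rule add)

text \<open>
  Substituting constants for the variables gives a constant polynomial
  (\<open>psubst_pconst_eq_peval\<close>), whose coefficient at the monomial \<open>1\<close> is the value.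
\<close>
definition peval :: "('v::finite \<Rightarrow> complex) \<Rightarrow> 'v cpoly \<Rightarrow> complex" where
  "peval v p = Poly_Mapping.lookup (psubst (\<lambda>i. pconst (v i)) p :: 'v cpoly) 0"

lemma psubst_pconst_eq_peval:
  fixes v :: "'v::finite \<Rightarrow> complex"
  shows "psubst (\<lambda>i. pconst (v i)) p = (pconst (peval v p) :: 'w cpoly)"
proof -
  have "\<exists>c. psubst (\<lambda>i. pconst (v i)) p = (pconst c :: 'w cpoly)
            \<and> psubst (\<lambda>i. pconst (v i)) p = (pconst c :: 'v cpoly)" for v :: "'v \<Rightarrow> complex" and p
  proof (induction p rule: pm_induct)
    case (single m c)
    show ?case
      by (rule exI [of _ "c * (\<Prod>i\<in>UNIV. v i ^ Poly_Mapping.lookup m i)"])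
         (simp add: psubst_single pconst_power pconst_prod pconst_mult)
  next
    case (add p q)
    then obtain c d where
      "psubst (\<lambda>i. pconst (v i)) p = (pconst c :: 'w cpoly)"
      "psubst (\<lambda>i. pconst (v i)) p = (pconst c :: 'v cpoly)"
      "psubst (\<lambda>i. pconst (v i)) q = (pconst d :: 'w cpoly)"
      "psubst (\<lambda>i. pconst (v i)) q = (pconst d :: 'v cpoly)" by blast
    then show ?case
      by (intro exI [of _ "c + d"]) (simp add: psubst_add pconst_add)
  qed
  then obtain c where "psubst (\<lambda>i. pconst (v i)) p = (pconst c :: 'w cpoly)"
    "psubst (\<lambda>i. pconst (v i)) p = (pconst c :: 'v cpoly)" by blast
  then show ?thesis by (simp add: peval_def) (simp add: pconst_def)
qed

lemma pconst_inj: "pconst c = (pconst d :: 'w cpoly) \<longleftrightarrow> c = d"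
  unfolding pconst_def by (metis lookup_single_eq)

lemma peval_pconst [simp]: "peval v (pconst c) = c"
  by (simp add: peval_def psubst_pconst) (simp add: pconst_def)

lemma peval_pvar [simp]: "peval v (pvar i) = v i"
  by (simp add: peval_def psubst_pvar) (simp add: pconst_def)

lemma peval_add [simp]: "peval v (p + q) = peval v p + peval v q"
  by (simp add: peval_def psubst_add lookup_add)

lemma peval_mult [simp]: "peval v (p * q) = peval v p * peval v q"
proof -
  have "(pconst (peval v (p * q)) :: 'a cpoly) = pconst (peval v p * peval v q)"
    by (simp add: pconst_mult psubst_mult flip: psubst_pconst_eq_peval)
  then show ?thesis by (simp add: pconst_inj)
qed

lemma peval_0 [simp]: "peval v 0 = 0"
  using peval_pconst [of v 0] by (simp add: pconst_0)

lemma peval_1 [simp]: "peval v 1 = 1"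
  using peval_pconst [of v 1] by (simp add: pconst_1)

lemma peval_uminus [simp]: "peval v (- p) = - peval v p"
  using peval_add [of v p "- p"] by (simp add: eq_neg_iff_add_eq_0 add.commute)

lemma peval_diff [simp]: "peval v (p - q) = peval v p - peval v q"
  using peval_add [of v p "- q"] by simp

lemma peval_cscale [simp]: "peval v (cscale c p) = c * peval v p"
  by (simp add: cscale_pconst)

lemma pvar_nonzero: "(pvar a :: 'v::finite cpoly) \<noteq> 0"
  using peval_pvar [of "\<lambda>_. 1" a] by (metis peval_0 zero_neq_one)

lemma peval_power [simp]: "peval v (p ^ k) = peval v p ^ k"
  by (induction k) simp_all

lemma peval_sum [simp]: "peval v (\<Sum>x\<in>X. f x) = (\<Sum>x\<in>X. peval v (f x))"
  by (induction X rule: infinite_finite_induct) simp_all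

lemma peval_psubst: "peval v (psubst f p) = peval (\<lambda>i. peval v (f i)) p"
proof -
  have "(pconst (peval v (psubst f p)) :: 'b cpoly) = psubst (\<lambda>i. psubst (\<lambda>i. pconst (v i)) (f i)) p"
    by (simp only: psubst_psubst flip: psubst_pconst_eq_peval)
  also have "\<dots> = pconst (peval (\<lambda>i. peval v (f i)) p)"
    by (simp only: psubst_pconst_eq_peval)
  finally show ?thesis by (simp add: pconst_inj)
qed

lemma peval_shift [simp]: "peval v (shift c p) = peval (\<lambda>i. v i - c i) p"
  by (simp add: shift_def peval_psubst)

text \<open>Rescaling the coordinate in which two monomials differ eliminates one of them.\<close>
lemma monomials_independent:
  fixes A :: "('v::finite \<Rightarrow>\<^sub>0 nat) set" and c :: "('v \<Rightarrow>\<^sub>0 nat) \<Rightarrow> complex"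
  assumes "finite A" and "\<And>v. (\<Sum>m\<in>A. c m * (\<Prod>i\<in>UNIV. v i ^ Poly_Mapping.lookup m i)) = 0"
    and "m \<in> A"
  shows "c m = 0"
  using assms
proof (induction A arbitrary: c m)
  case empty
  then show ?case by simp
next
  case (insert a A)
  define mono where "mono m v = (\<Prod>i\<in>UNIV. v i ^ Poly_Mapping.lookup m i)"
    for m :: "'v \<Rightarrow>\<^sub>0 nat" and v :: "'v \<Rightarrow> complex"
  have eq: "c a * mono a v + (\<Sum>m\<in>A. c m * mono m v) = 0" for v
    using insert.prems(1) [of v] insert.hyps by (simp add: mono_def)
  have rest: "(\<Sum>m\<in>A. c m * mono m v) = - (c a * mono a v)" for v
    using eq [of v] by (metis add.inverse_unique)
  have scaled: "mono m (v(i := 2 * v i)) = 2 ^ Poly_Mapping.lookup m i * mono m v" for m v i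
  proof -
    have "mono m (v(i := 2 * v i)) =
        (\<Prod>j\<in>UNIV. (if j = i then 2 ^ Poly_Mapping.lookup m i else 1) * v j ^ Poly_Mapping.lookup m j)"
      unfolding mono_def by (rule prod.cong) (auto simp: power_mult_distrib)
    then show ?thesis by (simp add: prod.distrib mono_def)
  qed
  have zero: "c m = 0" if "m \<in> A" for m
  proof -
    obtain i where i: "Poly_Mapping.lookup m i \<noteq> Poly_Mapping.lookup a i"
      using \<open>m \<in> A\<close> insert.hyps by (metis poly_mapping_eqI)
    define c' where "c' m = c m * (2 ^ Poly_Mapping.lookup m i - 2 ^ Poly_Mapping.lookup a i)" for m
    have "(\<Sum>m\<in>A. c' m * mono m v) = 0" for v
    proof -
      have "(\<Sum>m\<in>A. c' m * mono m v) = (\<Sum>m\<in>A. c m * mono m (v(i := 2 * v i)))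
          - 2 ^ Poly_Mapping.lookup a i * (\<Sum>m\<in>A. c m * mono m v)"
        unfolding scaled c'_def sum_distrib_left sum_subtractf [symmetric]
        by (rule sum.cong) (simp_all add: left_diff_distrib right_diff_distrib mult_ac)
      also have "\<dots> = - (c a * mono a (v(i := 2 * v i)))
          - 2 ^ Poly_Mapping.lookup a i * - (c a * mono a v)"
        by (simp only: rest)
      also have "\<dots> = 0" unfolding scaled by simp
      finally show ?thesis .
    qed
    then have "c' m = 0"
      using insert.IH [of c' m] \<open>m \<in> A\<close> by (simp add: mono_def)
    moreover have "(2 :: complex) ^ k \<noteq> 2 ^ l" if "k \<noteq> l" for k l :: nat
    proof -
      have "(2 :: nat) ^ k \<noteq> 2 ^ l" using that by simp
      then show ?thesis by (metis of_nat_eq_iff of_nat_numeral of_nat_power)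
    qed
    ultimately show ?thesis using i by (simp add: c'_def)
  qed
  moreover have "c a = 0"
    using eq [of "\<lambda>_. 1"] zero by (simp add: mono_def)
  ultimately show ?case using insert.prems by auto
qed

lemma peval_eqI:
  fixes p q :: "'v::finite cpoly"
  assumes "\<And>v. peval v p = peval v q"
  shows "p = q"
proof -
  define d where "d = p - q"
  have "peval v d = (\<Sum>m\<in>Poly_Mapping.keys d. Poly_Mapping.lookup d m *
      (\<Prod>i\<in>UNIV. v i ^ Poly_Mapping.lookup m i))" for v
    by (simp add: peval_def psubst_def pconst_power pconst_prod lookup_sum flip: pconst_mult)
       (simp add: pconst_def)
  moreover have "peval v d = 0" for v
    using assms by (simp add: d_def)
  ultimately have "Poly_Mapping.lookup d m = 0" if "m \<in> Poly_Mapping.keys d" for m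
    using monomials_independent [of "Poly_Mapping.keys d" "Poly_Mapping.lookup d" m] that by simp
  then have "d = 0"
    by (metis in_keys_iff poly_mapping_eqI lookup_zero)
  then show ?thesis by (simp add: d_def)
qed

lemma peval_on_line: "\<exists>P. \<forall>t. poly P t = peval (\<lambda>i. v i + t * w i) p"
proof (induction p rule: cpoly_induct)
  case (const c)
  show ?case by (rule exI [of _ "[:c:]"]) simp
next
  case (mult i p)
  then obtain P where "\<forall>t. poly P t = peval (\<lambda>i. v i + t * w i) p" ..
  then show ?case by (intro exI [of _ "[:v i, w i:] * P"]) (simp add: algebra_simps)
next
  case (add p q)
  then obtain P Q where "\<forall>t. poly P t = peval (\<lambda>i. v i + t * w i) p"
    "\<forall>t. poly Q t = peval (\<lambda>i. v i + t * w i) q" by auto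
  then show ?case by (intro exI [of _ "P + Q"]) simp
qed

text \<open>Through a point where \<open>p\<close> does not vanish and one where \<open>q\<close> does not vanish there is a line,
  and polynomials in one variable form an integral domain.\<close>
lemma cpoly_no_zero_divisors:
  fixes p q :: "'v::finite cpoly"
  assumes "p \<noteq> 0" "q \<noteq> 0"
  shows "p * q \<noteq> 0"
proof
  assume pq: "p * q = 0"
  obtain v where v: "peval v p \<noteq> 0" using assms(1) by (metis peval_eqI peval_0)
  obtain w where w: "peval w q \<noteq> 0" using assms(2) by (metis peval_eqI peval_0)
  obtain P where P: "\<And>t. poly P t = peval (\<lambda>i. v i + t * (w i - v i)) p"
    using peval_on_line by metis
  obtain Q where Q: "\<And>t. poly Q t = peval (\<lambda>i. v i + t * (w i - v i)) q"
    using peval_on_line by metis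
  have "poly (P * Q) t = 0" for t
    using pq by (simp add: P Q flip: peval_mult)
  then have "P * Q = 0" by (simp add: poly_eq_poly_eq_iff [symmetric] fun_eq_iff)
  moreover have "poly P 0 \<noteq> 0" "poly Q 1 \<noteq> 0" using v w by (simp_all add: P Q)
  ultimately show False by auto
qed

text \<open>
  An equation between polynomials may be proved after division by a nonzero polynomial, that is,
  at the points where the latter does not vanish.
\<close>
lemma cpoly_cancel:
  fixes p q :: "'v::finite cpoly"
  assumes "q \<noteq> 0" and "\<And>v. peval v q \<noteq> 0 \<Longrightarrow> peval v p = peval v p'"
  shows "p = p'"
proof -
  have "q * (p - p') = 0"
    by (rule peval_eqI) (use assms(2) in auto)
  then show ?thesis using cpoly_no_zero_divisors [OF assms(1), of "p - p'"] by auto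
qed

text \<open>Restricted to a line through the origin, a unit is a unit of \<open>\<complex>[t]\<close>.\<close>
lemma cpoly_unit_imp_constant:
  fixes p q :: "'v::finite cpoly"
  assumes "p * q = 1"
  obtains c where "c \<noteq> 0" "p = pconst c"
proof -
  have pq: "peval v p * peval v q = 1" for v
    using assms by (simp flip: peval_mult)
  have "peval v p = peval (\<lambda>_. 0) p" for v
  proof -
    obtain P where P: "\<And>t. poly P t = peval (\<lambda>i. 0 + t * v i) p"
      using peval_on_line [of "\<lambda>_. 0"] by metis
    obtain Q where Q: "\<And>t. poly Q t = peval (\<lambda>i. 0 + t * v i) q"
      using peval_on_line [of "\<lambda>_. 0"] by metis
    have "poly (P * Q) t = poly 1 t" for t
      using pq by (simp add: P Q)
    then have "P * Q = 1" by (simp only: poly_eq_poly_eq_iff [symmetric] fun_eq_iff) simp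
    then have "P \<noteq> 0" "Q \<noteq> 0" and "degree (P * Q) = 0" by auto
    then have "degree P = 0" by (simp add: degree_mult_eq)
    then obtain c where "P = [:c:]" by (rule degree_eq_zeroE)
    then have "poly P 1 = poly P 0" by simp
    then show ?thesis by (simp add: P)
  qed
  then have "p = pconst (peval (\<lambda>_. 0) p)"
    by (intro peval_eqI) simp
  moreover have "peval (\<lambda>_. 0) p \<noteq> 0" using pq by (metis mult_zero_left zero_neq_one)
  ultimately show ?thesis using that by blast
qed

text \<open>Every polynomial is congruent modulo \<open>X\<^sub>a\<close> to the result of substituting \<open>0\<close> for \<open>X\<^sub>a\<close>.\<close>
lemma pvar_dvd:
  fixes p :: "'v::finite cpoly"
  assumes "\<And>v. v a = 0 \<Longrightarrow> peval v p = 0"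
  shows "\<exists>q. p = pvar a * q"
proof -
  let ?g = "\<lambda>v. if v = a then 0 else pvar v"
  have "\<exists>q. p = psubst ?g p + pvar a * q" for p :: "'v cpoly"
  proof (induction p rule: cpoly_induct)
    case (const c)
    show ?case by (rule exI [of _ 0]) (simp add: psubst_pconst)
  next
    case (mult v p)
    then obtain q where q: "p = psubst ?g p + pvar a * q" ..
    show ?case
    proof (cases "v = a")
      case True
      then show ?thesis by (intro exI [of _ p]) (simp add: psubst_mult psubst_pvar)
    next
      case False
      have "pvar v * p = pvar v * psubst ?g p + pvar v * (pvar a * q)"
        by (subst q) (rule distrib_left)
      also have "pvar v * psubst ?g p = psubst ?g (pvar v * p)"
        using False by (simp add: psubst_mult psubst_pvar)
      also have "pvar v * (pvar a * q) = pvar a * (pvar v * q)"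
        by (rule mult.left_commute)
      finally show ?thesis ..
    qed
  next
    case (add p q)
    then obtain p' q' where "p = psubst ?g p + pvar a * p'" "q = psubst ?g q + pvar a * q'" by blast
    then have "p + q = psubst ?g p + pvar a * p' + (psubst ?g q + pvar a * q')"
      by (rule arg_cong2 [of _ _ _ _ "(+)"])
    also have "\<dots> = psubst ?g (p + q) + pvar a * (p' + q')"
      by (simp add: psubst_add algebra_simps)
    finally show ?case ..
  qed
  then obtain q where "p = psubst ?g p + pvar a * q" by blast
  moreover have "psubst ?g p = 0"
    by (rule peval_eqI) (simp add: peval_psubst assms)
  ultimately have "p = pvar a * q" by (simp only: add_0)
  then show ?thesis ..
qed

lemma poly_periodic:
  fixes P :: "complex poly"
  assumes "c \<noteq> 0" "\<And>t. poly P (t - c) = poly P t"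
  shows "P = [:poly P 0:]"
proof -
  have "poly P (of_nat k * c) = poly P 0" for k
  proof (induction k)
    case (Suc k)
    have "poly P (of_nat (Suc k) * c) = poly P (of_nat (Suc k) * c - c)" by (simp only: assms(2))
    also have "of_nat (Suc k) * c - c = of_nat k * c" by (simp add: algebra_simps)
    finally show ?case using Suc by simp
  qed simp
  then have "range (\<lambda>k. of_nat k * c) \<subseteq> {t. poly (P - [:poly P 0:]) t = 0}" by auto
  moreover have "infinite (range (\<lambda>k. of_nat k * c))"
    using assms(1) by (intro range_inj_infinite) (auto simp: inj_on_def)
  ultimately have "P - [:poly P 0:] = 0"
    using finite_subset poly_roots_finite by blast
  then show ?thesis by simp
qed

text \<open>
  Invariance under one translation is invariance under all its complex multiples, since a
  periodic polynomial in one variable is constant.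
\<close>
lemma shift_invariant_line:
  assumes "shift d p = p"
  shows "peval (\<lambda>i. v i + t * d i) p = peval v p"
proof -
  obtain P where P: "\<And>t. poly P t = peval (\<lambda>i. v i + t * d i) p"
    using peval_on_line by metis
  have "poly P (t - 1) = poly P t" for t
  proof -
    have "peval (\<lambda>i. v i + t * d i) p = peval (\<lambda>i. v i + t * d i) (shift d p)" by (simp only: assms)
    then show ?thesis by (simp add: P algebra_simps)
  qed
  then have "P = [:poly P 0:]" using poly_periodic [of 1 P] by simp
  then obtain c where "P = [:c:]" ..
  then have "poly P t = poly P 0" by simp
  then show ?thesis by (simp add: P)
qed

lemma shift_invariant_coordinates:
  fixes p :: "'v::finite cpoly"
  assumes "\<And>a. a \<in> S \<Longrightarrow> shift (\<lambda>i. if i = a then 1 else 0) p = p"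
    and "\<And>i. i \<notin> S \<Longrightarrow> v i = w i"
  shows "peval v p = peval w p"
proof -
  have "finite S" by simp
  then show ?thesis using assms
  proof (induction S arbitrary: v)
    case empty
    then have "v = w" by auto
    then show ?case by simp
  next
    case (insert a S)
    have "peval v p = peval (\<lambda>i. v i + (w a - v a) * (if i = a then 1 else 0)) p"
      using shift_invariant_line insert.prems(1) [of a] by (metis insertI1)
    also have "\<dots> = peval w p"
      by (rule insert.IH) (use insert.prems in auto)
    finally show ?case .
  qed
qed

lemma shift_add: "shift c (p + q) = shift c p + shift c q"
  and shift_mult: "shift c (p * q) = shift c p * shift c q"
  and shift_pconst: "shift c (pconst a) = pconst a"
  and shift_cscale: "shift c (cscale a p) = cscale a (shift c p)"
  by (simp_all add: shift_def psubst_add psubst_mult psubst_pconst cscale_pconst)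

section \<open>Functional equations on a line and on the integer lattice\<close>

lemma degree_le_1E:
  fixes p :: "'a::zero poly"
  assumes "degree p \<le> 1"
  obtains a b where "p = [:a, b:]"
proof -
  have "p = [:coeff p 0, coeff p 1:]"
    using assms by (intro poly_eqI) (auto simp: coeff_pCons coeff_eq_0 split: nat.split)
  then show ?thesis using that by blast
qed

text \<open>
  Where it is used, \<open>Q j\<close> and \<open>F k\<close> are the restrictions to a line in direction \<open>r\<close> of the
  polynomials of \<open>t\<^sup>j\<^sup>r d\<^sub>i\<close> and \<open>H\<^sub>a(k r)\<close>, with \<open>\<rho> = r\<^sub>i\<close> and \<open>h\<close> the value of \<open>H\<^sub>a\<close>, which is
  constant on the line. The relation for \<open>(j, - j)\<close> says that the polynomial
  \<open>F\<^sub>-\<^sub>j(t) Q\<^sub>j(t + j)\<close> has the constant difference \<open>j \<rho> h\<close>, hence degree \<open>1\<close>, so one factor is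
  constant and the other one linear. If \<open>Q\<^sub>j\<close> were constant, then the relations for \<open>(j, j)\<close> and
  \<open>(j, 2 j)\<close> would take differences of \<open>F\<^sub>j\<close> twice and give \<open>F\<^sub>3\<^sub>j = 0\<close>. Therefore all \<open>F\<^sub>k\<close> are
  constant, and the leading coefficients \<open>A\<^sub>j\<close> of the \<open>Q\<^sub>j\<close> multiply them: \<open>A\<^sub>j \<phi>\<^sub>k = \<rho> \<phi>\<^sub>j\<^sub>+\<^sub>k\<close>
  for \<open>j, k \<noteq> 0\<close>.
\<close>
lemma line_structure_constants:
  fixes Q F :: "int \<Rightarrow> complex poly" and h \<rho> :: complex
  assumes h: "h \<noteq> 0" and \<rho>: "\<rho> \<noteq> 0" and F0: "F 0 = [:h:]"
    and rel: "\<And>j k t. poly (Q j) t * poly (F k) (t - of_int j) - poly (F k) t * poly (Q j) (t - of_int k)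
        = of_int k * \<rho> * poly (F (j + k)) t"
  obtains \<phi> where "\<And>k. F k = [:\<phi> k:]" "\<phi> 1 * \<phi> (- 1) = h\<^sup>2" "(\<phi> 1)\<^sup>2 = h * \<phi> 2"
proof -
  have deg: "degree (F (- j)) + degree (Q j) = 1" and nz: "F (- j) \<noteq> 0" if "j \<noteq> 0" for j
  proof -
    define G where "G = F (- j) * pcompose (Q j) [:of_int j, 1:]"
    have G: "poly G t = poly (F (- j)) t * poly (Q j) (t + of_int j)" for t
      by (simp add: G_def poly_pcompose add.commute)
    define P where "P = G - [:0, \<rho> * h:]"
    have "poly P (t - of_int j) = poly P t" for t
      using rel [of j t "- j"] by (simp add: P_def G F0 algebra_simps)
    then have "P = [:poly P 0:]"
      using poly_periodic [of "of_int j" P] \<open>j \<noteq> 0\<close> by simp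
    then have "G = [:poly P 0, \<rho> * h:]"
      by (metis P_def diff_add_cancel add_pCons add_0 add.right_neutral)
    then have deg: "degree G = 1" using h \<rho> by simp
    then have "G \<noteq> 0" by auto
    then have nz: "F (- j) \<noteq> 0" "pcompose (Q j) [:of_int j, 1:] \<noteq> 0" by (auto simp: G_def)
    then show "F (- j) \<noteq> 0" by simp
    show "degree (F (- j)) + degree (Q j) = 1"
      using deg nz by (simp add: G_def degree_mult_eq degree_pcompose)
  qed
  have Fnz: "F k \<noteq> 0" for k
    using nz [of "- k"] F0 h by (cases "k = 0") auto
  have degQ: "degree (Q j) = 1" if j: "j \<noteq> 0" for j
  proof (rule ccontr)
    assume "degree (Q j) \<noteq> 1"
    then have "degree (Q j) = 0" using deg [OF j] by arith
    then obtain c where Qj: "Q j = [:c:]" by (rule degree_eq_zeroE)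
    have "degree (F j) \<le> 1" using deg [of "- j"] j by simp
    then obtain a b where Fj: "F j = [:a, b:]" by (rule degree_le_1E)
    have "of_int j * (\<rho> * poly (F (2 * j)) t) = of_int j * (- c * b)" for t
      using rel [of j t j] by (simp add: Qj Fj algebra_simps)
    then have "\<rho> * poly (F (2 * j)) t = - c * b" for t
      using j by (metis mult_cancel_left of_int_eq_0_iff)
    then have "poly (F (2 * j)) t = - c * b / \<rho>" for t
      using \<rho> by (metis nonzero_mult_div_cancel_left)
    then have "poly (F (3 * j)) t = 0" for t
      using rel [of j t "2 * j"] j \<rho> by (simp add: Qj algebra_simps)
    then have "F (3 * j) = 0" using poly_all_0_iff_0 by blast
    then show False using Fnz by blast
  qed
  have degF: "degree (F k) = 0" for k
    using deg [of "- k"] degQ [of "- k"] F0 by (cases "k = 0") auto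
  define \<phi> where "\<phi> k = poly (F k) 0" for k
  have F: "F k = [:\<phi> k:]" for k
  proof -
    obtain c where "F k = [:c:]" using degF [of k] by (rule degree_eq_zeroE)
    then show ?thesis by (simp add: \<phi>_def)
  qed
  have \<phi>nz: "\<phi> k \<noteq> 0" for k using Fnz [of k] by (simp add: F)
  have \<phi>0: "\<phi> 0 = h" by (simp add: \<phi>_def F0)
  have "\<exists>A. \<forall>k. k \<noteq> 0 \<longrightarrow> A * \<phi> k = \<rho> * \<phi> (j + k)" if j: "j \<noteq> 0" for j
  proof -
    obtain b A where Q: "Q j = [:b, A:]"
      using degQ [OF j] by (metis degree_le_1E order_refl)
    have "of_int k * (A * \<phi> k) = of_int k * (\<rho> * \<phi> (j + k))" for k
      using rel [of j 0 k] by (simp add: F Q algebra_simps)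
    then show ?thesis by (intro exI [of _ A]) auto
  qed
  then obtain A where A: "\<And>j k. j \<noteq> 0 \<Longrightarrow> k \<noteq> 0 \<Longrightarrow> A j * \<phi> k = \<rho> * \<phi> (j + k)" by metis
  have A1: "A 1 * \<phi> (-1) = \<rho> * h" "A 1 * \<phi> 1 = \<rho> * \<phi> 2" "A 1 * \<phi> (-2) = \<rho> * \<phi> (-1)"
    and A2: "A 2 * \<phi> (-1) = \<rho> * \<phi> 1" "A 2 * \<phi> (-2) = \<rho> * h"
    using A [of 1 "-1"] A [of 1 1] A [of 1 "-2"] A [of 2 "-1"] A [of 2 "-2"] by (simp_all add: \<phi>0)
  have "\<rho> * (\<phi> 1 * \<phi> (-2)) = \<rho> * (h * \<phi> (-1))"
    using A2 by (metis mult.assoc mult.commute)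
  then have i: "\<phi> 1 * \<phi> (-2) = h * \<phi> (-1)" using \<rho> by simp
  have "\<rho> * (h * \<phi> (-2)) = \<rho> * (\<phi> (-1) * \<phi> (-1))"
    using A1 by (metis mult.assoc mult.commute)
  then have ii: "h * \<phi> (-2) = \<phi> (-1) * \<phi> (-1)" using \<rho> by simp
  have "\<rho> * (h * \<phi> 1) = \<rho> * (\<phi> 2 * \<phi> (-1))"
    using A1 by (metis mult.assoc mult.commute)
  then have iii: "h * \<phi> 1 = \<phi> 2 * \<phi> (-1)" using \<rho> by simp
  have iv: "\<phi> 1 * \<phi> (-1) = h\<^sup>2"
  proof -
    have "\<phi> (-1) * (\<phi> 1 * \<phi> (-1)) = \<phi> 1 * (\<phi> (-1) * \<phi> (-1))" by (simp add: mult_ac)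
    also have "\<dots> = h * (\<phi> 1 * \<phi> (-2))" by (simp add: mult_ac flip: ii)
    also have "\<dots> = \<phi> (-1) * h\<^sup>2" by (simp add: i power2_eq_square mult_ac)
    finally have "\<phi> (-1) * (\<phi> 1 * \<phi> (-1)) = \<phi> (-1) * h\<^sup>2" .
    then show ?thesis using \<phi>nz by simp
  qed
  moreover have "(\<phi> 1)\<^sup>2 = h * \<phi> 2"
  proof -
    have "h\<^sup>2 * \<phi> 2 = \<phi> 1 * (\<phi> 2 * \<phi> (-1))" by (simp add: mult_ac flip: iv)
    also have "\<dots> = h * (\<phi> 1)\<^sup>2" using iii by (simp add: power2_eq_square mult_ac)
    finally have "h\<^sup>2 * \<phi> 2 = h * (\<phi> 1)\<^sup>2" .
    then show ?thesis using h by (simp add: power2_eq_square)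
  qed
  ultimately show ?thesis using that F by blast
qed

text \<open>
  The relation is silent about \<open>s = 0\<close>, and this makes the case \<open>r + s = 0\<close> of the conclusion
  special: it goes through \<open>f (2 r)\<close>.
\<close>
lemma almost_multiplicative_imp_multiplicative:
  fixes f c :: "'a::ab_group_add \<Rightarrow> complex"
  assumes nz: "\<And>r. f r \<noteq> 0" and one: "f 0 = 1"
    and torsion: "\<And>r :: 'a. r + r = 0 \<Longrightarrow> r = 0"
    and rel: "\<And>r s. s \<noteq> 0 \<Longrightarrow> f (r + s) = c r * f s"
  shows "f (r + s) = f r * f s"
proof -
  have c: "c r * f (- r) = 1" if "r \<noteq> 0" for r
    using rel [of "- r" r] that by (simp add: one)
  have mult: "f (r + s) = f r * f s" if "r + s \<noteq> 0" for r s
  proof (cases "r = 0")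
    case False
    have "f s = c (- r) * f (r + s)" using rel [of "r + s" "- r"] that by simp
    moreover have "c (- r) * f r = 1" using c [of "- r"] False by simp
    ultimately show ?thesis by (metis mult.commute mult.left_commute mult_1)
  qed (simp add: one)
  have inv: "f r * f (- r) = 1" if "r \<noteq> 0" for r
  proof -
    have "f r = f (r + r) * f (- r)"
      using mult [of "r + r" "- r"] that by simp
    also have "f (r + r) = f r * f r"
      using mult [of r r] that torsion by blast
    finally show ?thesis using nz [of r] by simp
  qed
  show "f (r + s) = f r * f s"
  proof (cases "r + s = 0")
    case True
    then have s: "s = - r" by (simp add: eq_neg_iff_add_eq_0 add.commute)
    show ?thesis
      by (cases "r = 0") (simp_all add: s one inv)
  qed (rule mult)
qed

text \<open>
  With \<open>s = - r\<close> the relation gives \<open>e j (- r) = - e j r\<close> and the symmetry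
  \<open>r\<^sub>i e\<^sub>j(r) = r\<^sub>j e\<^sub>i(r)\<close>; with \<open>i = j\<close> and \<open>s\<^sub>j = 0\<close> it shows that \<open>e\<^sub>j(r)\<close> depends on \<open>r\<^sub>j\<close>
  only. As a function of \<open>r\<^sub>j\<close> it satisfies the equation \<open>(k - m) b(k + m) = k b(k) - m b(m)\<close>
  known from the Witt algebra, whose odd solutions are linear, and the symmetry makes the slopes
  for different \<open>j\<close> equal.
\<close>
lemma witt_relation_imp_linear:
  fixes e :: "'n::finite \<Rightarrow> int ^ 'n \<Rightarrow> complex"
  assumes e0: "\<And>j. e j 0 = 0"
    and rel: "\<And>i j r s. of_int (s $ i) * e j s - of_int (r $ j) * e i r
        = of_int (s $ i) * e j (r + s) - of_int (r $ j) * e i (r + s)"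
  shows "\<exists>c. \<forall>j r. e j r = c * of_int (r $ j)"
proof -
  have refl: "of_int (r $ i) * e j (- r) = - (of_int (r $ j) * e i r)" for i j r
  proof -
    have "- (of_int (r $ i) * e j (- r)) - of_int (r $ j) * e i r = 0"
      using rel [of "- r" i j r] by (simp add: e0)
    then have "- (of_int (r $ i) * e j (- r)) = of_int (r $ j) * e i r" by simp
    then show ?thesis by (metis minus_equation_iff)
  qed
  have zero: "e j r = 0" if "r $ j = 0" for j r
  proof (cases "r = 0")
    case False
    then obtain i where "r $ i \<noteq> 0" by (auto simp: Finite_Cartesian_Product.vec_eq_iff)
    then show ?thesis using refl [of "- r" i j] that by simp
  qed (simp add: e0)
  have odd: "e j (- r) = - e j r" for j r
  proof (cases "r $ j = 0")
    case False
    have "of_int (r $ j) * (e j (- r) + e j r) = 0"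
      using refl [of r j j] by (simp add: distrib_left)
    then show ?thesis using False by (simp add: eq_neg_iff_add_eq_0)
  qed (simp add: zero)
  have sym: "of_int (r $ i) * e j r = of_int (r $ j) * e i r" for i j r
    using refl [of r i j] by (simp add: odd)
  define b where "b j k = e j (axis j k)" for j k
  have b: "e j r = b j (r $ j)" for j r
  proof (cases "r $ j = 0")
    case True
    then show ?thesis using zero by (simp add: b_def axis_def)
  next
    case False
    have "e j (r + s) = e j r" if "s $ j = 0" for s
      using rel [of s j j r] that False by simp
    from this [of "axis j (r $ j) - r"] show ?thesis by (simp add: b_def)
  qed
  have b0: "b j 0 = 0" and bodd: "b j (- k) = - b j k" for j k
    using zero [of "axis j 0" j] odd [of j "axis j k"] b [of j "- axis j k"]
    by (simp_all add: b_def)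
  have brel: "of_int (k - m) * b j (k + m) = of_int k * b j k - of_int m * b j m" for j k m
    using rel [of "axis j k" j j "axis j m"] by (simp add: b add.commute algebra_simps)
  \<comment> \<open>The relation with \<open>m = 1\<close> yields \<open>b(k + 1)\<close> from \<open>b(k)\<close>, but for \<open>k = 1\<close> it is void.\<close>
  have b2: "b j 2 = 2 * b j 1" for j
    using brel [of 2 "-1" j] bodd [of j 1] by simp
  have bnat: "b j (int k) = of_nat k * b j 1" for j k
  proof (induction k rule: less_induct)
    case (less k)
    consider "k = 0" | "k = 1" | "k = 2" | m where "k = Suc (Suc (Suc m))"
      by (metis One_nat_def Suc_1 not0_implies_Suc)
    then show ?case
    proof cases
      case 4
      have "of_int (int m + 1) * b j (int k) = of_int (int m + 2) * b j (int (m + 2)) - b j 1"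
        using brel [of "int m + 2" 1 j] 4 by (simp add: add.commute)
      also have "b j (int (m + 2)) = of_nat (m + 2) * b j 1"
        using less.IH [of "m + 2"] 4 by simp
      also have "of_int (int m + 2) * (of_nat (m + 2) * b j 1) - b j 1
          = of_int (int m + 1) * (of_nat k * b j 1)"
        using 4 by (simp add: algebra_simps)
      finally show ?thesis
        by (metis mult_cancel_left of_int_eq_0_iff of_nat_0_le_iff add_nonneg_eq_0_iff zero_le_one zero_neq_one)
    qed (simp_all add: b0 b2)
  qed
  have blin: "b j k = of_int k * b j 1" for j k
  proof (cases "k \<ge> 0")
    case True
    then show ?thesis using bnat [of j "nat k"] by simp
  next
    case False
    then show ?thesis using bnat [of j "nat (- k)"] bodd [of j k] by simp
  qed
  have "b i 1 = b j 1" for i j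
  proof (cases "i = j")
    case False
    then show ?thesis using sym [of "axis i 1 + axis j 1" i j] by (simp add: b axis_def)
  qed simp
  then have "b j 1 = b undefined 1" for j .
  then show ?thesis
    by (intro exI [of _ "b undefined 1"]) (metis b blin mult.commute)
qed

section \<open>Degree shifts and brackets with elements of degree zero\<close>

definition degree_shift :: "int ^ 'n::finite \<Rightarrow> 'l::finite + 'n \<Rightarrow> complex" where
  "degree_shift r v = (case v of Inl i \<Rightarrow> 0 | Inr j \<Rightarrow> of_int (r $ j))"

lemma tau_eq_shift: "tau r = shift (degree_shift r)"
  unfolding tau_def by (simp add: degree_shift_def [abs_def])

definition root_shift :: "'l::finite \<Rightarrow> complex \<Rightarrow> 'l + 'n::finite \<Rightarrow> complex" where
  "root_shift a \<epsilon> v = (if v = Inl a then \<epsilon> else 0)"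

lemma degree_shift_simps [simp]:
  "degree_shift r (Inl i) = 0" "degree_shift r (Inr j) = of_int (r $ j)"
  "degree_shift (k *s r) v = of_int k * degree_shift r v"
  "degree_shift (r + s) v = degree_shift r v + degree_shift s v"
  by (simp_all add: degree_shift_def split: sum.split)

lemma tau_simps [simp]:
  "tau r (p + q) = tau r p + tau r q" "tau r (p - q) = tau r p - tau r q"
  "tau r (p * q) = tau r p * tau r q"
  "tau r (pconst c) = pconst c" "tau r (cscale c p) = cscale c (tau r p)" "tau r 1 = 1" "tau r 0 = 0"
proof -
  have *: "tau r (p + q) = tau r p + tau r q" for p q
    by (simp add: tau_eq_shift shift_add)
  show "tau r (p + q) = tau r p + tau r q" by (rule *)
  show "tau r (p - q) = tau r p - tau r q"
    using * [of "p - q" q] by simp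
  show "tau r (p * q) = tau r p * tau r q" "tau r (pconst c) = pconst c"
    "tau r (cscale c p) = cscale c (tau r p)"
    by (simp_all add: tau_eq_shift shift_mult shift_pconst shift_cscale)
  show "tau r 0 = 0" using * [of 0 0] by simp
  show "tau r 1 = 1" using shift_pconst [of _ 1] by (simp add: tau_eq_shift pconst_1)
qed

declare tau_pvar [simp]

lemma tau_zero [simp]:
  fixes p :: "('l::finite + 'n::finite) cpoly"
  shows "tau 0 p = p"
proof -
  have "degree_shift (0 :: int ^ 'n) = (\<lambda>v :: 'l + 'n. 0)"
    by (auto simp: degree_shift_def fun_eq_iff split: sum.split)
  then show ?thesis by (simp add: tau_eq_shift shift_0)
qed

lemma cscale_simps [simp]:
  "cscale c 0 = 0" "cscale 0 p = 0" "cscale 1 p = p" "cscale c (cscale d p) = cscale (c * d) p"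
  "cscale c (p + q) = cscale c p + cscale c q" "cscale c (p - q) = cscale c p - cscale c q"
  by (auto intro!: poly_mapping_eqI simp: lookup_add lookup_minus algebra_simps)

context
  fixes sg :: "complex \<Rightarrow> 'g::ab_group_add \<Rightarrow> 'g" and br :: "'g \<Rightarrow> 'g \<Rightarrow> 'g"
  assumes lie: "lie_algebra sg br"
begin

interpretation V: vector_space sg by (rule lie_algebra_vector_space [OF lie])

lemma tor_scale_simps:
  fixes z :: 'g and r :: "int ^ 'n::finite"
  shows "tor_scale sg c (tor_loop z r) = tor_loop (sg c z) r"
    and "tor_scale sg c (tor_d r j :: ('g, 'n) toroidal) = (0, 0, axis j (cscale c (tpow r)))"
    and "tor_scale sg c (0, k :: 'n kah, 0) = (0, kah_scale c k, 0)"
proof -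
  have single: "Poly_Mapping.map (sg c) (Poly_Mapping.single r z) = Poly_Mapping.single r (sg c z)"
    by (rule poly_mapping_eqI) (simp add: Poly_Mapping.map.rep_eq lookup_single when_def)
  have zero: "Poly_Mapping.map (sg c) (0 :: int ^ 'n \<Rightarrow>\<^sub>0 'g) = 0"
    by (rule poly_mapping_eqI) (simp add: Poly_Mapping.map.rep_eq when_def)
  have c0: "cscale c (0 :: 'n laurent) = 0" by (rule poly_mapping_eqI) simp
  have v0: "vscale c (0 :: 'n der) = 0"
    by (simp add: vscale_def Finite_Cartesian_Product.vec_eq_iff c0)
  have vaxis: "vscale c (axis j p) = axis j (cscale c p)" for p :: "'n laurent"
    by (simp add: vscale_def Finite_Cartesian_Product.vec_eq_iff axis_if c0)
  show "tor_scale sg c (tor_loop z r) = tor_loop (sg c z) r"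
    by (simp add: tor_scale_def tor_loop_def single v0 kah_scale_0)
  show "tor_scale sg c (tor_d r j :: ('g, 'n) toroidal) = (0, 0, axis j (cscale c (tpow r)))"
    by (simp add: tor_scale_def tor_d_def zero vaxis kah_scale_0)
  show "tor_scale sg c (0, k :: 'n kah, 0) = (0, kah_scale c k, 0)"
    by (simp add: tor_scale_def zero v0)
qed

text \<open>
  These brackets exhibit \<open>z(r)\<close> and \<open>t\<^sup>r d\<^sub>j\<close> as weight vectors for \<open>\<hh> \<oplus> D\<close>.
\<close>
lemma tor_bracket_degree_zero:
  fixes r :: "int ^ 'n::finite"
  shows "tor_bracket sg br c1 c2 (tor_loop z 0) (tor_loop w r) = tor_loop (br z w) r"
    and "tor_bracket sg br c1 c2 (tor_d 0 j) (tor_loop w r) = tor_loop (sg (of_int (r $ j)) w) r"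
    and "tor_bracket sg br c1 c2 (tor_loop z 0) (tor_d r j) = 0"
    and "tor_bracket sg br c1 c2 (tor_d 0 i) (tor_d r j) =
      tor_scale sg (of_int (r $ i)) (tor_d r j :: ('g, 'n) toroidal)"
proof -
  have c0: "cscale 0 f = 0" for f :: "'n laurent" by (rule poly_mapping_eqI) simp
  have z: "(\<chi> p. 0) = (0 :: 'n omega)" by (simp add: Finite_Cartesian_Product.vec_eq_iff)
  have ax0: "axis k 0 = (0 :: 'n der)" for k
    by (simp add: axis_def Finite_Cartesian_Product.vec_eq_iff)
  show "tor_bracket sg br c1 c2 (tor_loop z 0) (tor_loop w r) = tor_loop (br z w) r"
    by (simp add: tor_bracket_loop_loop [OF lie] c0 z) (simp add: tor_loop_def)
  show "tor_bracket sg br c1 c2 (tor_d 0 j) (tor_loop w r) = tor_loop (sg (of_int (r $ j)) w) r"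
    by (simp add: tor_bracket_d_loop [OF V.vector_space_axioms]) (simp add: tor_loop_def)
  have "der_loop sg (axis j (tpow r)) (Poly_Mapping.single 0 z) = 0"
    using tor_bracket_d_loop [OF V.vector_space_axioms, of br c1 c2 r j z 0]
    by (simp add: tor_bracket_def tor_loop_def tor_d_def loop_bracket_def loop_central_0
        der_loop_0 kah_act_0 phi_0 kah_scale_0 der_bracket_0)
  then show "tor_bracket sg br c1 c2 (tor_loop z 0) (tor_d r j) = 0"
    by (simp add: tor_bracket_def tor_loop_def tor_d_def loop_bracket_def loop_central_0
        der_loop_0 kah_act_0 phi_0 kah_scale_0 der_bracket_0 zero_prod_def)
  show "tor_bracket sg br c1 c2 (tor_d 0 i) (tor_d r j) =
      tor_scale sg (of_int (r $ i)) (tor_d r j :: ('g, 'n) toroidal)"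
    unfolding tor_bracket_d_d phi1_basis phi2_basis der_bracket_basis tor_scale_simps
    by (simp add: z kah_scale_0 of_int_mult_eq_cscale ax0)
qed

lemma tor_bracket_d_d_modulo_centre:
  fixes r :: "int ^ 'n::finite"
  shows "\<exists>k. tor_bracket sg br c1 c2 (tor_d r i) (tor_d s j) = (0, k, 0)
      + (tor_scale sg (of_int (s $ i)) (tor_d (r + s) j)
      + tor_scale sg (- of_int (r $ j)) (tor_d (r + s) i :: ('g, 'n) toroidal))"
proof -
  have neg: "axis i (cscale (- c) p) = - axis i (cscale c p)" for i :: 'n and c and p :: "'n laurent"
    by (auto simp: axis_def Finite_Cartesian_Product.vec_eq_iff intro!: poly_mapping_eqI)
  show ?thesis
    unfolding tor_bracket_d_d der_bracket_basis tor_scale_simps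
    by (simp add: of_int_mult_eq_cscale neg)
qed

lemma tor_loop_linear:
  fixes r :: "int ^ 'n::finite" and z w :: 'g and f :: "'i \<Rightarrow> 'g"
  shows "tor_loop (z + w) r = tor_loop z r + tor_loop w r" "tor_loop (0 :: 'g) r = 0"
    "tor_loop (\<Sum>i\<in>X. f i) r = (\<Sum>i\<in>X. tor_loop (f i) r)"
proof -
  have add: "tor_loop (z + w) r = tor_loop z r + tor_loop w r" for z w :: 'g
    by (simp add: tor_loop_def single_add)
  have zero: "tor_loop (0 :: 'g) r = 0"
    by (simp add: tor_loop_def zero_prod_def)
  show "tor_loop (z + w) r = tor_loop z r + tor_loop w r" by (rule add)
  show "tor_loop (0 :: 'g) r = 0" by (rule zero)
  show "tor_loop (\<Sum>i\<in>X. f i) r = (\<Sum>i\<in>X. tor_loop (f i) r)"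
    by (induction X rule: infinite_finite_induct) (simp_all add: zero add)
qed

end

section \<open>Weight vectors in a module of rank one\<close>

text \<open>
  The module of the theorem, after its underlying space has been identified with \<open>\<complex>[H, d]\<close>.
\<close>
locale normalized_module =
  fixes sg :: "complex \<Rightarrow> 'g::ab_group_add \<Rightarrow> 'g"
    and br :: "'g \<Rightarrow> 'g \<Rightarrow> 'g"
    and h :: "'g set"
    and x y hc H :: "'l::finite \<Rightarrow> 'g"
    and c1 c2 :: complex
    and \<rho> :: "('g, 'n::finite) toroidal \<Rightarrow> ('l + 'n) cpoly \<Rightarrow> ('l + 'n) cpoly"
  assumes lie: "lie_algebra sg br" and fd: "finite_dim sg"
    and cartan: "cartan_subalgebra sg br h"
    and chevalley: "chevalley_generators sg br h x y hc"
    and dual: "dual_cartan_basis sg br h x y H"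
    and abelian: "\<And>z w. z \<in> h \<Longrightarrow> w \<in> h \<Longrightarrow> br z w = 0"
    and lie_mod: "lie_module (tor_scale sg) (tor_bracket sg br c1 c2) cscale \<rho>"
    and rho_basis: "\<And>v p. \<rho> (htilde_basis H v) p = pvar v * p"
begin

sublocale V: vector_space sg by (rule lie_algebra_vector_space [OF lie])

lemma rho_linear [simp]:
  "\<rho> X (p + q) = \<rho> X p + \<rho> X q" "\<rho> X (cscale c p) = cscale c (\<rho> X p)" "\<rho> X 0 = 0"
  "\<rho> X (p - q) = \<rho> X p - \<rho> X q"
  "\<rho> (X + Y) p = \<rho> X p + \<rho> Y p" "\<rho> (tor_scale sg c X) p = cscale c (\<rho> X p)" "\<rho> 0 p = 0"
  "\<rho> (sum f A) p = (\<Sum>a\<in>A. \<rho> (f a) p)"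
proof -
  interpret L: Vector_Spaces.linear cscale cscale "\<rho> X" for X
    using lie_mod unfolding lie_module_def by blast
  interpret R: Vector_Spaces.linear "tor_scale sg" cscale "\<lambda>X. \<rho> X p" for p
    using lie_mod unfolding lie_module_def by blast
  show "\<rho> X (p + q) = \<rho> X p + \<rho> X q" "\<rho> X (cscale c p) = cscale c (\<rho> X p)" "\<rho> X 0 = 0"
    "\<rho> X (p - q) = \<rho> X p - \<rho> X q"
    by (rule L.add L.scale L.zero L.diff)+
  show "\<rho> (X + Y) p = \<rho> X p + \<rho> Y p" "\<rho> (tor_scale sg c X) p = cscale c (\<rho> X p)" "\<rho> 0 p = 0"
    "\<rho> (sum f A) p = (\<Sum>a\<in>A. \<rho> (f a) p)"
    by (rule R.add R.scale R.zero R.sum)+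
qed

lemma rho_bracket:
  "\<rho> (tor_bracket sg br c1 c2 X Y) p = \<rho> X (\<rho> Y p) - \<rho> Y (\<rho> X p)"
  using lie_mod unfolding lie_module_def by blast

text \<open>
  Both sides commute with multiplication by a variable \<open>X\<^sub>v\<close> up to the constant \<open>w v\<close>, and they
  agree at \<open>1\<close>.
\<close>
lemma rho_weight_vector:
  assumes "\<And>v. tor_bracket sg br c1 c2 (htilde_basis H v) X = tor_scale sg (w v) X"
  shows "\<rho> X g = shift w g * \<rho> X 1"
proof (induction g rule: cpoly_induct)
  case (const c)
  have "\<rho> X (pconst c) = cscale c (\<rho> X 1)"
    using rho_linear(2) [of X c 1] by (simp add: cscale_pconst)
  then show ?case by (simp add: shift_pconst cscale_pconst)
next
  case (mult v p)
  have "\<rho> X (pvar v * p) = pvar v * \<rho> X p - \<rho> (tor_bracket sg br c1 c2 (htilde_basis H v) X) p"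
    unfolding rho_bracket by (simp add: rho_basis)
  also have "\<dots> = (pvar v - pconst (w v)) * \<rho> X p"
    by (simp add: assms cscale_pconst left_diff_distrib)
  finally show ?case by (simp add: mult shift_mult shift_pvar mult.assoc)
next
  case (add p q)
  then show ?case by (simp add: shift_add distrib_right)
qed

lemma rho_loop_weight_vector:
  assumes "\<And>i. br (H i) z = sg (\<beta> i) z"
  shows "\<rho> (tor_loop z r) g
      = shift (\<lambda>v. case v of Inl i \<Rightarrow> \<beta> i | Inr j \<Rightarrow> of_int (r $ j)) g * \<rho> (tor_loop z r) 1"
  by (rule rho_weight_vector)
     (auto simp: htilde_basis_def tor_bracket_degree_zero [OF lie] assms tor_scale_simps [OF lie]
       split: sum.split)

lemma rho_d: "\<rho> (tor_d r j) g = tau r g * \<rho> (tor_d r j) 1"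
  unfolding tau_eq_shift
  by (rule rho_weight_vector)
     (auto simp: htilde_basis_def tor_bracket_degree_zero [OF lie] tor_scale_simps [OF lie]
       degree_shift_def zero_prod_def axis_def Finite_Cartesian_Product.vec_eq_iff cscale_pconst
       split: sum.split intro!: poly_mapping_eqI)

lemma H_in_h: "H a \<in> h"
  using dual V.span_base by (auto simp: dual_cartan_basis_def basis_family_def)

lemma rho_H: "\<rho> (tor_loop (H a) r) g = tau r g * \<rho> (tor_loop (H a) r) 1"
  unfolding tau_def by (rule rho_loop_weight_vector) (use abelian H_in_h in simp)

section \<open>The loop algebra of the Cartan subalgebra\<close>

lemma d_H_relation:
  "tau r (\<rho> (tor_loop (H a) s) 1) * \<rho> (tor_d r j) 1 - tau s (\<rho> (tor_d r j) 1) * \<rho> (tor_loop (H a) s) 1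
    = cscale (of_int (s $ j)) (\<rho> (tor_loop (H a) (r + s)) 1)"
proof -
  have "\<rho> (tor_bracket sg br c1 c2 (tor_d r j) (tor_loop (H a) s)) 1
      = cscale (of_int (s $ j)) (\<rho> (tor_loop (H a) (r + s)) 1)"
    by (simp add: tor_bracket_d_loop [OF V.vector_space_axioms] flip: rho_linear(6))
       (simp add: tor_scale_simps [OF lie], simp add: tor_loop_def)
  then show ?thesis
    by (simp add: rho_bracket rho_d [of r j "\<rho> _ 1"] rho_H [of a s "\<rho> _ 1"])
qed

text \<open>
  Both identities hold on every line in direction \<open>r\<close> on which \<open>H\<^sub>a\<close> does not vanish, by
  \<open>line_structure_constants\<close>, and these lines suffice by \<open>cpoly_cancel\<close>.
\<close>
lemma H_squares:
  "\<rho> (tor_loop (H a) r) 1 * \<rho> (tor_loop (H a) (- r)) 1 = (pvar (Inl a))\<^sup>2"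
  "(\<rho> (tor_loop (H a) r) 1)\<^sup>2 = pvar (Inl a) * \<rho> (tor_loop (H a) (2 *s r)) 1"
proof -
  define f where "f k = \<rho> (tor_loop (H a) (k *s r)) 1" for k
  have f0: "\<rho> (tor_loop (H a) 0) 1 = pvar (Inl a)"
    using rho_basis [of "Inl a" 1] by (simp add: htilde_basis_def)
  have "peval v (f 1 * f (- 1)) = peval v ((pvar (Inl a))\<^sup>2) \<and>
      peval v ((f 1)\<^sup>2) = peval v (pvar (Inl a) * f 2)"
    if va: "peval v (pvar (Inl a)) \<noteq> 0" for v
  proof (cases "r = 0")
    case True
    then show ?thesis using f0 by (simp add: f_def power2_eq_square)
  next
    case False
    then obtain i where i: "r $ i \<noteq> 0" by (auto simp: Finite_Cartesian_Product.vec_eq_iff)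
    define line where "line t = (\<lambda>k. v k + t * degree_shift r k)" for t
    have "\<forall>k. \<exists>P. \<forall>t. poly P t = peval (line t) (f k)"
      unfolding line_def using peval_on_line by blast
    then obtain F where F: "\<And>k t. poly (F k) t = peval (line t) (f k)" by metis
    have "\<forall>k. \<exists>P. \<forall>t. poly P t = peval (line t) (\<rho> (tor_d (k *s r) i) 1)"
      unfolding line_def using peval_on_line by blast
    then obtain Q where Q: "\<And>k t. poly (Q k) t = peval (line t) (\<rho> (tor_d (k *s r) i) 1)" by metis
    have shift: "peval (line t) (tau (k *s r) p) = peval (line (t - of_int k)) p" for t k p
      by (simp add: tau_eq_shift line_def algebra_simps)
    have F0: "F 0 = [:v (Inl a):]"
      by (simp add: poly_eq_poly_eq_iff [symmetric] fun_eq_iff F f_def f0 line_def)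
    have rel: "poly (Q j) t * poly (F k) (t - of_int j) - poly (F k) t * poly (Q j) (t - of_int k)
        = of_int k * of_int (r $ i) * poly (F (j + k)) t" for j k t
      using arg_cong [OF d_H_relation [of "j *s r" a "k *s r" i], of "peval (line t)"]
      by (simp add: shift F Q f_def vector_sadd_rdistrib mult.commute)
    obtain \<phi> where \<phi>: "\<And>k. F k = [:\<phi> k:]"
      "\<phi> 1 * \<phi> (- 1) = (v (Inl a))\<^sup>2" "(\<phi> 1)\<^sup>2 = v (Inl a) * \<phi> 2"
      using line_structure_constants [OF _ _ F0 rel] va i by auto
    have "peval v (f k) = \<phi> k" for k
      using F [of k 0] by (simp add: \<phi>(1) line_def)
    then show ?thesis by (simp add: \<phi> power2_eq_square flip: power2_eq_square)
  qed
  then have "f 1 * f (- 1) = (pvar (Inl a))\<^sup>2" "(f 1)\<^sup>2 = pvar (Inl a) * f 2"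
    using cpoly_cancel [of "pvar (Inl a) :: ('l + 'n) cpoly"] pvar_nonzero by blast+
  moreover have minus: "(- 1) *s r = - r" by (simp add: Finite_Cartesian_Product.vec_eq_iff)
  moreover have "f 1 = \<rho> (tor_loop (H a) r) 1" "f (- 1) = \<rho> (tor_loop (H a) (- r)) 1"
    using minus by (simp_all add: f_def)
  ultimately show "\<rho> (tor_loop (H a) r) 1 * \<rho> (tor_loop (H a) (- r)) 1 = (pvar (Inl a))\<^sup>2"
    "(\<rho> (tor_loop (H a) r) 1)\<^sup>2 = pvar (Inl a) * \<rho> (tor_loop (H a) (2 *s r)) 1"
    by (simp_all add: f_def)
qed

text \<open>
  By the second identity \<open>H\<^sub>a\<close> divides \<open>f\<^sub>r\<close> for every \<open>r\<close>; by the first one the quotients of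
  \<open>f\<^sub>r\<close> and \<open>f\<^sub>-\<^sub>r\<close> are inverse to each other, hence constant.
\<close>
lemma H_action_scalar:
  obtains c where "c \<noteq> 0" "\<rho> (tor_loop (H a) r) 1 = cscale c (pvar (Inl a))"
proof -
  have dvd: "\<exists>g. \<rho> (tor_loop (H a) r) 1 = pvar (Inl a) * g" for r
  proof (rule pvar_dvd)
    fix v :: "'l + 'n \<Rightarrow> complex"
    assume "v (Inl a) = 0"
    then show "peval v (\<rho> (tor_loop (H a) r) 1) = 0"
      using arg_cong [OF H_squares(2) [of a r], of "peval v"] by (simp add: power2_eq_square)
  qed
  obtain g where g: "\<rho> (tor_loop (H a) r) 1 = pvar (Inl a) * g" using dvd by blast
  obtain g' where g': "\<rho> (tor_loop (H a) (- r)) 1 = pvar (Inl a) * g'" using dvd by blast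
  have "g * g' = 1"
  proof (rule cpoly_cancel [OF pvar_nonzero [of "Inl a"]])
    fix v :: "'l + 'n \<Rightarrow> complex"
    assume "peval v (pvar (Inl a)) \<noteq> 0"
    then show "peval v (g * g') = peval v 1"
      using arg_cong [OF H_squares(1) [of a r], of "peval v"]
      by (simp add: g g' power2_eq_square)
  qed
  then obtain c where "c \<noteq> 0" "g = pconst c" by (rule cpoly_unit_imp_constant)
  then show ?thesis using that g by (simp add: cscale_pconst mult.commute)
qed


definition H_scalar :: "'l \<Rightarrow> int ^ 'n \<Rightarrow> complex" where
  "H_scalar a r = peval (\<lambda>_. 1) (\<rho> (tor_loop (H a) r) 1)"

lemma H_scalar:
  "\<rho> (tor_loop (H a) r) 1 = cscale (H_scalar a r) (pvar (Inl a))" "H_scalar a r \<noteq> 0"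
proof -
  obtain c where "c \<noteq> 0" "\<rho> (tor_loop (H a) r) 1 = cscale c (pvar (Inl a))"
    by (rule H_action_scalar)
  then show "\<rho> (tor_loop (H a) r) 1 = cscale (H_scalar a r) (pvar (Inl a))" "H_scalar a r \<noteq> 0"
    by (simp_all add: H_scalar_def)
qed

lemma H_scalar_zero: "H_scalar a 0 = 1"
  using rho_basis [of "Inl a" 1] by (simp add: htilde_basis_def H_scalar_def)

lemma d_difference:
  "\<rho> (tor_d r j) 1 - tau s (\<rho> (tor_d r j) 1)
    = pconst (of_int (s $ j) * H_scalar a (r + s) / H_scalar a s)"
proof (rule cpoly_cancel [OF pvar_nonzero [of "Inl a"]])
  fix v :: "'l + 'n \<Rightarrow> complex"
  let ?q = "\<rho> (tor_d r j) 1"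
  assume "peval v (pvar (Inl a)) \<noteq> 0"
  moreover have "v (Inl a) * (H_scalar a s * (peval v ?q - peval v (tau s ?q)))
      = v (Inl a) * (of_int (s $ j) * H_scalar a (r + s))"
    using arg_cong [OF d_H_relation [of r a s j], of "peval v"]
    by (simp add: H_scalar(1) algebra_simps)
  ultimately have "H_scalar a s * (peval v ?q - peval v (tau s ?q)) = of_int (s $ j) * H_scalar a (r + s)"
    by simp
  then show "peval v (?q - tau s ?q) = peval v (pconst (of_int (s $ j) * H_scalar a (r + s) / H_scalar a s))"
    using H_scalar(2) [of a s] by (simp add: field_simps)
qed

text \<open>
  By \<open>d_difference\<close> the difference is a constant \<open>\<delta> j s\<close>, which vanishes when \<open>s\<^sub>j = 0\<close>. It is
  additive in \<open>s\<close>, as a difference of translates, so it is a multiple of \<open>s\<^sub>j\<close>. The factor is the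
  same for any two coordinates that are nonzero in a common vector \<open>s\<close>.
\<close>
lemma d_difference_linear:
  obtains c where "\<And>j s. \<rho> (tor_d r j) 1 - tau s (\<rho> (tor_d r j) 1) = pconst (of_int (s $ j) * c)"
proof -
  define \<delta> where "\<delta> j s = of_int (s $ j) * H_scalar undefined (r + s) / H_scalar undefined s" for j s
  have \<delta>: "\<rho> (tor_d r j) 1 - tau s (\<rho> (tor_d r j) 1) = pconst (\<delta> j s)" for j s
    unfolding \<delta>_def by (rule d_difference)
  have add: "\<delta> j (s + s') = \<delta> j s + \<delta> j s'" for j s s'
  proof -
    let ?q = "\<rho> (tor_d r j) 1"
    have "pconst (\<delta> j (s + s')) = (?q - tau s ?q) + tau s (?q - tau s' ?q)"
      by (simp add: tau_tau flip: \<delta>)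
    also have "\<dots> = pconst (\<delta> j s + \<delta> j s')"
      unfolding \<delta> by (simp add: pconst_add)
    finally show ?thesis by (simp only: pconst_inj)
  qed
  have zero: "\<delta> j s = 0" if "s $ j = 0" for j s
    using that by (simp add: \<delta>_def)
  define c where "c j = \<delta> j (axis j 1)" for j
  have axis_add: "axis j (k + l) = axis j k + (axis j l :: int ^ 'n)" for j k l
    by (simp add: axis_def Finite_Cartesian_Product.vec_eq_iff)
  have ax: "\<delta> j (axis j k) = of_int k * c j" for j k
  proof (induction k rule: int_induct [where k = 0])
    case base
    show ?case by (simp add: zero axis_def)
  next
    case (step1 k)
    then show ?case by (simp add: axis_add add c_def algebra_simps)
  next
    case (step2 k)
    have "\<delta> j (axis j k) = \<delta> j (axis j (k - 1)) + \<delta> j (axis j 1)"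
      using axis_add [of j "k - 1" 1] add by simp
    then show ?case using step2 by (simp add: c_def algebra_simps)
  qed
  have lin: "\<delta> j s = of_int (s $ j) * c j" for j s
  proof -
    have "\<delta> j s = \<delta> j (axis j (s $ j)) + \<delta> j (s - axis j (s $ j))"
      by (simp flip: add)
    then show ?thesis by (simp add: ax zero)
  qed
  have "c i = c j" for i j
  proof (cases "i = j")
    case False
    define s :: "int ^ 'n" where "s = axis i 1 + axis j 1"
    have "s $ i = 1" "s $ j = 1" using False by (auto simp: s_def axis_def)
    then show ?thesis using lin [of i s] lin [of j s] by (simp add: \<delta>_def)
  qed simp
  then have "\<delta> j s = of_int (s $ j) * c undefined" for j s using lin by metis
  then show ?thesis using that \<delta> by metis
qed

text \<open>
  The index \<open>undefined\<close> is an arbitrary choice: \<open>rho_H_eq\<close> shows that every index gives the same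
  function.
\<close>
definition character :: "int ^ 'n \<Rightarrow> complex" where
  "character = H_scalar undefined"

lemma H_scalar_quotient:
  obtains c where "\<And>a s. s \<noteq> 0 \<Longrightarrow> H_scalar a (r + s) = c * H_scalar a s"
    "\<And>j s. \<rho> (tor_d r j) 1 - tau s (\<rho> (tor_d r j) 1) = pconst (of_int (s $ j) * c)"
proof -
  obtain c where c: "\<And>j s. \<rho> (tor_d r j) 1 - tau s (\<rho> (tor_d r j) 1) = pconst (of_int (s $ j) * c)"
    using d_difference_linear by blast
  have "H_scalar a (r + s) = c * H_scalar a s" if s: "s \<noteq> 0" for a s
  proof -
    obtain j where j: "s $ j \<noteq> 0" using s by (auto simp: Finite_Cartesian_Product.vec_eq_iff)
    have "of_int (s $ j) * H_scalar a (r + s) / H_scalar a s = of_int (s $ j) * c"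
      using d_difference [of r j s a] c [of j s] pconst_inj by metis
    then show ?thesis using j H_scalar(2) [of a s] by (simp add: field_simps)
  qed
  then show ?thesis using that c by blast
qed

text \<open>
  The quotients \<open>\<lambda>\<^sub>a(r + s) / \<lambda>\<^sub>a(s)\<close> of the scalars by which \<open>H\<^sub>a(r + s)\<close> and \<open>H\<^sub>a(s)\<close> act are
  differences of the polynomial of \<open>t\<^sup>r d\<^sub>j\<close>. They therefore depend neither on \<open>a\<close> nor on
  \<open>s \<noteq> 0\<close>.
\<close>
lemma character_nonzero: "character r \<noteq> 0"
  and character_zero: "character 0 = 1"
  and character_add: "character (r + s) = character r * character s"
  and rho_H_eq: "\<rho> (tor_loop (H a) r) 1 = cscale (character r) (pvar (Inl a))"
  and tau_d: "tau s (\<rho> (tor_d r j) 1) = \<rho> (tor_d r j) 1 - pconst (of_int (s $ j) * character r)"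
proof -
  have "\<exists>c. (\<forall>a s. s \<noteq> 0 \<longrightarrow> H_scalar a (r + s) = c * H_scalar a s) \<and>
      (\<forall>j s. \<rho> (tor_d r j) 1 - tau s (\<rho> (tor_d r j) 1) = pconst (of_int (s $ j) * c))" for r
    by (rule H_scalar_quotient [of r]) blast
  from choice [OF allI, OF this] obtain c where
    "\<forall>r. (\<forall>a s. s \<noteq> 0 \<longrightarrow> H_scalar a (r + s) = c r * H_scalar a s) \<and>
      (\<forall>j s. \<rho> (tor_d r j) 1 - tau s (\<rho> (tor_d r j) 1) = pconst (of_int (s $ j) * c r))" ..
  then have c: "\<And>r a s. s \<noteq> 0 \<Longrightarrow> H_scalar a (r + s) = c r * H_scalar a s"
    "\<And>r j s. \<rho> (tor_d r j) 1 - tau s (\<rho> (tor_d r j) 1) = pconst (of_int (s $ j) * c r)"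
    by blast+
  have torsion: "r = 0" if "r + r = 0" for r :: "int ^ 'n"
    using that by (simp add: Finite_Cartesian_Product.vec_eq_iff)
  have mult: "H_scalar a (r + s) = H_scalar a r * H_scalar a s" for a r s
    by (rule almost_multiplicative_imp_multiplicative [where f = "H_scalar a" and c = c])
       (use H_scalar(2) H_scalar_zero torsion c(1) in auto)
  have c_eq: "c r = H_scalar a r" for a r
  proof -
    have "axis undefined 1 \<noteq> (0 :: int ^ 'n)" by simp
    then show ?thesis using c(1) [of "axis undefined 1" a r] mult H_scalar(2) by simp
  qed
  show "character r \<noteq> 0" "character 0 = 1" "character (r + s) = character r * character s"
    by (simp_all add: character_def H_scalar(2) H_scalar_zero mult)
  show "\<rho> (tor_loop (H a) r) 1 = cscale (character r) (pvar (Inl a))"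
    using H_scalar(1) [of a r] c_eq by (simp add: character_def flip: c_eq)
  show "tau s (\<rho> (tor_d r j) 1) = \<rho> (tor_d r j) 1 - pconst (of_int (s $ j) * character r)"
    using c(2) [of r j s] by (simp add: character_def algebra_simps flip: c_eq)
qed

text \<open>
  By \<open>tau_d\<close> the polynomial \<open>\<Lambda>\<^sup>-\<^sup>r (t\<^sup>r d\<^sub>j.1)\<close> has the same differences as \<open>d\<^sub>j\<close>. Their
  difference is invariant under the \<open>\<tau>\<^sup>s\<close>, and in the end it is the constant \<open>- r\<^sub>j (a + 1)\<close>.
\<close>
definition d_error :: "'n \<Rightarrow> int ^ 'n \<Rightarrow> ('l + 'n) cpoly" where
  "d_error j r = cscale (1 / character r) (\<rho> (tor_d r j) 1) - pvar (Inr j)"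

lemma rho_d_eq: "\<rho> (tor_d r j) 1 = cscale (character r) (pvar (Inr j) + d_error j r)"
  using character_nonzero [of r] by (simp add: d_error_def)

lemma tau_d_error: "tau s (d_error j r) = d_error j r"
  using character_nonzero [of r]
  by (simp add: d_error_def tau_d) (simp add: cscale_pconst algebra_simps flip: pconst_mult)

section \<open>The centre acts by zero\<close>

lemma cartan_poly_action:
  assumes "z \<in> h"
  shows "\<rho> (tor_loop z r) g = cscale (character r) (cartan_poly sg H z * tau r g)"
proof -
  have inj: "inj H" and indep: "\<not> V.dependent (range H)" and span: "V.span (range H) = h"
    using dual by (auto simp: dual_cartan_basis_def basis_family_def)
  have "z = (\<Sum>b\<in>range H. sg (V.representation (range H) z b) b)"
    using V.sum_representation_eq [OF indep, of z "range H"] span assms by simp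
  then have z: "z = (\<Sum>i\<in>UNIV. sg (V.representation (range H) z (H i)) (H i))"
    using inj by (simp add: sum.reindex)
  have "\<rho> (tor_loop z r) g
      = (\<Sum>i\<in>UNIV. cscale (V.representation (range H) z (H i)) (\<rho> (tor_loop (H i) r) g))"
    by (subst z) (simp add: tor_loop_linear [OF lie] flip: tor_scale_simps [OF lie])
  also have "\<dots> = cscale (character r) (cartan_poly sg H z * tau r g)"
    unfolding rho_H [of _ r g] rho_H_eq cartan_poly_def
    by (simp add: cscale_pconst sum_distrib_left sum_distrib_right mult_ac)
  finally show ?thesis .
qed

text \<open>
  The Jacobi identity shows that \<open>[x\<^sub>i, y\<^sub>i]\<close> centralizes \<open>\<hh>\<close>, and \<open>\<hh>\<close> is its own normalizer.
\<close>
lemma hc_in_h: "hc i \<in> h" and hc_nonzero: "hc i \<noteq> 0"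
  and killing_hc: "killing sg br (hc i) (hc i) \<noteq> 0"
proof -
  obtain \<alpha> where sr: "simple_roots sg br h \<alpha>" and all: "\<forall>i. x i \<in> root_space sg br h (\<alpha> i) \<and>
      y i \<in> root_space sg br h (\<lambda>z. - \<alpha> i z) \<and> hc i = br (x i) (y i) \<and> \<alpha> i (hc i) = 2"
    using chevalley unfolding chevalley_generators_def by blast
  from sr have "\<forall>i. is_root sg br h (\<alpha> i)"
    unfolding simple_roots_def by (rule conjunct1)
  then have "linear_form_on sg h (\<alpha> i)" by (simp add: is_root_def)
  moreover note all [THEN spec, of i]
  ultimately have \<alpha>: "linear_form_on sg h (\<alpha> i)" "x i \<in> root_space sg br h (\<alpha> i)"
    "y i \<in> root_space sg br h (\<lambda>z. - \<alpha> i z)" "hc i = br (x i) (y i)" "\<alpha> i (hc i) = 2"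
    by blast+
  interpret L: Vector_Spaces.linear sg sg "br u" for u
    using lie unfolding lie_algebra_def by blast
  interpret R: Vector_Spaces.linear sg sg "\<lambda>u. br u v" for v
    using lie unfolding lie_algebra_def by blast
  have "br (hc i) z = 0" if z: "z \<in> h" for z
  proof -
    have "br z (hc i) = br (br z (x i)) (y i) + br (x i) (br z (y i))"
      unfolding \<alpha>(4) by (rule lie_algebra_derivation [OF lie])
    also have "\<dots> = 0"
      using \<alpha>(2,3) z by (simp add: root_space_def R.scale L.scale L.neg)
    finally show ?thesis using lie_algebra_skew [OF lie, of "hc i" z] by simp
  qed
  moreover have "0 \<in> h" and self: "{x. \<forall>z\<in>h. br x z \<in> h} = h"
    using cartan V.subspace_0 by (auto simp: cartan_subalgebra_def lie_subalgebra_def)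
  ultimately show mem: "hc i \<in> h" by auto
  have "\<alpha> i 0 = 0"
    using \<alpha>(1) \<open>0 \<in> h\<close> unfolding linear_form_on_def by (metis V.scale_zero_left mult_zero_left)
  then show nz: "hc i \<noteq> 0" using \<alpha>(5) by auto
  then have xnz: "x i \<noteq> 0" using \<alpha>(4) by (auto simp: R.zero)
  show "killing sg br (hc i) (hc i) \<noteq> 0"
  proof (rule killing_sl2_nonzero [OF lie fd _ _ \<alpha>(4) [symmetric] xnz])
    show "br (hc i) (x i) = sg 2 (x i)" "br (hc i) (y i) = - sg 2 (y i)"
      using \<alpha>(2,3,5) mem by (simp_all add: root_space_def)
  qed
qed

text \<open>
  The elements \<open>h(e\<^sub>j)\<close> and \<open>h(m - e\<^sub>j)\<close> commute in the module, and their bracket in \<open>\<L>\<close> is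
  \<open>(h, h) t\<^sup>m K\<^sub>j\<close>.
\<close>
lemma rho_K: "\<rho> (tor_K m j) g = 0"
proof -
  let ?z = "hc undefined" and ?r = "axis j 1 :: int ^ 'n"
  let ?c = "killing sg br ?z ?z"
  have tau_c: "tau r (cartan_poly sg H ?z :: ('l + 'n) cpoly) = cartan_poly sg H ?z" for r
  proof -
    have sum: "tau r (\<Sum>i\<in>X. p i) = (\<Sum>i\<in>X. tau r (p i))" for X :: "'l set" and p
      by (induction X rule: infinite_finite_induct) simp_all
    show ?thesis by (simp add: cartan_poly_def sum)
  qed
  have "tor_bracket sg br c1 c2 (tor_loop ?z ?r) (tor_loop ?z (m - ?r)) = tor_scale sg ?c (tor_K m j)"
  proof -
    have br0: "br ?z ?z = 0" using abelian hc_in_h by blast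
    have "abs_kah (\<chi> i. cscale (?c * of_int (?r $ i)) (tpow m)) = kah_scale ?c (abs_kah (axis j (tpow m)))"
      unfolding kah_scale.abs_eq
      by (rule arg_cong [of _ _ abs_kah])
         (auto simp: vscale_def axis_def Finite_Cartesian_Product.vec_eq_iff)
    then show ?thesis
      by (simp add: tor_bracket_loop_loop [OF lie] br0 tor_K_def tor_scale_simps [OF lie])
  qed
  then have "cscale ?c (\<rho> (tor_K m j) g)
      = \<rho> (tor_loop ?z ?r) (\<rho> (tor_loop ?z (m - ?r)) g) - \<rho> (tor_loop ?z (m - ?r)) (\<rho> (tor_loop ?z ?r) g)"
    using rho_bracket by (metis rho_linear(6))
  also have "\<dots> = 0"
    by (simp add: cartan_poly_action hc_in_h tau_tau tau_c mult_cscale mult_ac add.commute)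
  finally have "pconst ?c * \<rho> (tor_K m j) g = 0" by (simp add: cscale_pconst)
  moreover have "pconst ?c \<noteq> (0 :: ('l + 'n) cpoly)"
    using killing_hc pconst_inj [of ?c 0] by (simp add: pconst_0)
  ultimately show ?thesis using cpoly_no_zero_divisors by blast
qed

lemma rho_centre: "\<rho> (0, k, 0) g = 0"
proof -
  have axis: "\<rho> (0, abs_kah (axis j p), 0) g = 0" for j and p :: "'n laurent"
  proof (induction p rule: pm_induct)
    case (single m c)
    have "(0, abs_kah (axis j (Poly_Mapping.single m c)), 0) = tor_scale sg c (tor_K m j)"
      by (simp add: tor_K_def tor_scale_simps [OF lie] kah_scale.abs_eq)
         (rule arg_cong [of _ _ abs_kah],
          auto simp: vscale_def axis_def Finite_Cartesian_Product.vec_eq_iff single_eq_cscale)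
    then show ?case by (simp add: rho_K)
  next
    case (add p q)
    have "axis j (p + q) = axis j p + axis j q"
      by (simp add: axis_def Finite_Cartesian_Product.vec_eq_iff)
    then have "\<rho> (0, abs_kah (axis j (p + q)), 0) g
        = \<rho> ((0, abs_kah (axis j p), 0) + (0, abs_kah (axis j q), 0)) g"
      by (simp add: abs_kah_add)
    then show ?case using add by (simp only: rho_linear add_0_left)
  qed
  have sum: "\<rho> (0, abs_kah (\<Sum>j\<in>X. axis j (w $ j)), 0) g = 0" for X :: "'n set" and w
  proof (induction X rule: infinite_finite_induct)
    case (insert a X)
    have "(0, abs_kah (\<Sum>j\<in>insert a X. axis j (w $ j)), 0)
        = (0, abs_kah (axis a (w $ a)), 0) + ((0, abs_kah (\<Sum>j\<in>X. axis j (w $ j)), 0) :: ('g, 'n) toroidal)"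
      using insert by (simp add: abs_kah_add)
    then show ?case using insert axis by (simp only: rho_linear) simp
  qed (simp_all flip: zero_prod_def)
  have k: "k = abs_kah (rep_kah k)"
    by (rule Quotient3_abs_rep [OF Quotient3_kah, symmetric])
  have "rep_kah k = (\<Sum>j\<in>UNIV. axis j (rep_kah k $ j))"
    by (simp add: Finite_Cartesian_Product.vec_eq_iff axis_def if_distrib cong: if_cong)
  then show ?thesis using sum k by metis
qed

section \<open>Derivations and loops of Chevalley generators\<close>

text \<open>
  At each point the brackets \<open>[t\<^sup>r d\<^sub>i, t\<^sup>s d\<^sub>j]\<close> impose the relation of
  \<open>witt_relation_imp_linear\<close>: the cocycle takes values in \<open>\<K>\<^sub>A\<close>, which acts by zero, and the
  character cancels.
\<close>
lemma d_error_linear: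
  obtains c where "\<And>j r. d_error j r = cscale (of_int (r $ j)) c"
proof -
  have zero: "d_error j 0 = 0" for j
    using rho_basis [of "Inr j" 1] by (simp add: d_error_def character_zero htilde_basis_def)
  have rel: "of_int (s $ i) * peval v (d_error j s) - of_int (r $ j) * peval v (d_error i r)
      = of_int (s $ i) * peval v (d_error j (r + s)) - of_int (r $ j) * peval v (d_error i (r + s))"
    for i j r s and v :: "'l + 'n \<Rightarrow> complex"
  proof -
    obtain k where k: "tor_bracket sg br c1 c2 (tor_d r i) (tor_d s j) = (0, k, 0)
      + (tor_scale sg (of_int (s $ i)) (tor_d (r + s) j)
      + tor_scale sg (- of_int (r $ j)) (tor_d (r + s) i :: ('g, 'n) toroidal))"
      using tor_bracket_d_d_modulo_centre [OF lie] by blast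
    have "\<rho> (tor_d r i) (\<rho> (tor_d s j) 1) - \<rho> (tor_d s j) (\<rho> (tor_d r i) 1)
        = cscale (of_int (s $ i)) (\<rho> (tor_d (r + s) j) 1)
          + cscale (- of_int (r $ j)) (\<rho> (tor_d (r + s) i) 1)"
      unfolding rho_bracket [symmetric] k by (simp add: rho_centre)
    then have "tau r (\<rho> (tor_d s j) 1) * \<rho> (tor_d r i) 1 - tau s (\<rho> (tor_d r i) 1) * \<rho> (tor_d s j) 1
        = cscale (of_int (s $ i)) (\<rho> (tor_d (r + s) j) 1)
          + cscale (- of_int (r $ j)) (\<rho> (tor_d (r + s) i) 1)"
      by (simp only: rho_d [of _ _ "\<rho> _ 1"])
    from arg_cong [OF this, of "peval v"]
    have "character (r + s) * (of_int (s $ i) * peval v (d_error j s) - of_int (r $ j) * peval v (d_error i r))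
      = character (r + s) * (of_int (s $ i) * peval v (d_error j (r + s)) - of_int (r $ j) * peval v (d_error i (r + s)))"
      by (simp add: rho_d_eq tau_d_error character_add algebra_simps)
    then show ?thesis using character_nonzero by simp
  qed
  define c where "c = d_error undefined (axis undefined 1)"
  have "peval v (d_error j r) = of_int (r $ j) * peval v c" for v j r
  proof -
    obtain c' where c': "\<And>j r. peval v (d_error j r) = c' * of_int (r $ j)"
      using witt_relation_imp_linear [of "\<lambda>j r. peval v (d_error j r)", OF _ rel] zero by auto
    then show ?thesis by (simp add: c_def)
  qed
  then have "d_error j r = cscale (of_int (r $ j)) c" for j r
    by (intro peval_eqI) simp
  then show ?thesis by (rule that)
qed


text \<open>
  The cases \<open>z = x\<^sub>a\<close>, \<open>\<epsilon> = 1\<close> and \<open>z = y\<^sub>a\<close>, \<open>\<epsilon> = - 1\<close> are alike. The bracket with \<open>H\<^sub>a(s)\<close>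
  expresses \<open>p\<^sub>s = z(s).1\<close> through \<open>p\<^sub>0\<close>; using it twice, for \<open>p\<^sub>r\<^sub>+\<^sub>s\<close>, forces the second
  differences of \<open>p\<^sub>0\<close> in the \<open>d\<close>-directions to vanish. So \<open>l\<^sub>r = p\<^sub>0 - \<tau>\<^sup>r p\<^sub>0\<close> is additive in
  \<open>r\<close>. The bracket of \<open>t\<^sup>r d\<^sub>j\<close> with \<open>z(0)\<close> gives \<open>r\<^sub>j (c - c') p\<^sub>0 = l\<^sub>r (d\<^sub>j + r\<^sub>j c)\<close>, where
  \<open>c'\<close> is the translate of \<open>c\<close>. In this equation \<open>r\<close> and \<open>2 r\<close> together yield \<open>l\<^sub>r c = 0\<close>. If
  \<open>c = 0\<close> then \<open>c' = 0\<close> and the equation reads \<open>l\<^sub>r d\<^sub>j = 0\<close>; in any case \<open>l\<^sub>r = 0\<close>, and then the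
  equation says \<open>(c - c') p\<^sub>0 = 0\<close>.
\<close>
lemma weight_one_loop_vector:
  assumes z: "\<And>b. br (H b) z = sg (if b = a then \<epsilon> else 0) z" and \<epsilon>: "\<epsilon> * \<epsilon> = 1"
    and c: "\<And>j r. d_error j r = cscale (of_int (r $ j)) c"
  shows "\<rho> (tor_loop z r) g
      = cscale (character r) (shift (root_shift a \<epsilon>) (tau r g) * \<rho> (tor_loop z 0) 1)" (is ?action)
    and "tau r (\<rho> (tor_loop z 0) 1) = \<rho> (tor_loop z 0) 1" (is ?invariant)
    and "\<rho> (tor_loop z 0) 1 \<noteq> 0 \<Longrightarrow> shift (root_shift a \<epsilon>) c = c"
proof -
  define p where "p r = \<rho> (tor_loop z r) 1" for r
  define S :: "('l + 'n) cpoly \<Rightarrow> ('l + 'n) cpoly" where "S = shift (root_shift a \<epsilon>)"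
  have S_simps: "S (f * g) = S f * S g" "S (f + g) = S f + S g" "S (pconst d) = pconst d"
    "S (cscale d f) = cscale d (S f)" for f g d
    by (simp_all add: S_def shift_mult shift_add shift_pconst shift_cscale)
  have S_pvar: "S (pvar (Inl a)) = pvar (Inl a) - pconst \<epsilon>" "S (pvar (Inr j)) = pvar (Inr j)" for j
    by (simp_all add: S_def shift_pvar root_shift_def pconst_0)
  have act: "\<rho> (tor_loop z r) g = S (tau r g) * p r" for r g
  proof -
    have "(\<lambda>v. case v of Inl i \<Rightarrow> if i = a then \<epsilon> else 0 | Inr j \<Rightarrow> of_int (r $ j))
        = (\<lambda>v. root_shift a \<epsilon> v + degree_shift r v)"
      by (auto simp: root_shift_def fun_eq_iff split: sum.split)
    then show ?thesis
      unfolding S_def tau_eq_shift shift_shift p_def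
      using rho_loop_weight_vector [of z "\<lambda>i. if i = a then \<epsilon> else 0" r g, OF z] by simp
  qed
  have H_rel: "cscale (character s) (pvar (Inl a) * tau s (p r) - (pvar (Inl a) - pconst \<epsilon>) * p r)
      = cscale \<epsilon> (p (r + s))" for r s
  proof -
    have "tor_bracket sg br c1 c2 (tor_loop (H a) s) (tor_loop z r) =
        tor_scale sg \<epsilon> (tor_loop z (r + s))
        + (0, abs_kah (\<chi> i. cscale (killing sg br (H a) z * of_int (s $ i)) (tpow (s + r))), 0)"
      by (simp add: tor_bracket_loop_loop [OF lie] z tor_scale_simps [OF lie] add.commute)
         (simp add: tor_loop_def)
    then have "\<rho> (tor_bracket sg br c1 c2 (tor_loop (H a) s) (tor_loop z r)) 1 = cscale \<epsilon> (p (r + s))"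
      by (simp add: rho_centre p_def)
    moreover have "\<rho> (tor_loop (H a) s) (p r) = tau s (p r) * cscale (character s) (pvar (Inl a))"
      using rho_H [of a s "p r"] by (simp add: rho_H_eq)
    moreover have "\<rho> (tor_loop z r) (\<rho> (tor_loop (H a) s) 1)
        = cscale (character s) ((pvar (Inl a) - pconst \<epsilon>) * p r)"
      by (simp only: rho_H_eq act tau_simps tau_pvar S_simps S_pvar cscale_mult)
    ultimately show ?thesis
      unfolding rho_bracket p_def [symmetric]
      by (simp add: mult_cscale mult.commute)
  qed
  define P where "P s v = peval v (tau s (p 0))" for s v
  have P_shift: "P s (\<lambda>k. v k - degree_shift r k) = P (r + s) v" for r s v
    by (simp add: P_def tau_eq_shift algebra_simps)
  have p_eq: "peval v (p s) = \<epsilon> * character s * (v (Inl a) * P s v - (v (Inl a) - \<epsilon>) * P 0 v)" for v s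
  proof -
    have "\<epsilon> * peval v (p s) = character s * (v (Inl a) * P s v - (v (Inl a) - \<epsilon>) * P 0 v)"
      using arg_cong [OF H_rel [of s 0], of "peval v"] by (simp add: P_def right_diff_distrib)
    then have "\<epsilon> * (\<epsilon> * peval v (p s))
        = \<epsilon> * (character s * (v (Inl a) * P s v - (v (Inl a) - \<epsilon>) * P 0 v))" by simp
    then show ?thesis by (simp add: \<epsilon> mult.assoc flip: mult.assoc [of \<epsilon> \<epsilon>])
  qed
  have second: "P (r + s) v + P 0 v = P r v + P s v" for r s v
  proof -
    have "tau (r + s) (p 0) + p 0 = tau r (p 0) + tau s (p 0)"
    proof (rule cpoly_cancel [of "pvar (Inl a) * (pvar (Inl a) - pconst \<epsilon>)"])
      have "\<epsilon> \<noteq> 2" using \<epsilon> by auto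
      then have "peval (\<lambda>_. 2) (pvar (Inl a) * (pvar (Inl a) - pconst \<epsilon>) :: ('l + 'n) cpoly) \<noteq> 0"
        by simp
      then show "(pvar (Inl a) * (pvar (Inl a) - pconst \<epsilon>) :: ('l + 'n) cpoly) \<noteq> 0"
        by (metis peval_0)
    next
      fix v :: "'l + 'n \<Rightarrow> complex"
      define X where "X = v (Inl a)"
      assume "peval v (pvar (Inl a) * (pvar (Inl a) - pconst \<epsilon>)) \<noteq> 0"
      then have X: "X * (X - \<epsilon>) \<noteq> 0" by (simp add: X_def)
      have "character s * (X * peval v (tau s (p r)) - (X - \<epsilon>) * peval v (p r)) = \<epsilon> * peval v (p (r + s))"
        using arg_cong [OF H_rel [of s r], of "peval v"] by (simp add: X_def right_diff_distrib)
      moreover have "peval v (tau s (p r))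
          = \<epsilon> * character r * (X * P (r + s) v - (X - \<epsilon>) * P s v)"
        using p_eq [of "\<lambda>k. v k - degree_shift s k" r] P_shift [of r v s] P_shift [of 0 v s]
        by (simp add: tau_eq_shift X_def add.commute)
      moreover have "peval v (p r) = \<epsilon> * character r * (X * P r v - (X - \<epsilon>) * P 0 v)"
        using p_eq by (simp add: X_def)
      moreover have "peval v (p (r + s)) = \<epsilon> * (character s * character r) * (X * P (r + s) v - (X - \<epsilon>) * P 0 v)"
        using p_eq by (simp add: X_def character_add mult_ac)
      ultimately have "(character s * character r * \<epsilon>) *
            (X * (X * P (r + s) v - (X - \<epsilon>) * P s v) - (X - \<epsilon>) * (X * P r v - (X - \<epsilon>) * P 0 v))
          = (character s * character r * \<epsilon>) * (\<epsilon> * (X * P (r + s) v - (X - \<epsilon>) * P 0 v))"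
        by (simp add: algebra_simps)
      moreover have "character s * character r * \<epsilon> \<noteq> 0"
        using character_nonzero \<epsilon> by auto
      ultimately have "X * (X * P (r + s) v - (X - \<epsilon>) * P s v) - (X - \<epsilon>) * (X * P r v - (X - \<epsilon>) * P 0 v)
          = \<epsilon> * (X * P (r + s) v - (X - \<epsilon>) * P 0 v)"
        by (simp only: mult_cancel_left) blast
      then have "X * (X - \<epsilon>) * (P (r + s) v + P 0 v) = X * (X - \<epsilon>) * (P r v + P s v)"
        by (simp add: algebra_simps)
      then show "peval v (tau (r + s) (p 0) + p 0) = peval v (tau r (p 0) + tau s (p 0))"
        using X by (simp add: P_def)
    qed
    from arg_cong [OF this, of "peval v"] show ?thesis by (simp add: P_def)
  qed
  have d_rel: "(v (Inr j) + of_int (r $ j) * peval v c) * P r v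
      = P 0 v * (v (Inr j) + of_int (r $ j) * peval v (S c))" for v j r
  proof -
    have "tor_bracket sg br c1 c2 (tor_d r j) (tor_loop z 0) = 0"
      by (simp add: tor_bracket_d_loop [OF V.vector_space_axioms] zero_prod_def)
    then have "\<rho> (tor_d r j) (p 0) = \<rho> (tor_loop z 0) (\<rho> (tor_d r j) 1)"
      using rho_bracket [of "tor_d r j" "tor_loop z 0" 1] by (simp add: p_def)
    then have "tau r (p 0) * \<rho> (tor_d r j) 1 = S (\<rho> (tor_d r j) 1) * p 0"
      by (simp add: rho_d [of r j "p 0"] act)
    from arg_cong [OF this, of "peval v"]
    have "character r * ((v (Inr j) + of_int (r $ j) * peval v c) * P r v)
        = character r * (P 0 v * (v (Inr j) + of_int (r $ j) * peval v (S c)))"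
      by (simp add: rho_d_eq c S_simps S_pvar P_def algebra_simps
          del: mult_cancel_left mult_cancel_right)
    then show ?thesis using character_nonzero by simp
  qed
  have invariant: "tau r (p 0) = p 0" for r
  proof (cases "r = 0")
    case False
    then obtain j where j: "r $ j \<noteq> 0" by (auto simp: Finite_Cartesian_Product.vec_eq_iff)
    define \<rho>j where "\<rho>j = (of_int (r $ j) :: complex)"
    have nz: "\<rho>j \<noteq> 0" using j by (simp add: \<rho>j_def)
    define l where "l = p 0 - tau r (p 0)"
    have l: "peval v l = P 0 v - P r v" for v by (simp add: l_def P_def)
    \<comment> \<open>the bracket with \<open>t\<^sup>r d\<^sub>j\<close>, and then the one with \<open>t\<^sup>2\<^sup>r d\<^sub>j\<close>\<close>
    have 1: "\<rho>j * (peval v c - peval v (S c)) * P 0 v = peval v l * (v (Inr j) + \<rho>j * peval v c)" for v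
      using d_rel [of v j r] by (simp add: l \<rho>j_def algebra_simps)
    have 2: "2 * \<rho>j * (peval v c - peval v (S c)) * P 0 v
        = 2 * peval v l * (v (Inr j) + 2 * \<rho>j * peval v c)" for v
    proof -
      have PP: "P (r + r) v = P r v + P r v - P 0 v"
        by (simp only: second [of r r v, symmetric] add_diff_cancel_right')
      show ?thesis using d_rel [of v j "r + r", unfolded PP] by (simp add: l \<rho>j_def algebra_simps)
    qed
    have "peval v l * peval v c = 0" for v
    proof -
      have "2 * (peval v l * (v (Inr j) + \<rho>j * peval v c))
          = 2 * \<rho>j * (peval v c - peval v (S c)) * P 0 v"
        by (simp only: 1 [symmetric] mult.assoc)
      also note 2 [of v]
      finally have "2 * (peval v l * (v (Inr j) + \<rho>j * peval v c))
          = 2 * (peval v l * (v (Inr j) + 2 * \<rho>j * peval v c))" by (simp only: mult.assoc)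
      then have "peval v l * (v (Inr j) + \<rho>j * peval v c) = peval v l * (v (Inr j) + 2 * \<rho>j * peval v c)"
        by (metis mult_cancel_left zero_neq_numeral)
      then have "\<rho>j * (peval v l * peval v c) = 0" by (simp add: algebra_simps)
      then show ?thesis using nz by simp
    qed
    then have "l * c = 0" by (intro peval_eqI) simp
    then have "l = 0 \<or> c = 0" using cpoly_no_zero_divisors by blast
    moreover have "l = 0" if "c = 0"
    proof -
      have "S c = 0" using S_simps(3) [of 0] that by (simp add: pconst_0)
      then have "peval v (l * pvar (Inr j)) = 0" for v using 1 [of v] that by simp
      then have "l * pvar (Inr j) = 0" by (intro peval_eqI) simp
      then show ?thesis using cpoly_no_zero_divisors pvar_nonzero by blast
    qed
    ultimately show ?thesis by (auto simp: l_def)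
  qed simp
  then show ?invariant by (simp add: p_def)
  have p: "p r = cscale (character r) (p 0)" for r
  proof (rule peval_eqI)
    fix v :: "'l + 'n \<Rightarrow> complex"
    have "P s v = peval v (p 0)" for s by (simp add: P_def invariant)
    then have "peval v (p r) = (\<epsilon> * \<epsilon>) * (character r * peval v (p 0))"
      using p_eq [of v r] by (simp add: algebra_simps)
    then show "peval v (p r) = peval v (cscale (character r) (p 0))" by (simp add: \<epsilon>)
  qed
  have "\<rho> (tor_loop z r) g = S (tau r g) * cscale (character r) (p 0)"
    by (simp only: act p [of r])
  also have "\<dots> = cscale (character r) (S (tau r g) * p 0)" by (rule mult_cscale)
  finally show ?action by (simp only: S_def p_def)
  show "shift (root_shift a \<epsilon>) c = c" if "\<rho> (tor_loop z 0) 1 \<noteq> 0"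
  proof (rule cpoly_cancel [OF that])
    fix v :: "'l + 'n \<Rightarrow> complex"
    assume "peval v (\<rho> (tor_loop z 0) 1) \<noteq> 0"
    then have nz: "peval v (p 0) \<noteq> 0" by (simp add: p_def)
    let ?r = "axis undefined 1 :: int ^ 'n"
    have "P r v = peval v (p 0)" for r by (simp add: P_def invariant)
    then have "peval v c = peval v (S c)"
      using d_rel [of v undefined ?r] nz by (simp add: mult.commute)
    then show "peval v (shift (root_shift a \<epsilon>) c) = peval v c" by (simp add: S_def)
  qed
qed

lemma H_x: "br (H b) (x a) = sg (if b = a then 1 else 0) (x a)"
  and H_y: "br (H b) (y a) = sg (if b = a then - 1 else 0) (y a)"
  using dual by (auto simp: dual_cartan_basis_def)

text \<open>Otherwise \<open>[x\<^sub>a, y\<^sub>a]\<close> would act by zero, but it acts as multiplication by a nonzero linear form.\<close>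
lemma rho_x_nonzero: "\<rho> (tor_loop (x a) 0) 1 \<noteq> 0"
proof
  assume "\<rho> (tor_loop (x a) 0) 1 = 0"
  then have zero: "\<rho> (tor_loop (x a) 0) g = 0" for g
    using rho_loop_weight_vector [OF H_x, of a 0 g] by simp
  have "hc a = br (x a) (y a)" using chevalley by (auto simp: chevalley_generators_def)
  then have "tor_bracket sg br c1 c2 (tor_loop (x a) 0) (tor_loop (y a) 0) = tor_loop (hc a) (0 :: int ^ 'n)"
    by (simp add: tor_bracket_degree_zero [OF lie])
  then have "\<rho> (tor_loop (hc a) 0) 1 = 0"
    using rho_bracket [of "tor_loop (x a) 0" "tor_loop (y a) 0" 1] by (simp add: zero)
  then have "(cartan_poly sg H (hc a) :: ('l + 'n) cpoly) = 0"
    using cartan_poly_action [OF hc_in_h, of a 0 1] by (simp add: character_zero)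
  then have poly0: "peval v (cartan_poly sg H (hc a)) = 0" for v :: "'l + 'n \<Rightarrow> complex" by simp
  have coeff: "V.representation (range H) (hc a) (H i) = 0" for i
  proof -
    have "peval (\<lambda>v :: 'l + 'n. if v = Inl i then 1 else 0) (cartan_poly sg H (hc a))
        = (\<Sum>j\<in>UNIV. if j = i then V.representation (range H) (hc a) (H i) else 0)"
      unfolding cartan_poly_def peval_sum by (rule sum.cong) auto
    then show ?thesis using poly0 by simp
  qed
  have indep: "\<not> V.dependent (range H)" and span: "V.span (range H) = h"
    using dual by (auto simp: dual_cartan_basis_def basis_family_def)
  have "hc a = (\<Sum>b\<in>range H. sg (V.representation (range H) (hc a) b) b)"
    using V.sum_representation_eq [OF indep, of "hc a" "range H"] span hc_in_h by simp
  also have "\<dots> = 0" by (rule sum.neutral) (auto simp: coeff)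
  finally show False using hc_nonzero by blast
qed

text \<open>
  The polynomial \<open>c\<close> is invariant under the unit translations in all coordinates: in those of \<open>d\<close>
  by \<open>tau_d_error\<close> and in those of \<open>H\<close> because the \<open>x\<^sub>a\<close> act nontrivially.
\<close>
lemma d_error_eq:
  obtains a where "\<And>j r. d_error j r = pconst (- (of_int (r $ j) * (a + 1)))"
proof -
  obtain c where c: "\<And>j r. d_error j r = cscale (of_int (r $ j)) c"
    using d_error_linear by blast
  have inv_d: "tau s c = c" for s
    using tau_d_error [of s undefined "axis undefined 1"] by (simp add: c)
  have inv_h: "shift (root_shift a 1) c = c" for a
    by (rule weight_one_loop_vector(3) [OF H_x _ c rho_x_nonzero]) simp
  have "peval v c = peval (\<lambda>_. 0) c" for v
  proof (rule shift_invariant_coordinates [where S = UNIV])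
    fix k :: "'l + 'n"
    show "shift (\<lambda>i. if i = k then 1 else 0) c = c"
    proof (cases k)
      case (Inl a)
      have "(\<lambda>i :: 'l + 'n. if i = k then 1 else 0) = root_shift a 1"
        by (auto simp: root_shift_def Inl)
      then show ?thesis using inv_h by simp
    next
      case (Inr j)
      have "(\<lambda>i :: 'l + 'n. if i = k then 1 else 0) = degree_shift (axis j 1)"
        by (auto simp: degree_shift_def Inr axis_def split: sum.split)
      then show ?thesis using inv_d [of "axis j 1"] by (simp add: tau_eq_shift)
    qed
  qed simp
  then have "c = pconst (peval (\<lambda>_. 0) c)" by (intro peval_eqI) simp
  then obtain c0 where c0: "c = pconst c0" ..
  show ?thesis
    by (rule that [of "- c0 - 1"]) (simp add: c c0 cscale_pconst flip: pconst_mult)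
qed

end

section \<open>Setting the derivations to zero\<close>

definition drop_d :: "('l::finite + 'n::finite) cpoly \<Rightarrow> 'l cpoly" where
  "drop_d = psubst (\<lambda>v. case v of Inl i \<Rightarrow> pvar i | Inr j \<Rightarrow> 0)"

lemma drop_d_simps [simp]:
  fixes p q :: "('l::finite + 'n::finite) cpoly"
  shows "drop_d (p + q) = drop_d p + drop_d q" "drop_d (p - q) = drop_d p - drop_d q"
  "drop_d (p * q) = drop_d p * drop_d q" "drop_d (pconst c) = pconst c"
  "drop_d (cscale c p) = cscale c (drop_d p)"
  "drop_d (pvar (Inl i)) = pvar i" "drop_d (pvar (Inr j)) = 0" "drop_d (0 :: ('l + 'n) cpoly) = 0"
proof -
  have *: "drop_d (p + q) = drop_d p + drop_d q" for p q :: "('l + 'n) cpoly"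
    by (simp add: drop_d_def psubst_add)
  show "drop_d (p + q) = drop_d p + drop_d q" by (rule *)
  show "drop_d (p - q) = drop_d p - drop_d q" using * [of "p - q" q] by simp
  show "drop_d (0 :: ('l + 'n) cpoly) = 0" using * [of 0 0] by simp
  show "drop_d (p * q) = drop_d p * drop_d q" "drop_d (pconst c) = pconst c"
    "drop_d (cscale c p) = cscale c (drop_d p)"
    "drop_d (pvar (Inl i)) = pvar i" "drop_d (pvar (Inr j)) = 0"
    by (simp_all add: drop_d_def psubst_mult psubst_pconst cscale_pconst psubst_pvar)
qed

lemma Uh_incl_simps [simp]:
  "Uh_incl (p + q) = Uh_incl p + Uh_incl q" "Uh_incl (p * q) = Uh_incl p * Uh_incl q"
  "Uh_incl (pconst c) = pconst c" "Uh_incl (cscale c p) = cscale c (Uh_incl p)"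
  "Uh_incl (pvar i) = pvar (Inl i)" "Uh_incl 1 = 1" "Uh_incl 0 = 0"
  using psubst_pconst [of _ 0]
  by (simp_all add: Uh_incl_def psubst_add psubst_mult psubst_pconst cscale_pconst psubst_pvar
      psubst_1 pconst_0)

lemma drop_d_Uh_incl [simp]:
  fixes p :: "'l::finite cpoly"
  shows "drop_d (Uh_incl p :: ('l + 'n::finite) cpoly) = p"
  by (induction p rule: cpoly_induct) simp_all

text \<open>A polynomial that is invariant under the \<open>\<tau>\<^sup>r\<close> does not involve the \<open>d\<^sub>j\<close>.\<close>
lemma Uh_incl_drop_d:
  fixes p :: "('l::finite + 'n::finite) cpoly"
  assumes "\<And>r. tau r p = p"
  shows "Uh_incl (drop_d p) = p"
proof (rule peval_eqI)
  fix v :: "'l + 'n \<Rightarrow> complex"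
  have "peval v (Uh_incl (drop_d p)) = peval (\<lambda>k. case k of Inl i \<Rightarrow> v k | Inr j \<Rightarrow> 0) p"
    unfolding Uh_incl_def drop_d_def peval_psubst
    by (rule arg_cong [where f = "\<lambda>w. peval w p"]) (auto split: sum.split)
  also have "\<dots> = peval v p"
  proof (rule shift_invariant_coordinates [where S = "range Inr"])
    fix k :: "'l + 'n" assume "k \<in> range Inr"
    then obtain j where k: "k = Inr j" by auto
    have "(\<lambda>i :: 'l + 'n. if i = k then 1 else 0) = degree_shift (axis j 1)"
      by (auto simp: degree_shift_def k axis_def split: sum.split)
    then show "shift (\<lambda>i. if i = k then 1 else 0) p = p"
      using assms [of "axis j 1"] by (simp add: tau_eq_shift)
  qed (auto split: sum.split)
  finally show "peval v (Uh_incl (drop_d p)) = peval v p" .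
qed

context normalized_module
begin

definition actg :: "'g \<Rightarrow> 'l cpoly \<Rightarrow> 'l cpoly" where
  "actg z p = drop_d (\<rho> (tor_loop z 0) (Uh_incl p))"

text \<open>
  Since \<open>\<gg>\<close> commutes with the \<open>d\<^sub>j\<close>, the ideal they generate is a \<open>\<gg>\<close>-submodule, and \<open>actg\<close> is
  the action on the quotient.
\<close>
lemma drop_d_rho: "drop_d (\<rho> (tor_loop z 0) g) = actg z (drop_d g)"
proof (induction g arbitrary: z rule: cpoly_induct)
  case (const c)
  show ?case by (simp add: actg_def)
next
  case (add p q)
  then show ?case by (simp add: actg_def)
next
  case (mult v p)
  have comm: "\<rho> (tor_loop z 0) (pvar v * p)
      = pvar v * \<rho> (tor_loop z 0) p - \<rho> (tor_bracket sg br c1 c2 (htilde_basis H v) (tor_loop z 0)) p" for p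
    unfolding rho_bracket by (simp add: rho_basis)
  show ?case
  proof (cases v)
    case (Inl i)
    have br: "tor_bracket sg br c1 c2 (htilde_basis H (Inl i)) (tor_loop z (0 :: int ^ 'n))
        = tor_loop (br (H i) z) 0"
      by (simp add: htilde_basis_def tor_bracket_degree_zero [OF lie])
    show ?thesis
      using comm [of p] comm [of "Uh_incl (drop_d p)"] mult [of z] mult [of "br (H i) z"]
      by (simp add: br actg_def Inl)
  next
    case (Inr j)
    have "tor_bracket sg br c1 c2 (htilde_basis H v) (tor_loop z 0) = tor_scale sg 0 (tor_loop z 0)"
      by (simp add: Inr htilde_basis_def tor_bracket_degree_zero [OF lie] tor_scale_simps [OF lie])
    then show ?thesis using comm [of p] by (simp add: actg_def Inr)
  qed
qed

lemma actg_normalized: "category_M_normalized sg br h H actg"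
proof -
  have H: "actg (H i) p = pvar i * p" for i p
    using rho_basis [of "Inl i" "Uh_incl p"] by (simp add: actg_def htilde_basis_def)
  have lin1: "Vector_Spaces.linear cscale cscale (actg z)" for z
    by (rule Vector_Spaces.linear_iff [THEN iffD2]) 
       (auto simp: actg_def vector_space_cscale)
  have lin2: "Vector_Spaces.linear sg cscale (\<lambda>z. actg z p)" for p
    by (rule Vector_Spaces.linear_iff [THEN iffD2]) 
       (auto simp: actg_def vector_space_cscale V.vector_space_axioms
         tor_loop_linear [OF lie] simp flip: tor_scale_simps(1) [OF lie])
  have "actg (br z w) p = actg z (actg w p) - actg w (actg z p)" for z w p
  proof -
    have "actg (br z w) p
        = drop_d (\<rho> (tor_bracket sg br c1 c2 (tor_loop z 0) (tor_loop w 0)) (Uh_incl p))"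
      by (simp add: actg_def tor_bracket_degree_zero [OF lie])
    then show ?thesis
      by (simp add: rho_bracket drop_d_rho)
  qed
  then have "lie_module sg br cscale actg"
    using lin1 lin2 by (simp add: lie_module_def)
  moreover have "free_rank_one H cscale actg"
    unfolding free_rank_one_def
    by (rule exI [of _ id]) (auto simp: H vector_space.linear_id [OF vector_space_cscale])
  ultimately show ?thesis
    using cartan dual abelian H
    by (auto simp: category_M_normalized_def category_M_def cartan_subalgebra_def dual_cartan_basis_def)
qed

lemma Lpow_character: "Lpow (\<chi> j. character (axis j 1)) r = character r"
proof -
  have axis_add: "axis j (k + l) = axis j k + (axis j l :: int ^ 'n)" for j k l
    by (simp add: axis_def Finite_Cartesian_Product.vec_eq_iff)
  have pow: "character (axis j k) = character (axis j 1) powi k" for j k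
  proof (induction k rule: int_induct [where k = 0])
    case base
    have "axis j 0 = (0 :: int ^ 'n)" by (simp add: axis_def Finite_Cartesian_Product.vec_eq_iff)
    then show ?case by (simp only: character_zero power_int_0_right)
  next
    case (step1 k)
    then show ?case using character_nonzero by (simp add: axis_add character_add power_int_add)
  next
    case (step2 k)
    have "character (axis j k) = character (axis j (k - 1)) * character (axis j 1)"
      using axis_add [of j "k - 1" 1] by (simp add: character_add)
    then show ?case using step2 character_nonzero by (simp add: power_int_diff field_simps)
  qed
  have prod: "character (\<Sum>j\<in>X. axis j (r $ j)) = (\<Prod>j\<in>X. character (axis j (r $ j)))" for X
    by (induction X rule: infinite_finite_induct) (simp_all add: character_zero character_add)
  have decomp: "(\<Sum>j\<in>UNIV. axis j (r $ j)) = r"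
    by (simp add: Finite_Cartesian_Product.vec_eq_iff axis_def if_distrib cong: if_cong)
  have "character r = (\<Prod>j\<in>UNIV. character (axis j (r $ j)))"
    using prod [of UNIV] by (simp only: decomp)
  also have "\<dots> = (\<Prod>j\<in>UNIV. character (axis j 1) powi (r $ j))"
    by (intro prod.cong refl pow)
  finally show ?thesis by (simp add: Lpow_def)
qed

lemma is_Mhat_rho:
  obtains a where "is_Mhat sg br c1 c2 h x y H (\<chi> j. character (axis j 1)) a actg \<rho>"
proof -
  obtain a where a: "\<And>j r. d_error j r = pconst (- (of_int (r $ j) * (a + 1)))"
    using d_error_eq by blast
  obtain c where c: "\<And>j r. d_error j r = cscale (of_int (r $ j)) c"
    using d_error_linear by blast
  have incl: "Uh_incl (actg z 1) = \<rho> (tor_loop z 0) 1"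
    if "\<And>r. tau r (\<rho> (tor_loop z 0) 1) = \<rho> (tor_loop z 0) 1" for z
    using Uh_incl_drop_d [OF that] by (simp add: actg_def)
  have 1: "(1 :: complex) * 1 = 1" "(- 1 :: complex) * - 1 = 1" by simp_all
  have x: "\<rho> (tor_loop (x i) r) g
      = cscale (character r) (sigma i (tau r g) * Uh_incl (actg (x i) 1))" for i r g
  proof -
    have "(sigma i :: ('l + 'n) cpoly \<Rightarrow> _) = shift (root_shift i 1)"
      by (simp add: sigma_def root_shift_def [abs_def])
    then show ?thesis
      by (simp add: incl [OF weight_one_loop_vector(2) [OF H_x 1(1) c]]
          weight_one_loop_vector(1) [OF H_x 1(1) c, of i r g])
  qed
  have y: "\<rho> (tor_loop (y i) r) g
      = cscale (character r) (inv_into UNIV (sigma i) (tau r g) * Uh_incl (actg (y i) 1))" for i r g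
  proof -
    have "inv_into UNIV (sigma i :: ('l + 'n) cpoly \<Rightarrow> _) = shift (root_shift i (- 1))"
      by (simp add: inv_sigma root_shift_def [abs_def])
    then show ?thesis
      by (simp add: incl [OF weight_one_loop_vector(2) [OF H_y 1(2) c]]
          weight_one_loop_vector(1) [OF H_y 1(2) c, of i r g])
  qed
  have d: "\<rho> (tor_d r j) g
      = cscale (character r) (tau r g * (pvar (Inr j) - pconst (of_int (r $ j) * (a + 1))))" for r j g
    using rho_d [of r j g] by (simp only: rho_d_eq a pconst_uminus mult_cscale) simp
  have "is_Mhat sg br c1 c2 h x y H (\<chi> j. character (axis j 1)) a actg \<rho>"
    unfolding is_Mhat_def Lpow_character
    using lie_mod rho_K cartan_poly_action x y d by blast
  then show ?thesis by (rule that)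
qed

end

theorem theorem5p5:
  fixes sg :: "complex \<Rightarrow> 'g::ab_group_add \<Rightarrow> 'g"
    and br :: "'g \<Rightarrow> 'g \<Rightarrow> 'g"
    and h :: "'g set"
    and x y hc H :: "'l::finite \<Rightarrow> 'g"
    and c1 c2 :: complex
    and sM :: "complex \<Rightarrow> 'm::ab_group_add \<Rightarrow> 'm"
    and act :: "('g, 'n::finite) toroidal \<Rightarrow> 'm \<Rightarrow> 'm"
  assumes "simple_lie_algebra sg br" and "finite_dim sg"
    and "cartan_subalgebra sg br h"
    and "chevalley_generators sg br h x y hc"
    and "dual_cartan_basis sg br h x y H"
    and "category_M (tor_scale sg) (tor_bracket sg br c1 c2) (htilde sg h) (htilde_basis H) sM act"
  shows "\<exists>(\<Lambda> :: complex ^ 'n) (a :: complex) actg \<rho>.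
           (\<forall>j. \<Lambda> $ j \<noteq> 0) \<and>
           category_M_normalized sg br h H actg \<and>
           is_Mhat sg br c1 c2 h x y H \<Lambda> a actg \<rho> \<and>
           (\<exists>F. lie_module_iso sM act cscale \<rho> F)"
proof -
  have lie: "lie_algebra sg br" using assms(1) by (simp add: simple_lie_algebra_def)
  interpret V: vector_space sg by (rule lie_algebra_vector_space [OF lie])
  have mod: "lie_module (tor_scale sg) (tor_bracket sg br c1 c2) sM act"
    and free: "free_rank_one (htilde_basis H) sM act"
    and comm: "\<And>X Y :: ('g, 'n) toroidal. X \<in> htilde sg h \<Longrightarrow> Y \<in> htilde sg h \<Longrightarrow> tor_bracket sg br c1 c2 X Y = 0"
    using assms(6) unfolding category_M_def by blast+
  obtain \<Phi> :: "('l + 'n) cpoly \<Rightarrow> 'm" where \<Phi>: "Vector_Spaces.linear cscale sM \<Phi>" "bij \<Phi>"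
    "\<And>v p. \<Phi> (pvar v * p) = act (htilde_basis H v) (\<Phi> p)"
    using free unfolding free_rank_one_def by blast
  define F where "F = inv_into UNIV \<Phi>"
  have F\<Phi>: "F (\<Phi> p) = p" and \<Phi>F: "\<Phi> (F m) = m" for p m
    using \<Phi>(2) by (simp_all add: F_def bij_is_inj bij_is_surj inv_f_f surj_f_inv_f)
  interpret \<Phi>: Vector_Spaces.linear cscale sM \<Phi> by (rule \<Phi>(1))
  interpret A: Vector_Spaces.linear sM sM "act X" for X
    using mod unfolding lie_module_def by blast
  interpret B: Vector_Spaces.linear "tor_scale sg" sM "\<lambda>X. act X m" for m
    using mod unfolding lie_module_def by blast
  have F_add: "F (m + m') = F m + F m'" for m m'
    by (metis F\<Phi> \<Phi>F \<Phi>.add)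
  have F_scale: "F (sM c m) = cscale c (F m)" for c m
    by (metis F\<Phi> \<Phi>F \<Phi>.scale)
  have F_diff: "F (m - m') = F m - F m'" for m m'
    by (metis F\<Phi> \<Phi>F \<Phi>.diff)
  define \<rho> where "\<rho> X p = F (act X (\<Phi> p))" for X p
  have "Vector_Spaces.linear cscale cscale (\<rho> X)" for X
    by (rule Vector_Spaces.linear_iff [THEN iffD2])
       (auto simp: \<rho>_def vector_space_cscale \<Phi>.add \<Phi>.scale A.add A.scale F_add F_scale)
  moreover have "Vector_Spaces.linear (tor_scale sg) cscale (\<lambda>X. \<rho> X p)" for p
    by (rule Vector_Spaces.linear_iff [THEN iffD2])
       (auto simp: \<rho>_def vector_space_cscale B.vs1.vector_space_axioms
         B.add B.scale F_add F_scale simp del: split_paired_All)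
  moreover have "\<rho> (tor_bracket sg br c1 c2 X Y) p = \<rho> X (\<rho> Y p) - \<rho> Y (\<rho> X p)" for X Y p
  proof -
    have "act (tor_bracket sg br c1 c2 X Y) (\<Phi> p) = act X (act Y (\<Phi> p)) - act Y (act X (\<Phi> p))"
      using mod unfolding lie_module_def by blast
    then show ?thesis by (simp add: \<rho>_def \<Phi>F F_diff)
  qed
  ultimately have lie_mod: "lie_module (tor_scale sg) (tor_bracket sg br c1 c2) cscale \<rho>"
    unfolding lie_module_def by blast
  have abelian: "br z w = 0" if "z \<in> h" "w \<in> h" for z w
  proof -
    have mem: "(tor_loop z 0 :: ('g, 'n) toroidal) \<in> htilde sg h" if "z \<in> h" for z
    proof -
      have "tor_scale sg 0 X = (0 :: ('g, 'n) toroidal)" for X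
        using B.vs1.scale_zero_left by blast
      then show ?thesis
        unfolding htilde_def using that
        by (intro CollectI exI [of _ z] exI [of _ "\<lambda>_. 0"]) simp
    qed
    have "tor_loop (br z w) (0 :: int ^ 'n) = 0"
      using comm [OF mem mem] that tor_bracket_degree_zero(1) [OF lie] by metis
    then have "Poly_Mapping.single (0 :: int ^ 'n) (br z w) = 0"
      by (simp add: tor_loop_def zero_prod_def)
    then show ?thesis by (metis lookup_single_eq lookup_zero)
  qed
  interpret normalized_module sg br h x y hc H c1 c2 \<rho>
    using lie assms(2-5) abelian lie_mod
    by unfold_locales (auto simp: \<rho>_def F\<Phi> simp flip: \<Phi>(3))
  obtain a where a: "is_Mhat sg br c1 c2 h x y H (\<chi> j. character (axis j 1)) a actg \<rho>"
    by (rule is_Mhat_rho)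
  have "Vector_Spaces.linear sM cscale F"
    by (rule Vector_Spaces.linear_iff [THEN iffD2])
       (auto simp: vector_space_cscale \<Phi>.vs2.vector_space_axioms F_add F_scale)
  moreover have "bij F" unfolding F_def using \<Phi>(2) by (rule bij_imp_bij_inv)
  ultimately have "lie_module_iso sM act cscale \<rho> F"
    unfolding lie_module_iso_def by (simp add: \<rho>_def \<Phi>F)
  moreover have "\<forall>j. (\<chi> j. character (axis j 1)) $ j \<noteq> 0" using character_nonzero by simp
  ultimately show ?thesis using actg_normalized a by blast
qed

end
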